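(* (Foliated tubular neighborhood theorem.) Let $M$ be a manifold, $W\subset TM$ an integrable distribution, and $N$ a submanifold of $M$ complementary to $W$ in the sense that $W|_N\oplus TN=TM|_N$. Then there exist an open neighborhood $U$ of $N$ in $M$ and a diffeomorphism $\phi$ from $U$ onto an open subset of $W|_N$ containing the zero section, such that: (a) $\phi|_N=\mathrm{id}_N$; (b) the differential of $\phi$ at any point of $N$ is the identity; (c) for all $p\in N$, $\phi$ maps the leaf of the foliation defined by $W$ passing through $p$ to $\phi(U)\cap W|_p$, i.e. to the fiber over $p$ of $W|_N\to N$, intersected with $\phi(U)$.
   Context: All manifolds are smooth. $W|_N\to N$ denotes the restriction of the vector bundle $W$ to $N$, and $W|_p$ its fiber over $p$. The submanifold $N$ is identified with the zero section of $W|_N$; for $x\in N$, the tangent space at $x$ of the total space of $W|_N$ is identified with $T_xN\oplus W|_x=T_xM$, which gives meaning to (a) and (b). The foliation defined by $W$ is the foliation of $M$ whose leaves are tangent to $W$.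
   Formalization: In (c), "the leaf through p" is taken as the leaf through p of the foliation induced by W on U; with leaves of M, (c) fails whenever a leaf meets N more than once (irrational foliation of a torus, N a transverse circle). Submanifold means embedded submanifold. *)

theory Defs
  imports "HOL-Analysis.Analysis"
begin

section \<open>Smooth maps between subsets of Euclidean spaces\<close>

text \<open>\<open>Ck_on k S f\<close> is meant for open \<open>S\<close>.\<close>

primrec Ck_on :: "nat \<Rightarrow> 'e::real_normed_vector set \<Rightarrow> ('e \<Rightarrow> 'f::real_normed_vector) \<Rightarrow> bool" where
  "Ck_on 0 S f \<longleftrightarrow> continuous_on S f"
| "Ck_on (Suc k) S f \<longleftrightarrow>
     (\<forall>x\<in>S. f differentiable (at x)) \<and> (\<forall>v. Ck_on k S (\<lambda>x. frechet_derivative f (at x) v))"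

text \<open>Smoothness on an arbitrary subset: local extendability to a \<open>C\<^sup>\<infinity>\<close> map on an open set.
  For a relatively open subset of a linear subspace this is ordinary smoothness.\<close>

definition smooth_on :: "'e::real_normed_vector set \<Rightarrow> ('e \<Rightarrow> 'f::real_normed_vector) \<Rightarrow> bool" where
  "smooth_on S f \<longleftrightarrow>
     (\<forall>x\<in>S. \<exists>G g. open G \<and> x \<in> G \<and> (\<forall>k. Ck_on k G g) \<and> (\<forall>y\<in>G \<inter> S. g y = f y))"

text \<open>The derivative of \<open>g\<close> at \<open>x\<close> in direction \<open>v\<close>. Only the line through \<open>x\<close> enters, so this is
  also meaningful for \<open>g\<close> defined on a relatively open subset of a linear subspace containing \<open>v\<close>.\<close>

definition dir_deriv :: "('e::real_normed_vector \<Rightarrow> 'f::real_normed_vector) \<Rightarrow> 'e \<Rightarrow> 'e \<Rightarrow> 'f" where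
  "dir_deriv g x v = vector_derivative (\<lambda>t. g (x + t *\<^sub>R v)) (at 0)"


section \<open>Smooth manifolds\<close>

text \<open>Charts take values in a linear subspace \<open>E\<close> of a Euclidean space; the dimension of the
  manifold is \<^term>\<open>dim E\<close>. Allowing a proper subspace (in particular \<open>{0}\<close>) lets one type serve for
  manifolds of all dimensions, including dimension zero. The map of a chart is irrelevant outside
  its domain.\<close>

type_synonym ('a, 'e) chart = "'a set \<times> ('a \<Rightarrow> 'e)"

definition chart_inv :: "('a, 'e) chart \<Rightarrow> 'e \<Rightarrow> 'a" where
  "chart_inv c = inv_into (fst c) (snd c)"

definition smooth_atlas ::
  "'e::euclidean_space set \<Rightarrow> 'a topology \<Rightarrow> ('a, 'e) chart set \<Rightarrow> bool" where
  "smooth_atlas E X A \<longleftrightarrow>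
     (\<forall>c\<in>A. openin X (fst c) \<and> openin (top_of_set E) (snd c ` fst c) \<and>
        homeomorphic_map (subtopology X (fst c)) (top_of_set (snd c ` fst c)) (snd c)) \<and>
     (\<Union>c\<in>A. fst c) = topspace X \<and>
     (\<forall>c\<in>A. \<forall>d\<in>A. smooth_on (snd c ` (fst c \<inter> fst d)) (snd d \<circ> chart_inv c))"

definition smooth_manifold ::
  "'e::euclidean_space set \<Rightarrow> 'a topology \<Rightarrow> ('a, 'e) chart set \<Rightarrow> bool" where
  "smooth_manifold E X A \<longleftrightarrow>
     subspace E \<and> Hausdorff_space X \<and> second_countable X \<and> smooth_atlas E X A \<and>
     (\<forall>c. smooth_atlas E X (insert c A) \<longrightarrow> c \<in> A)"

text \<open>Smooth maps from an arbitrary subset \<open>S\<close> of a manifold with atlas \<open>A\<close> to a manifold with atlas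
  \<open>B\<close>, in the sense of local smooth extendability. If \<open>S\<close> is open or, more generally, an embedded
  submanifold, this is smoothness for the induced smooth structure on \<open>S\<close>; likewise a map is smooth
  into an embedded submanifold iff it is smooth as a map into the ambient manifold.\<close>

definition smooth_map_on ::
  "'a topology \<Rightarrow> ('a, 'e::euclidean_space) chart set \<Rightarrow> ('b, 'f::euclidean_space) chart set \<Rightarrow>
   'a set \<Rightarrow> ('a \<Rightarrow> 'b) \<Rightarrow> bool" where
  "smooth_map_on X A B S f \<longleftrightarrow>
     (\<forall>p\<in>S. \<exists>c\<in>A. \<exists>d\<in>B. \<exists>G. openin X G \<and> p \<in> G \<and> G \<subseteq> fst c \<and> f ` (G \<inter> S) \<subseteq> fst d \<and>
        smooth_on (snd c ` (G \<inter> S)) (snd d \<circ> f \<circ> chart_inv c))"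

definition diffeomorphism_on ::
  "'a topology \<Rightarrow> ('a, 'e::euclidean_space) chart set \<Rightarrow>
   'b topology \<Rightarrow> ('b, 'f::euclidean_space) chart set \<Rightarrow> 'a set \<Rightarrow> 'b set \<Rightarrow> ('a \<Rightarrow> 'b) \<Rightarrow> bool" where
  "diffeomorphism_on X A Y B S T f \<longleftrightarrow>
     bij_betw f S T \<and> smooth_map_on X A B S f \<and> smooth_map_on Y B A T (inv_into S f)"


section \<open>Tangent vectors\<close>

text \<open>A tangent vector at \<open>p\<close> is the family of its coordinate vectors in the charts around \<open>p\<close>,
  related by the derivatives of the transition maps, and extended by 0 to all other charts.
  Vector space operations are pointwise.\<close>

type_synonym ('a, 'e) tvec = "('a, 'e) chart \<Rightarrow> 'e"

definition tangent_space ::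
  "'e::euclidean_space set \<Rightarrow> ('a, 'e) chart set \<Rightarrow> 'a \<Rightarrow> ('a, 'e) tvec set" where
  "tangent_space E A p =
     {v. (\<forall>c. \<not> (c \<in> A \<and> p \<in> fst c) \<longrightarrow> v c = 0) \<and>
         (\<forall>c\<in>A. p \<in> fst c \<longrightarrow> v c \<in> E) \<and>
         (\<forall>c\<in>A. \<forall>d\<in>A. p \<in> fst c \<and> p \<in> fst d \<longrightarrow>
            v d = dir_deriv (snd d \<circ> chart_inv c) (snd c p) (v c))}"

definition tzero :: "('a, 'e::euclidean_space) tvec" where
  "tzero = (\<lambda>c. 0)"

definition tadd :: "('a, 'e::euclidean_space) tvec \<Rightarrow> ('a, 'e) tvec \<Rightarrow> ('a, 'e) tvec" where
  "tadd v w = (\<lambda>c. v c + w c)"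

definition tscale :: "real \<Rightarrow> ('a, 'e::euclidean_space) tvec \<Rightarrow> ('a, 'e) tvec" where
  "tscale r v = (\<lambda>c. r *\<^sub>R v c)"

text \<open>The velocity at time 0 of a curve, and the differential of a map at \<open>p\<close>. The latter does not
  depend on the chart \<open>c\<close> chosen around \<open>p\<close> if the map is smooth near \<open>p\<close>.\<close>

definition velocity ::
  "('a, 'e::euclidean_space) chart set \<Rightarrow> (real \<Rightarrow> 'a) \<Rightarrow> ('a, 'e) tvec" where
  "velocity A \<gamma> =
     (\<lambda>c. if c \<in> A \<and> \<gamma> 0 \<in> fst c then vector_derivative (snd c \<circ> \<gamma>) (at 0) else 0)"

definition differential ::
  "('a, 'e::euclidean_space) chart set \<Rightarrow> ('b, 'f::euclidean_space) chart set \<Rightarrow>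
   ('a \<Rightarrow> 'b) \<Rightarrow> 'a \<Rightarrow> ('a, 'e) tvec \<Rightarrow> ('b, 'f) tvec" where
  "differential A B f p v =
     (let c = (SOME c. c \<in> A \<and> p \<in> fst c) in
      (\<lambda>d. if d \<in> B \<and> f p \<in> fst d then dir_deriv (snd d \<circ> f \<circ> chart_inv c) (snd c p) (v c) else 0))"


section \<open>Embedded submanifolds\<close>

definition embedded_submanifold ::
  "'e::euclidean_space set \<Rightarrow> 'a topology \<Rightarrow> ('a, 'e) chart set \<Rightarrow> nat \<Rightarrow> 'a set \<Rightarrow> bool" where
  "embedded_submanifold E X A n N \<longleftrightarrow>
     N \<subseteq> topspace X \<and>
     (\<forall>p\<in>N. \<exists>c\<in>A. \<exists>F. p \<in> fst c \<and> subspace F \<and> F \<subseteq> E \<and> dim F = n \<and>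
        snd c ` (fst c \<inter> N) = snd c ` fst c \<inter> F)"

text \<open>The tangent space of an embedded submanifold \<open>N\<close>, as a subspace of the ambient tangent space:
  velocities of smooth curves in \<open>N\<close>.\<close>

definition sub_tangent_space ::
  "('a, 'e::euclidean_space) chart set \<Rightarrow> 'a set \<Rightarrow> 'a \<Rightarrow> ('a, 'e) tvec set" where
  "sub_tangent_space A N p =
     {velocity A \<gamma> | \<gamma>. \<gamma> 0 = p \<and>
        (\<exists>c\<in>A. \<exists>\<epsilon>>0. \<gamma> ` {-\<epsilon><..<\<epsilon>} \<subseteq> fst c \<inter> N \<and> smooth_on {-\<epsilon><..<\<epsilon>} (snd c \<circ> \<gamma>))}"


section \<open>The tangent bundle\<close>

definition tangent_bundle ::
  "'e::euclidean_space set \<Rightarrow> 'a topology \<Rightarrow> ('a, 'e) chart set \<Rightarrow> ('a \<times> ('a, 'e) tvec) set" where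
  "tangent_bundle E X A = (SIGMA p:topspace X. tangent_space E A p)"

definition tb_chart ::
  "'e::euclidean_space set \<Rightarrow> ('a, 'e) chart set \<Rightarrow> ('a, 'e) chart \<Rightarrow>
   ('a \<times> ('a, 'e) tvec, 'e \<times> 'e) chart" where
  "tb_chart E A c = ((SIGMA p:fst c. tangent_space E A p), (\<lambda>(p, v). (snd c p, v c)))"

definition tb_atlas ::
  "'e::euclidean_space set \<Rightarrow> ('a, 'e) chart set \<Rightarrow> ('a \<times> ('a, 'e) tvec, 'e \<times> 'e) chart set" where
  "tb_atlas E A = tb_chart E A ` A"

definition tb_topology ::
  "'e::euclidean_space set \<Rightarrow> ('a, 'e) chart set \<Rightarrow> ('a \<times> ('a, 'e) tvec) topology" where
  "tb_topology E A =
     topology_generated_by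
       {{z \<in> fst C. snd C z \<in> G} | C G. C \<in> tb_atlas E A \<and> open G}"

definition zero_section :: "'a \<Rightarrow> 'a \<times> ('a, 'e::euclidean_space) tvec" where
  "zero_section p = (p, tzero)"

text \<open>The tangent vector at the zero vector over \<open>p\<close> of the total space of the tangent bundle which
  corresponds to \<open>b\<close> under the identification of a vector space with its own tangent space at 0.\<close>

definition vertical_lift ::
  "'e::euclidean_space set \<Rightarrow> ('a, 'e) chart set \<Rightarrow> 'a \<Rightarrow> ('a, 'e) tvec \<Rightarrow>
   ('a \<times> ('a, 'e) tvec, 'e \<times> 'e) tvec" where
  "vertical_lift E A p b = velocity (tb_atlas E A) (\<lambda>t. (p, tscale t b))"


section \<open>Distributions, foliations and leaves\<close>

text \<open>Smooth subbundles of rank \<open>k\<close> of the tangent bundle, i.e. spanned near each point by \<open>k\<close>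
  smooth, linearly independent vector fields, here given by their components in a chart.\<close>

definition distribution ::
  "'e::euclidean_space set \<Rightarrow> 'a topology \<Rightarrow> ('a, 'e) chart set \<Rightarrow> nat \<Rightarrow>
   ('a \<Rightarrow> ('a, 'e) tvec set) \<Rightarrow> bool" where
  "distribution E X A k W \<longleftrightarrow>
     (\<forall>p\<in>topspace X. W p \<subseteq> tangent_space E A p) \<and>
     (\<forall>p\<in>topspace X. \<exists>c\<in>A. \<exists>G. \<exists>V :: nat \<Rightarrow> 'e \<Rightarrow> 'e.
        openin X G \<and> p \<in> G \<and> G \<subseteq> fst c \<and> (\<forall>i<k. smooth_on (snd c ` G) (V i)) \<and>
        (\<forall>q\<in>G. (\<lambda>v. v c) ` W q = span ((\<lambda>i. V i (snd c q)) ` {..<k}) \<and>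
               dim ((\<lambda>v. v c) ` W q) = k))"

text \<open>A foliation is given by a foliated atlas \<open>\<F>\<close>: its charts have the translates of \<open>F\<close> as plaques,
  and the transition maps locally send plaques into plaques.\<close>

definition foliated_atlas ::
  "'e::euclidean_space set \<Rightarrow> 'a topology \<Rightarrow> ('a, 'e) chart set \<Rightarrow> 'e set \<Rightarrow>
   ('a, 'e) chart set \<Rightarrow> bool" where
  "foliated_atlas E X A F \<F> \<longleftrightarrow>
     subspace F \<and> F \<subseteq> E \<and> \<F> \<subseteq> A \<and> (\<Union>c\<in>\<F>. fst c) = topspace X \<and>
     (\<forall>c\<in>\<F>. \<forall>d\<in>\<F>. \<forall>p\<in>fst c \<inter> fst d. \<exists>G. openin X G \<and> p \<in> G \<and> G \<subseteq> fst c \<inter> fst d \<and>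
        (\<forall>q\<in>G. \<forall>r\<in>G. snd c q - snd c r \<in> F \<longrightarrow> snd d q - snd d r \<in> F))"

text \<open>Integrable means tangent to a foliation.\<close>

definition integrable_distribution ::
  "'e::euclidean_space set \<Rightarrow> 'a topology \<Rightarrow> ('a, 'e) chart set \<Rightarrow>
   ('a \<Rightarrow> ('a, 'e) tvec set) \<Rightarrow> bool" where
  "integrable_distribution E X A W \<longleftrightarrow>
     (\<exists>F \<F>. foliated_atlas E X A F \<F> \<and> (\<forall>c\<in>\<F>. \<forall>q\<in>fst c. (\<lambda>v. v c) ` W q = F))"

text \<open>Connected integral manifolds of \<open>W\<close> contained in \<open>U\<close>: connected manifolds \<open>Y\<close> with their own
  topology and smooth structure, whose underlying set is a subset of \<open>U\<close>, such that the inclusion is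
  an immersion with image \<open>W\<close> on tangent spaces.\<close>

definition connected_integral_manifold ::
  "'e::euclidean_space set \<Rightarrow> 'a topology \<Rightarrow> ('a, 'e) chart set \<Rightarrow>
   ('a \<Rightarrow> ('a, 'e) tvec set) \<Rightarrow> 'a set \<Rightarrow> 'a topology \<Rightarrow> bool" where
  "connected_integral_manifold E X A W U Y \<longleftrightarrow>
     topspace Y \<subseteq> U \<and> connected_space Y \<and>
     (\<exists>(F :: 'e set) B. smooth_manifold F Y B \<and> smooth_map_on Y B A (topspace Y) id \<and>
        (\<forall>q\<in>topspace Y. bij_betw (differential B A id q) (tangent_space F B q) (W q)))"

text \<open>The leaf through \<open>p\<close> of the foliation which \<open>W\<close> defines on the open set \<open>U\<close>: the maximal
  connected integral manifold through \<open>p\<close> in \<open>U\<close>. For \<open>U\<close> the whole manifold, these are the leaves of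
  the foliation itself; for smaller \<open>U\<close> they can be smaller than the intersections of those with \<open>U\<close>.\<close>

definition leaf_in ::
  "'e::euclidean_space set \<Rightarrow> 'a topology \<Rightarrow> ('a, 'e) chart set \<Rightarrow>
   ('a \<Rightarrow> ('a, 'e) tvec set) \<Rightarrow> 'a set \<Rightarrow> 'a \<Rightarrow> 'a set" where
  "leaf_in E X A W U p =
     \<Union>{topspace Y | Y. connected_integral_manifold E X A W U Y \<and> p \<in> topspace Y}"

definition complementary ::
  "'e::euclidean_space set \<Rightarrow> ('a, 'e) chart set \<Rightarrow> ('a \<Rightarrow> ('a, 'e) tvec set) \<Rightarrow> 'a set \<Rightarrow> bool" where
  "complementary E A W N \<longleftrightarrow>
     (\<forall>p\<in>N. W p \<inter> sub_tangent_space A N p = {tzero} \<and>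
        {tadd w a | w a. w \<in> W p \<and> a \<in> sub_tangent_space A N p} = tangent_space E A p)"

text \<open>The total space of the restriction of \<open>W\<close> to \<open>N\<close>, an embedded submanifold of the
  tangent bundle if \<open>W\<close> is a distribution and \<open>N\<close> an embedded submanifold.\<close>

definition restricted_bundle ::
  "('a \<Rightarrow> ('a, 'e::euclidean_space) tvec set) \<Rightarrow> 'a set \<Rightarrow> ('a \<times> ('a, 'e) tvec) set" where
  "restricted_bundle W N = (SIGMA p:N. W p)"

end

theory Submission
  imports Defs
begin

text \<open>
  Near a point of \<open>N\<close> there is a foliated chart \<open>c\<close> in which \<open>N\<close> is the orthogonal complement of the
  model space \<open>F\<close> of \<open>W\<close>. With \<open>P\<close> the orthogonal projection onto \<open>F\<close> and \<open>Q = 1 - P\<close>, such a chart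
  gives a local projection \<open>c\<^sup>-\<^sup>1 \<circ> Q \<circ> c\<close> onto \<open>N\<close> along the plaques and, for each point of \<open>N\<close>, a map from
  the plaque through it to the fibre of \<open>W\<close> with coordinates \<open>P \<circ> c\<close>. On a neighbourhood of \<open>N\<close> the
  local projections agree, giving \<open>\<pi>\<close>; a partition of unity combines the local maps to the fibres
  into one map \<open>h\<close> with \<open>h x \<in> W (\<pi> x)\<close>. No exponential map is needed because the fibres are vector
  spaces. In an adapted chart, \<open>\<phi> = (\<pi>, h)\<close> is the identity on \<open>N\<close> with identity differential there,
  so by the inverse function theorem it is a local diffeomorphism near \<open>N\<close>; since it preserves
  fibres, shrinking makes it injective with fibrewise starshaped image. The leaf through \<open>p \<in> N\<close> is the
  fibre of \<open>\<pi>\<close>: this fibre is a connected integral manifold, and \<open>\<pi>\<close> is locally constant on every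
  integral manifold.
\<close>

subsection \<open>Smooth maps\<close>

text \<open>Two features of the averaging shape the construction. Local fibre maps can be added only
  where the local projections agree, since otherwise their values lie in different fibres; hence the
  care about domains. And averaging does not spoil the differential on \<open>N\<close>: every local
  map vanishes there, so the derivatives of the weights get multiplied by zero, while each local
  map, transported to a common chart, has the identity as its derivative along the fibre, and the
  weights sum to 1. Leaves are taken inside the neighbourhood because a leaf of the whole manifold
  may meet \<open>N\<close> many times. Starshapedness of the image is what makes these leaves
  connected. Charts take values in a subspace \<open>E\<close>, so derivatives make sense only along
  \<open>E\<close>: they appear as directional derivatives or as derivatives within a relatively
  open set, and a map is extended to the surrounding space by orthogonal projection before it is
  inverted.\<close>

lemma Ck_on_cong:
  assumes "open S" "\<And>x. x \<in> S \<Longrightarrow> f x = g x"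
  shows "Ck_on k S f \<longleftrightarrow> Ck_on k S g"
  using assms
proof (induction k arbitrary: f g)
  case 0
  then show ?case by (simp cong: continuous_on_cong)
next
  case (Suc k)
  have d: "(f has_derivative D) (at x) \<longleftrightarrow> (g has_derivative D) (at x)" if "x \<in> S" for x D
    using has_derivative_transform_within_open[OF _ Suc.prems(1) that] Suc.prems(2) by metis
  have fd: "frechet_derivative f (at x) = frechet_derivative g (at x)" if "x \<in> S" for x
    unfolding frechet_derivative_def using d[OF that] by simp
  have "Ck_on k S (\<lambda>x. frechet_derivative f (at x) v) \<longleftrightarrow> Ck_on k S (\<lambda>x. frechet_derivative g (at x) v)" for v
    by (rule Suc.IH) (auto simp: Suc.prems fd)
  moreover have "f differentiable (at x) \<longleftrightarrow> g differentiable (at x)" if "x \<in> S" for x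
    unfolding differentiable_def using d[OF that] by simp
  ultimately show ?case by simp
qed

lemma Ck_on_subset: "Ck_on k S f \<Longrightarrow> T \<subseteq> S \<Longrightarrow> Ck_on k T f"
  by (induction k arbitrary: f) (auto intro: continuous_on_subset)

lemma Ck_on_SucD: "Ck_on (Suc k) S f \<Longrightarrow> Ck_on k S f"
proof (induction k arbitrary: f)
  case 0
  then show ?case
    by (auto intro!: continuous_at_imp_continuous_on differentiable_imp_continuous_within)
next
  case (Suc k)
  then show ?case by simp
qed

lemma Ck_on_SucI:
  assumes "open S" "\<And>x. x \<in> S \<Longrightarrow> (f has_derivative f' x) (at x)" "\<And>v. Ck_on k S (\<lambda>x. f' x v)"
  shows "Ck_on (Suc k) S f"
proof -
  have "Ck_on k S (\<lambda>x. frechet_derivative f (at x) v) \<longleftrightarrow> Ck_on k S (\<lambda>x. f' x v)" for v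
    by (rule Ck_on_cong[OF assms(1)]) (use frechet_derivative_at[OF assms(2)] in metis)
  then show ?thesis using assms by (auto simp: differentiable_def)
qed

lemma Ck_on_SucE:
  assumes "Ck_on (Suc k) S f"
  shows "\<And>x. x \<in> S \<Longrightarrow> (f has_derivative frechet_derivative f (at x)) (at x)"
    and "\<And>v. Ck_on k S (\<lambda>x. frechet_derivative f (at x) v)"
  using assms by (auto simp: frechet_derivative_works)

lemma Ck_on_local:
  assumes "\<And>x. x \<in> S \<Longrightarrow> \<exists>G. open G \<and> x \<in> G \<and> Ck_on k G f"
  shows "Ck_on k S f"
  using assms
proof (induction k arbitrary: f)
  case 0
  then show ?case
    by (auto intro!: continuous_at_imp_continuous_on) (metis continuous_on_eq_continuous_at)
next
  case (Suc k)
  have "f differentiable at x" if "x \<in> S" for x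
    using Suc.prems[OF that] by auto
  moreover have "Ck_on k S (\<lambda>x. frechet_derivative f (at x) v)" for v
    by (rule Suc.IH) (use Suc.prems in fastforce)
  ultimately show ?case by simp
qed

lemma Ck_on_const: "open S \<Longrightarrow> Ck_on k S (\<lambda>x. c)"
proof (induction k arbitrary: c)
  case (Suc k)
  show ?case by (rule Ck_on_SucI[where f'="\<lambda>x v. 0"]) (auto simp: Suc)
qed auto

lemma Ck_on_bounded_linear:
  assumes "open S" "bounded_linear L" "Ck_on k S f"
  shows "Ck_on k S (\<lambda>x. L (f x))"
  using assms(3)
proof (induction k arbitrary: f)
  case 0
  then show ?case using bounded_linear.continuous_on[OF assms(2)] by simp
next
  case (Suc k)
  note E = Ck_on_SucE[OF Suc.prems]
  show ?case
    by (rule Ck_on_SucI[where f'="\<lambda>x v. L (frechet_derivative f (at x) v)"])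
      (auto intro!: assms(1) Suc.IH E bounded_linear.has_derivative[OF assms(2)])
qed

lemma Ck_on_id: "open S \<Longrightarrow> Ck_on k S (\<lambda>x. x)"
proof (cases k)
  case (Suc j)
  assume "open S"
  then show ?thesis unfolding Suc
    by (intro Ck_on_SucI[where f'="\<lambda>x v. v"]) (auto intro: Ck_on_const)
qed auto

lemma Ck_on_add:
  assumes "open S" "Ck_on k S f" "Ck_on k S g"
  shows "Ck_on k S (\<lambda>x. f x + g x)"
  using assms(2,3)
proof (induction k arbitrary: f g)
  case 0
  then show ?case by (auto intro: continuous_intros)
next
  case (Suc k)
  note E = Ck_on_SucE[OF Suc.prems(1)] Ck_on_SucE[OF Suc.prems(2)]
  show ?case
    by (rule Ck_on_SucI[where f'="\<lambda>x v. frechet_derivative f (at x) v + frechet_derivative g (at x) v"])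
      (auto intro!: assms(1) Suc.IH E has_derivative_add)
qed

lemma Ck_on_sum:
  assumes "open S" "\<And>i. i \<in> I \<Longrightarrow> Ck_on k S (f i)"
  shows "Ck_on k S (\<lambda>x. \<Sum>i\<in>I. f i x)"
  using assms(2)
  by (induction I rule: infinite_finite_induct) (auto intro!: Ck_on_add Ck_on_const assms(1))

lemma Ck_on_bilinear:
  assumes "open S" "bounded_bilinear B" "Ck_on k S f" "Ck_on k S g"
  shows "Ck_on k S (\<lambda>x. B (f x) (g x))"
  using assms(3,4)
proof (induction k arbitrary: f g)
  case 0
  then show ?case using bounded_bilinear.continuous_on[OF assms(2)] by simp
next
  case (Suc k)
  note E = Ck_on_SucE[OF Suc.prems(1)] Ck_on_SucE[OF Suc.prems(2)]
  show ?case
    by (rule Ck_on_SucI[where f'="\<lambda>x v. B (f x) (frechet_derivative g (at x) v) + B (frechet_derivative f (at x) v) (g x)"])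
      (auto intro!: assms(1) Suc.IH E Ck_on_add Ck_on_SucD[OF Suc.prems(1)] Ck_on_SucD[OF Suc.prems(2)]
         bounded_bilinear.FDERIV[OF assms(2)])
qed

lemma linear_sum_Basis:
  fixes L :: "'m::euclidean_space \<Rightarrow> 'f::real_vector"
  assumes "linear L"
  shows "L v = (\<Sum>b\<in>Basis. (v \<bullet> b) *\<^sub>R L b)"
proof -
  have "L v = L (\<Sum>b\<in>Basis. (v \<bullet> b) *\<^sub>R b)" by (simp add: euclidean_representation)
  also have "\<dots> = (\<Sum>b\<in>Basis. (v \<bullet> b) *\<^sub>R L b)"
    using assms by (simp add: linear_sum linear_cmul)
  finally show ?thesis .
qed

text \<open>In the chain rule both the linear map and the vector it is applied to vary with the
  point, whereas \<open>Ck_on\<close> controls derivatives in fixed directions only. Expanding the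
  inner vector in \<open>Basis\<close> separates the two dependences; this is why the middle space
  is Euclidean.\<close>

lemma Ck_on_compose:
  fixes f :: "'e::real_normed_vector \<Rightarrow> 'm::euclidean_space"
  assumes "open S" "Ck_on k S f" "Ck_on k T g" "f ` S \<subseteq> T"
  shows "Ck_on k S (\<lambda>x. g (f x))"
  using assms(2,3)
proof (induction k arbitrary: g)
  case 0
  then show ?case using assms(4) by (auto intro: continuous_on_compose2)
next
  case (Suc k)
  note E = Ck_on_SucE[OF Suc.prems(1)] Ck_on_SucE[OF Suc.prems(2)]
  have lin: "linear (frechet_derivative g (at (f x)))" if "x \<in> S" for x
    using E(3)[of "f x"] that assms(4) has_derivative_linear by blast
  show ?case
  proof (rule Ck_on_SucI[OF assms(1)])
    fix x assume x: "x \<in> S"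
    show "((\<lambda>x. g (f x)) has_derivative (\<lambda>v. \<Sum>b\<in>Basis. (frechet_derivative f (at x) v \<bullet> b) *\<^sub>R frechet_derivative g (at (f x)) b)) (at x)"
      unfolding linear_sum_Basis[OF lin[OF x], symmetric]
      by (rule has_derivative_compose[OF E(1)[OF x]]) (use E(3) x assms(4) in auto)
  next
    fix v
    show "Ck_on k S (\<lambda>x. \<Sum>b\<in>Basis. (frechet_derivative f (at x) v \<bullet> b) *\<^sub>R frechet_derivative g (at (f x)) b)"
      by (intro Ck_on_sum Ck_on_bilinear[OF assms(1) bounded_bilinear_scaleR] assms(1)
          Ck_on_bounded_linear[OF assms(1) bounded_linear_inner_left] E(2) Suc.IH E(4)
          Ck_on_SucD[OF Suc.prems(1)])
  qed
qed

declare Ck_on.simps(2) [simp del]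

lemma smooth_on_open_iff:
  assumes "open S"
  shows "smooth_on S f \<longleftrightarrow> (\<forall>k. Ck_on k S f)"
proof
  assume sm: "smooth_on S f"
  show "\<forall>k. Ck_on k S f"
  proof (rule allI, rule Ck_on_local)
    fix k x assume "x \<in> S"
    then obtain G g where G: "open G" "x \<in> G" "\<forall>k. Ck_on k G g" "\<forall>y\<in>G \<inter> S. g y = f y"
      using sm unfolding smooth_on_def by blast
    have "Ck_on k (G \<inter> S) g" using G(3) Ck_on_subset by blast
    then have "Ck_on k (G \<inter> S) f"
      using Ck_on_cong[of "G \<inter> S" g f] G assms by auto
    then show "\<exists>G. open G \<and> x \<in> G \<and> Ck_on k G f"
      using G assms \<open>x \<in> S\<close> by (intro exI[of _ "G \<inter> S"]) auto
  qed
qed (use assms in \<open>auto simp: smooth_on_def\<close>)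

lemma smooth_onI:
  assumes "\<And>x. x \<in> S \<Longrightarrow> \<exists>G g. open G \<and> x \<in> G \<and> smooth_on G g \<and> (\<forall>y\<in>G \<inter> S. g y = f y)"
  shows "smooth_on S f"
  unfolding smooth_on_def
proof
  fix x assume "x \<in> S"
  with assms obtain G g where "open G" "x \<in> G" "smooth_on G g" "\<forall>y\<in>G \<inter> S. g y = f y" by blast
  then show "\<exists>G g. open G \<and> x \<in> G \<and> (\<forall>k. Ck_on k G g) \<and> (\<forall>y\<in>G \<inter> S. g y = f y)"
    by (metis smooth_on_open_iff)
qed

lemma smooth_onE:
  assumes "smooth_on S f" "x \<in> S"
  obtains G g where "open G" "x \<in> G" "smooth_on G g" "\<And>y. y \<in> G \<Longrightarrow> y \<in> S \<Longrightarrow> g y = f y"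
proof -
  obtain G g where G: "open G" "x \<in> G" "\<forall>k. Ck_on k G g" "\<forall>y\<in>G \<inter> S. g y = f y"
    using assms unfolding smooth_on_def by blast
  then have "smooth_on G g" by (simp add: smooth_on_open_iff)
  show thesis
    by (rule that[OF G(1,2) \<open>smooth_on G g\<close>]) (use G(4) in blast)
qed

lemma smooth_on_subset:
  assumes "smooth_on S f" "T \<subseteq> S"
  shows "smooth_on T f"
proof (rule smooth_onI)
  fix x assume "x \<in> T"
  then have "x \<in> S" using assms(2) by blast
  then obtain G g where G: "open G" "x \<in> G" "smooth_on G g" "\<And>y. y \<in> G \<Longrightarrow> y \<in> S \<Longrightarrow> g y = f y"
    using smooth_onE[OF assms(1)] by metis
  then have "\<forall>y\<in>G \<inter> T. g y = f y" using assms(2) by blast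
  then show "\<exists>G g. open G \<and> x \<in> G \<and> smooth_on G g \<and> (\<forall>y\<in>G \<inter> T. g y = f y)"
    using G(1-3) by (intro exI conjI)
qed

lemma smooth_on_cong:
  assumes "\<And>x. x \<in> S \<Longrightarrow> f x = g x"
  shows "smooth_on S f \<longleftrightarrow> smooth_on S g"
  unfolding smooth_on_def using assms by simp

lemma smooth_on_local:
  assumes "\<And>x. x \<in> S \<Longrightarrow> \<exists>G. open G \<and> x \<in> G \<and> smooth_on (S \<inter> G) f"
  shows "smooth_on S f"
proof (rule smooth_onI)
  fix x assume "x \<in> S"
  then obtain G where G: "open G" "x \<in> G" "smooth_on (S \<inter> G) f" using assms by blast
  then obtain G' g where "open G'" "x \<in> G'" "smooth_on G' g" "\<And>y. y \<in> G' \<Longrightarrow> y \<in> S \<inter> G \<Longrightarrow> g y = f y"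
    using smooth_onE[OF G(3), of x] \<open>x \<in> S\<close> by blast
  then show "\<exists>G g. open G \<and> x \<in> G \<and> smooth_on G g \<and> (\<forall>y\<in>G \<inter> S. g y = f y)"
    using G by (intro exI[of _ "G \<inter> G'"] exI[of _ g]) (auto intro: smooth_on_subset)
qed

lemma smooth_on_imp_continuous_on:
  assumes "smooth_on S f" shows "continuous_on S f"
  unfolding continuous_on_eq_continuous_within
proof
  fix x assume x: "x \<in> S"
  then obtain G g where G: "open G" "x \<in> G" "smooth_on G g" "\<And>y. y \<in> G \<Longrightarrow> y \<in> S \<Longrightarrow> g y = f y"
    using smooth_onE[OF assms] by metis
  then have "Ck_on 0 G g" using smooth_on_open_iff by blast
  then have "isCont g x"
    using G(1,2) by (simp add: continuous_on_eq_continuous_at)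
  then have "continuous (at x within S) g"
    by (rule continuous_at_imp_continuous_at_within)
  moreover obtain d where "d > 0" "ball x d \<subseteq> G" using G(1,2) by (rule openE)
  ultimately show "continuous (at x within S) f"
    using G(4) x by (intro continuous_transform_within[of x S g d f]) (auto simp: dist_commute subset_iff)
qed

lemma smooth_on_const: "smooth_on S (\<lambda>x. c)"
  by (rule smooth_on_subset[of UNIV]) (auto simp: smooth_on_open_iff Ck_on_const)

lemma smooth_on_id: "smooth_on S (\<lambda>x. x)"
  by (rule smooth_on_subset[of UNIV]) (auto simp: smooth_on_open_iff Ck_on_id)

lemma smooth_on_compose:
  fixes f :: "'e::real_normed_vector \<Rightarrow> 'm::euclidean_space"
  assumes "smooth_on T g" "smooth_on S f" "f ` S \<subseteq> T"
  shows "smooth_on S (\<lambda>x. g (f x))"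
proof (rule smooth_onI)
  fix x assume x: "x \<in> S"
  then obtain G f' where G: "open G" "x \<in> G" "smooth_on G f'" "\<And>y. y \<in> G \<Longrightarrow> y \<in> S \<Longrightarrow> f' y = f y"
    using smooth_onE[OF assms(2)] by metis
  obtain H g' where H: "open H" "f x \<in> H" "smooth_on H g'" "\<And>y. y \<in> H \<Longrightarrow> y \<in> T \<Longrightarrow> g' y = g y"
    using smooth_onE[OF assms(1), of "f x"] x assms(3) by blast
  let ?I = "G \<inter> f' -` H"
  have o: "open ?I"
    by (rule continuous_open_preimage[OF smooth_on_imp_continuous_on[OF G(3)] G(1) H(1)])
  have "smooth_on ?I (\<lambda>x. g' (f' x))"
    unfolding smooth_on_open_iff[OF o]
  proof
    fix k
    have f: "Ck_on k G f'" and g: "Ck_on k H g'"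
      using G(1,3) H(1,3) by (simp_all add: smooth_on_open_iff)
    show "Ck_on k ?I (\<lambda>x. g' (f' x))"
      by (rule Ck_on_compose[OF o Ck_on_subset[OF f] g]) auto
  qed
  moreover have "\<forall>y\<in>?I \<inter> S. g' (f' y) = g (f y)"
    using G H assms(3) by auto
  moreover have "x \<in> ?I" using G H x by auto
  ultimately show "\<exists>G g'. open G \<and> x \<in> G \<and> smooth_on G g' \<and> (\<forall>y\<in>G \<inter> S. g' y = g (f y))"
    using o by (intro exI[of _ ?I] exI[of _ "\<lambda>x. g' (f' x)"]) auto
qed

text \<open>Local extensions are combined on the intersection of their domains. Unary operations are
  covered by an \<open>h\<close> that ignores an argument.\<close>

lemma smooth_on_binop:
  fixes S :: "'e::real_normed_vector set"
  assumes "smooth_on S f" "smooth_on S g"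
    and "\<And>(G::'e set) f g k. open G \<Longrightarrow> Ck_on k G f \<Longrightarrow> Ck_on k G g \<Longrightarrow> Ck_on k G (\<lambda>x. h (f x) (g x))"
  shows "smooth_on S (\<lambda>x. h (f x) (g x))"
proof (rule smooth_onI)
  fix x assume x: "x \<in> S"
  obtain G f' where G: "open G" "x \<in> G" "smooth_on G f'" "\<And>y. y \<in> G \<Longrightarrow> y \<in> S \<Longrightarrow> f' y = f y"
    using smooth_onE[OF assms(1) x] by metis
  obtain H g' where H: "open H" "x \<in> H" "smooth_on H g'" "\<And>y. y \<in> H \<Longrightarrow> y \<in> S \<Longrightarrow> g' y = g y"
    using smooth_onE[OF assms(2) x] by metis
  have "smooth_on (G \<inter> H) (\<lambda>x. h (f' x) (g' x))"
    unfolding smooth_on_open_iff[OF open_Int[OF G(1) H(1)]]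
  proof
    fix k
    have f: "Ck_on k G f'" and g: "Ck_on k H g'"
      using G(1,3) H(1,3) by (simp_all add: smooth_on_open_iff)
    show "Ck_on k (G \<inter> H) (\<lambda>x. h (f' x) (g' x))"
      by (rule assms(3)[OF open_Int[OF G(1) H(1)] Ck_on_subset[OF f] Ck_on_subset[OF g]]) auto
  qed
  then show "\<exists>G k. open G \<and> x \<in> G \<and> smooth_on G k \<and> (\<forall>y\<in>G \<inter> S. k y = h (f y) (g y))"
    using G H x by (intro exI[of _ "G \<inter> H"] exI[of _ "\<lambda>x. h (f' x) (g' x)"]) auto
qed

lemma smooth_on_bilinear:
  assumes "bounded_bilinear B" "smooth_on S f" "smooth_on S g"
  shows "smooth_on S (\<lambda>x. B (f x) (g x))"
  using assms(2,3) by (rule smooth_on_binop) (rule Ck_on_bilinear[OF _ assms(1)])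

lemmas smooth_on_scaleR = smooth_on_bilinear[OF bounded_bilinear_scaleR]
lemmas smooth_on_mult = smooth_on_bilinear[OF bounded_bilinear_mult]
lemmas smooth_on_inner = smooth_on_bilinear[OF bounded_bilinear_inner]

lemma smooth_on_add:
  assumes "smooth_on S f" "smooth_on S g"
  shows "smooth_on S (\<lambda>x. f x + g x)"
  using assms by (rule smooth_on_binop) (rule Ck_on_add)

lemma smooth_on_bounded_linear:
  assumes "bounded_linear L" "smooth_on S f"
  shows "smooth_on S (\<lambda>x. L (f x))"
  using assms(2,2) by (rule smooth_on_binop[where h="\<lambda>x y. L x"]) (rule Ck_on_bounded_linear[OF _ assms(1)])

lemma smooth_on_linear:
  fixes f :: "'e::real_normed_vector \<Rightarrow> 'm::euclidean_space"
  shows "linear L \<Longrightarrow> smooth_on S f \<Longrightarrow> smooth_on S (\<lambda>x. L (f x))"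
  by (simp add: smooth_on_bounded_linear linear_conv_bounded_linear)

lemmas smooth_on_fst = smooth_on_bounded_linear[OF bounded_linear_fst]
lemmas smooth_on_snd = smooth_on_bounded_linear[OF bounded_linear_snd]
lemmas smooth_on_uminus = smooth_on_bounded_linear[OF bounded_linear_minus[OF bounded_linear_ident]]

lemma smooth_on_diff:
  assumes "smooth_on S f" "smooth_on S g"
  shows "smooth_on S (\<lambda>x. f x - g x)"
  using smooth_on_add[OF assms(1) smooth_on_uminus[OF assms(2)]] by simp

lemma smooth_on_Pair:
  assumes "smooth_on S f" "smooth_on S g"
  shows "smooth_on S (\<lambda>x. (f x, g x))"
proof -
  have "bounded_linear (\<lambda>x. (x, 0))" and "bounded_linear (\<lambda>x. (0, x))"
    by (auto intro!: bounded_linear_Pair bounded_linear_ident bounded_linear_zero)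
  note smooth_on_add[OF smooth_on_bounded_linear[OF this(1) assms(1)] smooth_on_bounded_linear[OF this(2) assms(2)]]
  then show ?thesis by simp
qed

lemma smooth_on_sum:
  assumes "\<And>i. i \<in> I \<Longrightarrow> smooth_on S (f i)"
  shows "smooth_on S (\<lambda>x. \<Sum>i\<in>I. f i x)"
  using assms
  by (induction I rule: infinite_finite_induct) (auto intro!: smooth_on_add smooth_on_const)

lemma smooth_on_prod:
  fixes f :: "'i \<Rightarrow> 'e::real_normed_vector \<Rightarrow> real"
  assumes "\<And>i. i \<in> I \<Longrightarrow> smooth_on S (f i)"
  shows "smooth_on S (\<lambda>x. \<Prod>i\<in>I. f i x)"
  using assms
  by (induction I rule: infinite_finite_induct) (auto intro!: smooth_on_mult smooth_on_const)

lemma smooth_on_has_derivative: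
  assumes "smooth_on S f" "x \<in> S"
  obtains f' where "(f has_derivative f') (at x within S)"
proof -
  obtain G g where G: "open G" "x \<in> G" "smooth_on G g" "\<And>y. y \<in> G \<Longrightarrow> y \<in> S \<Longrightarrow> g y = f y"
    using smooth_onE[OF assms] by metis
  then have "Ck_on (Suc 0) G g" using smooth_on_open_iff by blast
  then obtain g' where "(g has_derivative g') (at x)" using G(2) Ck_on_SucE(1) by blast
  then have "(g has_derivative g') (at x within S)" by (rule has_derivative_at_withinI)
  then have "(f has_derivative g') (at x within S)"
    by (rule has_derivative_transform_eventually) (use G assms(2) in \<open>auto simp: eventually_at_topological\<close>)
  then show ?thesis by (rule that)
qed

subsection \<open>A smooth cutoff function\<close>

text \<open>\<open>flat_exp 0\<close> is the classical flat function exp(-1/x). The powers of 1/x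
  are those that its derivatives produce, so the family is closed under differentiation up to linear
  combinations and one induction treats all members at once.\<close>

definition flat_exp :: "nat \<Rightarrow> real \<Rightarrow> real" where
  "flat_exp n x = (if x > 0 then (1 / x) ^ n * exp (- (1 / x)) else 0)"

lemma flat_exp_tendsto_0: "(flat_exp n \<longlongrightarrow> 0) (at 0)"
proof -
  have "((\<lambda>x. (1 / x) ^ n / exp (1 / x)) \<longlongrightarrow> (0::real)) (at_right 0)"
    using filterlim_compose[OF tendsto_power_div_exp_0 filterlim_inverse_at_top_right]
    by (simp add: inverse_eq_divide)
  then have "(flat_exp n \<longlongrightarrow> 0) (at_right 0)"
    by (rule Lim_transform_eventually)
      (auto simp: eventually_at_filter flat_exp_def exp_minus divide_inverse)
  moreover have "(flat_exp n \<longlongrightarrow> 0) (at_left 0)"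
    by (rule Lim_transform_eventually[OF tendsto_const])
      (auto simp: eventually_at_filter flat_exp_def)
  ultimately show ?thesis by (simp add: filterlim_at_split)
qed

lemma flat_exp_deriv:
  "(flat_exp n has_real_derivative flat_exp (n + 2) x - real n * flat_exp (n + 1) x) (at x)"
proof -
  consider "x > 0" | "x < 0" | "x = 0" by linarith
  then show ?thesis
  proof cases
    case 1
    have "((\<lambda>x. (1 / x) ^ n * exp (- (1 / x))) has_real_derivative
        (real n * (1 / x) ^ (n - 1) * (- 1 / x\<^sup>2)) * exp (- (1 / x)) + (exp (- (1 / x)) * (1 / x\<^sup>2)) * (1 / x) ^ n) (at x)"
      using 1 by (auto intro!: derivative_eq_intros simp: power2_eq_square)
    moreover have "(real n * (1 / x) ^ (n - 1) * (- 1 / x\<^sup>2)) * exp (- (1 / x)) + (exp (- (1 / x)) * (1 / x\<^sup>2)) * (1 / x) ^ n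
       = flat_exp (n + 2) x - real n * flat_exp (n + 1) x"
      using 1 by (cases n) (auto simp: flat_exp_def field_simps power2_eq_square)
    ultimately have "((\<lambda>x. (1 / x) ^ n * exp (- (1 / x))) has_real_derivative
        flat_exp (n + 2) x - real n * flat_exp (n + 1) x) (at x)" by simp
    then show ?thesis
      by (rule has_field_derivative_transform_within_open[where S="{0<..}"])
        (use 1 in \<open>auto simp: flat_exp_def\<close>)
  next
    case 2
    have "((\<lambda>x. 0) has_real_derivative flat_exp (n + 2) x - real n * flat_exp (n + 1) x) (at x)"
      using 2 by (simp add: flat_exp_def)
    then show ?thesis
      by (rule has_field_derivative_transform_within_open[where S="{..<0}"])
        (use 2 in \<open>auto simp: flat_exp_def\<close>)
  next
    case 3
    \<comment> \<open>At 0 the difference quotient is \<open>flat_exp (n + 1)\<close>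
      itself.\<close>
    have "((\<lambda>h. (flat_exp n h - flat_exp n 0) / h) \<longlongrightarrow> 0) (at 0)"
      by (rule Lim_transform_eventually[OF flat_exp_tendsto_0[of "n + 1"]])
        (auto simp: eventually_at_filter flat_exp_def)
    then show ?thesis using 3 by (simp add: DERIV_def flat_exp_def)
  qed
qed

lemma Ck_on_flat_exp: "Ck_on k UNIV (flat_exp n)"
proof (induction k arbitrary: n)
  case 0
  then show ?case
    by (auto intro!: continuous_at_imp_continuous_on DERIV_isCont flat_exp_deriv)
next
  case (Suc k)
  let ?D = "\<lambda>x. flat_exp (n + 2) x + (- real n) *\<^sub>R flat_exp (n + 1) x"
  show ?case
  proof (rule Ck_on_SucI)
    show "(flat_exp n has_derivative (\<lambda>v. v *\<^sub>R ?D x)) (at x)" for x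
    proof -
      have "(\<lambda>v. v *\<^sub>R ?D x) = (*) (flat_exp (n + 2) x - real n * flat_exp (n + 1) x)"
        by (auto simp: algebra_simps)
      then show ?thesis using flat_exp_deriv[of n x] by (simp only: has_field_derivative_def)
    qed
    show "Ck_on k UNIV (\<lambda>x. v *\<^sub>R ?D x)" for v
      by (intro Ck_on_bounded_linear[OF _ bounded_linear_scaleR_right] Ck_on_add Suc.IH open_UNIV)
  qed simp
qed

lemma smooth_cutoff:
  obtains s :: "real \<Rightarrow> real" where "smooth_on UNIV s" "\<And>t. t \<le> 0 \<Longrightarrow> s t = 0" "\<And>t. t \<ge> 1 \<Longrightarrow> s t = 1"
proof
  let ?f = "flat_exp 0"
  \<comment> \<open>No quotient is required: \<open>exp 1 * ?f (1 - u)\<close> is 0 for u at least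
    1, equals 1 at u = 0 and is at least 1 for u below 0. Applying this function twice exchanges the
    two ends and makes both of them constant.\<close>
  let ?s = "\<lambda>t. exp 1 * ?f (1 - exp 1 * ?f (1 - t))"
  have f: "smooth_on UNIV ?f" by (simp add: smooth_on_open_iff Ck_on_flat_exp)
  show "smooth_on UNIV ?s"
    by (intro smooth_on_mult smooth_on_const smooth_on_compose[OF f] smooth_on_diff smooth_on_id) auto
  show "?s t = 1" if "t \<ge> 1" for t
    using that by (simp add: flat_exp_def flip: exp_add)
  show "?s t = 0" if "t \<le> 0" for t
  proof -
    have "1 \<le> exp (1 + - (1 / (1 - t)))" using that by (simp add: field_simps)
    then have "1 \<le> exp 1 * ?f (1 - t)" using that by (simp add: flat_exp_def flip: exp_add)
    then show ?thesis by (simp add: flat_exp_def)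
  qed
qed

subsection \<open>The inverse function theorem for smooth maps\<close>

text \<open>A product rule in which the vector factor is merely continuous; it holds because the
  scalar factor vanishes at the point. It serves for the inverse of a matrix, where only continuity
  is known of the factor in question.\<close>

lemma has_derivative_scaleR_continuous:
  fixes \<alpha> :: "'e::real_normed_vector \<Rightarrow> real"
  assumes \<alpha>: "(\<alpha> has_derivative \<alpha>') (at x)" "\<alpha> x = 0" and \<beta>: "isCont \<beta> x"
  shows "((\<lambda>y. \<alpha> y *\<^sub>R \<beta> y) has_derivative (\<lambda>u. \<alpha>' u *\<^sub>R \<beta> x)) (at x)"
proof -
  have bl: "bounded_linear \<alpha>'" using \<alpha>(1) by (rule has_derivative_bounded_linear)
  obtain K where K: "\<And>u. norm (\<alpha>' u) \<le> norm u * K" using bounded_linear.bounded[OF bl] by blast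
  let ?r = "\<lambda>y. norm (\<alpha> y - \<alpha> x - \<alpha>' (y - x)) / norm (y - x)"
  have r: "(?r \<longlongrightarrow> 0) (at x)" using \<alpha>(1) by (simp add: has_derivative_iff_norm)
  have "((\<lambda>y. \<alpha> y *\<^sub>R (\<beta> y - \<beta> x)) has_derivative (\<lambda>u. 0)) (at x)"
    unfolding has_derivative_iff_norm
  proof (intro conjI bounded_linear_zero)
    have b: "norm (\<alpha> y *\<^sub>R (\<beta> y - \<beta> x) - \<alpha> x *\<^sub>R (\<beta> x - \<beta> x) - 0) / norm (y - x)
        \<le> (?r y + K) * norm (\<beta> y - \<beta> x)" if "y \<noteq> x" for y
    proof -
      have "\<bar>\<alpha> y\<bar> \<le> norm (\<alpha> y - \<alpha> x - \<alpha>' (y - x)) + norm (\<alpha>' (y - x))"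
        using \<alpha>(2) norm_triangle_sub[of "\<alpha> y" "\<alpha>' (y - x)"] by simp
      also have "\<dots> \<le> norm (\<alpha> y - \<alpha> x - \<alpha>' (y - x)) + norm (y - x) * K" using K by simp
      finally have "\<bar>\<alpha> y\<bar> / norm (y - x) \<le> ?r y + K"
        using that by (simp add: field_simps)
      from mult_right_mono[OF this, of "norm (\<beta> y - \<beta> x)"] show ?thesis using \<alpha>(2) by simp
    qed
    have "((\<lambda>y. (?r y + K) * norm (\<beta> y - \<beta> x)) \<longlongrightarrow> (0 + K) * norm (\<beta> x - \<beta> x)) (at x)"
      using \<beta> by (intro tendsto_intros r) (simp add: isCont_def)
    then have "((\<lambda>y. (?r y + K) * norm (\<beta> y - \<beta> x)) \<longlongrightarrow> 0) (at x)" by simp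
    then show "((\<lambda>y. norm (\<alpha> y *\<^sub>R (\<beta> y - \<beta> x) - \<alpha> x *\<^sub>R (\<beta> x - \<beta> x) - 0) / norm (y - x)) \<longlongrightarrow> 0) (at x)"
      by (rule Lim_null_comparison[rotated]) (use b in \<open>auto simp: eventually_at_filter\<close>)
  qed
  moreover have "((\<lambda>y. \<alpha> y *\<^sub>R \<beta> x) has_derivative (\<lambda>u. \<alpha>' u *\<^sub>R \<beta> x)) (at x)"
    by (rule has_derivative_scaleR_left[OF \<alpha>(1)])
  ultimately show ?thesis
    by (auto dest: has_derivative_add simp: scaleR_right_diff_distrib)
qed

text \<open>If \<open>A y\<close> stretches by at least m, then \<open>A x\<close> stretches by at
  least m/2 for x near y. With w the solution at y, the difference of the two solutions is mapped by
  \<open>A x\<close> to \<open>A y w - A x w\<close>, which tends to 0.\<close>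

lemma continuous_on_inv_linear:
  fixes A :: "'e::t2_space \<Rightarrow> 'm::euclidean_space \<Rightarrow> 'm"
  assumes "open V" and lin: "\<And>y. y \<in> V \<Longrightarrow> linear (A y)" and bij: "\<And>y. y \<in> V \<Longrightarrow> bij (A y)"
    and cont: "\<And>z. continuous_on V (\<lambda>y. A y z)"
  shows "continuous_on V (\<lambda>y. inv (A y) v)"
proof -
  have "isCont (\<lambda>y. inv (A y) v) y" if y: "y \<in> V" for y
  proof -
    obtain m where m: "m > 0" "\<And>z. norm (A y z) \<ge> m * norm z"
      using linear_inj_bounded_below_pos[OF lin[OF y]] bij[OF y] by (metis bij_is_inj)
    \<comment> \<open>A bound for the operator norm of \<open>A x - A y\<close>, built from values
      on fixed vectors, the only ones whose continuity is assumed.\<close>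
    let ?D = "\<lambda>x. \<Sum>b\<in>Basis. norm (A x b - A y b)"
    have cA: "isCont (\<lambda>x. A x z) y" for z
      using cont assms(1) y by (simp add: continuous_on_eq_continuous_at)
    have "(?D \<longlongrightarrow> (\<Sum>b\<in>Basis. norm (A y b - A y b))) (at y)"
      using cA by (intro tendsto_intros) (simp add: isCont_def)
    then have "eventually (\<lambda>x. ?D x < m / 2) (at y)"
      using m(1) by (intro order_tendstoD(2)) auto
    then have ev: "eventually (\<lambda>x. ?D x < m / 2 \<and> x \<in> V) (at y)"
      using assms(1) y by (intro eventually_conj) (auto simp: eventually_at_topological)
    have est: "norm (inv (A x) v - inv (A y) v) \<le> 2 / m * norm (A y (inv (A y) v) - A x (inv (A y) v))"
      if x: "?D x < m / 2" "x \<in> V" for x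
    proof -
      let ?z = "inv (A x) v - inv (A y) v"
      have d: "linear (\<lambda>z. A x z - A y z)"
        using lin[OF x(2)] lin[OF y] by (rule linear_compose_sub)
      have "norm (A x ?z - A y ?z) = norm (\<Sum>b\<in>Basis. (?z \<bullet> b) *\<^sub>R (A x b - A y b))"
        by (subst linear_sum_Basis[OF d]) simp
      also have "\<dots> \<le> (\<Sum>b\<in>Basis. norm ((?z \<bullet> b) *\<^sub>R (A x b - A y b)))" by (rule norm_sum)
      also have "\<dots> \<le> (\<Sum>b\<in>Basis. norm ?z * norm (A x b - A y b))"
        by (intro sum_mono) (auto intro!: mult_right_mono Basis_le_norm)
      also have "\<dots> = norm ?z * ?D x" by (simp add: sum_distrib_left)
      also have "\<dots> \<le> norm ?z * (m / 2)" using x by (intro mult_left_mono) auto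
      finally have "norm (A x ?z - A y ?z) \<le> norm ?z * (m / 2)" .
      moreover have "m * norm ?z \<le> norm (A y ?z)" by (rule m)
      moreover have "norm (A y ?z) \<le> norm (A x ?z) + norm (A x ?z - A y ?z)"
        using norm_triangle_sub[of "A y ?z" "A x ?z"] by (simp add: norm_minus_commute)
      ultimately have "m / 2 * norm ?z \<le> norm (A x ?z)" by (simp add: algebra_simps)
      moreover have "A x ?z = A y (inv (A y) v) - A x (inv (A y) v)"
        using bij[OF x(2)] bij[OF y] by (simp add: linear_diff[OF lin[OF x(2)]] bij_is_surj surj_f_inv_f)
      ultimately show ?thesis using m(1) by (simp add: field_simps)
    qed
    have "((\<lambda>x. 2 / m * norm (A y (inv (A y) v) - A x (inv (A y) v))) \<longlongrightarrow>
          2 / m * norm (A y (inv (A y) v) - A y (inv (A y) v))) (at y)"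
      using cA by (intro tendsto_intros) (simp add: isCont_def)
    then have "((\<lambda>x. 2 / m * norm (A y (inv (A y) v) - A x (inv (A y) v))) \<longlongrightarrow> 0) (at y)" by simp
    then have "((\<lambda>x. inv (A x) v - inv (A y) v) \<longlongrightarrow> 0) (at y)"
      by (rule Lim_null_comparison[rotated]) (use ev est in \<open>auto elim: eventually_mono\<close>)
    then show ?thesis unfolding isCont_def by (simp add: LIM_zero_iff)
  qed
  then show ?thesis by (simp add: continuous_at_imp_continuous_on)
qed

text \<open>Differentiate \<open>A\<^sub>y w\<^sub>y = v\<close>: the increment of \<open>w = inv A v\<close> is \<open>- inv A\<^sub>y ((A\<^sub>y - A\<^sub>x) w\<^sub>x)\<close>.\<close>

lemma Ck_on_inv_linear:
  fixes A :: "'e::real_normed_vector \<Rightarrow> 'm::euclidean_space \<Rightarrow> 'm"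
  assumes V: "open V" and lin: "\<And>y. y \<in> V \<Longrightarrow> linear (A y)" and bij: "\<And>y. y \<in> V \<Longrightarrow> bij (A y)"
    and "\<And>z. Ck_on k V (\<lambda>y. A y z)"
  shows "Ck_on k V (\<lambda>y. inv (A y) v)"
  using assms(4)
proof (induction k arbitrary: v)
  case 0
  then show ?case using continuous_on_inv_linear[OF V lin bij] by simp
next
  case (Suc k)
  have IH: "Ck_on k V (\<lambda>y. inv (A y) v)" for v
    using Suc by (meson Ck_on_SucD)
  have inv_lin: "linear (inv (A y))" if "y \<in> V" for y
    using lin bij that by (metis bij_def linear_inj_imp_surj inj_linear_imp_inv_linear)
  define a' where "a' c x = frechet_derivative (\<lambda>y. A y c) (at x)" for c x
  have a': "((\<lambda>y. A y c) has_derivative a' c x) (at x)" if "x \<in> V" for c x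
    unfolding a'_def using Ck_on_SucE(1)[OF Suc.prems] that by blast
  have Ck_a': "Ck_on k V (\<lambda>x. a' c x u)" for c u
    unfolding a'_def using Ck_on_SucE(2)[OF Suc.prems] by blast
  have cont: "isCont (\<lambda>y. inv (A y) v) x" if "x \<in> V" for x v
  proof -
    have "continuous_on V (\<lambda>y. A y z)" for z
      using Suc.prems by (meson Ck_on_SucE(1) continuous_at_imp_continuous_on has_derivative_continuous)
    then show ?thesis
      using continuous_on_inv_linear[OF V lin bij] V that by (simp add: continuous_on_eq_continuous_at)
  qed
  \<comment> \<open>\<open>?w'\<close> is what differentiation yields, but it contains the
    derivative of \<open>A\<close> applied to a vector that moves with x. \<open>?w''\<close>
    expands that vector in the basis, so that every factor is of class k by itself.\<close>
  let ?w' = "\<lambda>x u. - (\<Sum>b\<in>Basis. (a' (inv (A x) v) x u \<bullet> b) *\<^sub>R inv (A x) b)"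
  let ?w'' = "\<lambda>x u. - (\<Sum>b\<in>Basis. (\<Sum>c\<in>Basis. ((inv (A x) v \<bullet> c) *\<^sub>R a' c x u) \<bullet> b) *\<^sub>R inv (A x) b)"
  show ?case
  proof (rule Ck_on_SucI[OF V])
    fix x assume x: "x \<in> V"
    let ?w = "inv (A x) v"
    have eq: "inv (A x) v - (\<Sum>b\<in>Basis. ((A y ?w - A x ?w) \<bullet> b) *\<^sub>R inv (A y) b) = inv (A y) v"
      if y: "y \<in> V" for y
    proof -
      have "(\<Sum>b\<in>Basis. ((A y ?w - A x ?w) \<bullet> b) *\<^sub>R inv (A y) b) = inv (A y) (A y ?w - A x ?w)"
        by (subst (2) linear_sum_Basis[OF inv_lin[OF y]]) simp
      also have "\<dots> = ?w - inv (A y) v"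
        using bij[OF x] bij[OF y]
        by (simp add: linear_diff[OF inv_lin[OF y]] bij_is_surj surj_f_inv_f bij_is_inj inv_f_f)
      finally show ?thesis by simp
    qed
    have "((\<lambda>y. ?w - (\<Sum>b\<in>Basis. ((A y ?w - A x ?w) \<bullet> b) *\<^sub>R inv (A y) b)) has_derivative
        (\<lambda>u. 0 - (\<Sum>b\<in>Basis. ((a' ?w x u - 0) \<bullet> b) *\<^sub>R inv (A x) b))) (at x)"
      by (intro has_derivative_diff has_derivative_const has_derivative_sum
          has_derivative_scaleR_continuous cont x has_derivative_inner_left a') auto
    then have "((\<lambda>y. inv (A y) v) has_derivative ?w' x) (at x)"
      by (intro has_derivative_transform_within_open[OF _ V x eq]) auto
    moreover have "a' ?w x u = (\<Sum>c\<in>Basis. (?w \<bullet> c) *\<^sub>R a' c x u)" for u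
    proof -
      have "((\<lambda>y. \<Sum>c\<in>Basis. (?w \<bullet> c) *\<^sub>R A y c) has_derivative (\<lambda>u. \<Sum>c\<in>Basis. (?w \<bullet> c) *\<^sub>R a' c x u)) (at x)"
        by (intro has_derivative_sum has_derivative_scaleR_right a' x)
      then have "((\<lambda>y. A y ?w) has_derivative (\<lambda>u. \<Sum>c\<in>Basis. (?w \<bullet> c) *\<^sub>R a' c x u)) (at x)"
        by (rule has_derivative_transform_within_open[OF _ V x]) (metis lin linear_sum_Basis)
      from has_derivative_unique[OF a'[OF x] this] show ?thesis by metis
    qed
    ultimately show "((\<lambda>y. inv (A y) v) has_derivative ?w'' x) (at x)"
      by (simp add: inner_sum_left)
  next
    fix u
    show "Ck_on k V (\<lambda>x. ?w'' x u)"
      by (intro Ck_on_bounded_linear[OF V bounded_linear_minus[OF bounded_linear_ident]] Ck_on_sum V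
          Ck_on_bilinear[OF V bounded_bilinear_scaleR] Ck_on_bounded_linear[OF V bounded_linear_inner_left]
          IH Ck_a')
  qed
qed

text \<open>Bootstrapping: the derivative of the inverse \<open>g\<close> at y is the inverse of
  \<open>f' (g y)\<close>. If \<open>g\<close> is of class k, so is this derivative, by
  \<open>Ck_on_inv_linear\<close>, and then \<open>g\<close> is of class k + 1.\<close>

lemma smooth_inverse_function_theorem:
  fixes f :: "'e::euclidean_space \<Rightarrow> 'e"
  assumes "open G" "smooth_on G f" "a \<in> G" and D: "(f has_derivative D) (at a)" "inj D"
  obtains U V g where "open U" "a \<in> U" "U \<subseteq> G" "open V" "homeomorphism U V f g" "smooth_on V g"
proof -
  have Ck: "Ck_on k G f" for k using assms(1,2) smooth_on_open_iff by blast
  define f' where "f' x = frechet_derivative f (at x)" for x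
  have f': "(f has_derivative f' x) (at x)" if "x \<in> G" for x
    unfolding f'_def using Ck_on_SucE(1)[OF Ck] that by blast
  have Ckf': "Ck_on k G (\<lambda>x. f' x v)" for k v
    unfolding f'_def using Ck_on_SucE(2)[OF Ck] by blast
  have bl: "bounded_linear (f' x)" if "x \<in> G" for x
    using f'[OF that] by (rule has_derivative_bounded_linear)
  \<comment> \<open>The theorem for continuously differentiable maps wants the derivative as a
    continuous family of bounded linear maps; off \<open>G\<close>, where \<open>f'\<close> may be
    meaningless, any value will do.\<close>
  define F where "F x = (if x \<in> G then Blinfun (f' x) else 0)" for x
  have F: "blinfun_apply (F x) = f' x" if "x \<in> G" for x
    using bl that by (simp add: F_def bounded_linear_Blinfun_apply)
  have "f' a = D" using has_derivative_unique f' assms(3) D(1) by blast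
  then have "inj (f' a)" "linear (f' a)" using D(2) bl[OF assms(3)] by (auto simp: linear_conv_bounded_linear)
  then obtain L where L: "linear L" "\<And>x. L (f' a x) = x"
    using linear_injective_left_inverse by (metis comp_apply id_apply)
  have invf: "Blinfun L o\<^sub>L F a = id_blinfun"
    by (rule blinfun_eqI)
      (use L assms(3) in \<open>simp add: F bounded_linear_Blinfun_apply linear_conv_bounded_linear\<close>)
  have contF: "continuous_on G F"
  proof (rule continuous_on_blinfun_componentwise)
    fix i :: 'e
    have "continuous_on G (\<lambda>x. f' x i)" using Ckf'[of 0] by simp
    then show "continuous_on G (\<lambda>x. blinfun_apply (F x) i)"
      by (simp add: F cong: continuous_on_cong)
  qed
  obtain U V g g' where U: "open U" "U \<subseteq> G" "a \<in> U" "open V" "f a \<in> V" "homeomorphism U V f g"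
    and g: "\<And>y. y \<in> V \<Longrightarrow> (g has_derivative (g' y)) (at y)"
    and g': "\<And>y. y \<in> V \<Longrightarrow> g' y = inv (blinfun_apply (F (g y)))"
    and bij: "\<And>y. y \<in> V \<Longrightarrow> bij (blinfun_apply (F (g y)))"
    using inverse_function_theorem[OF assms(1) _ contF assms(3) invf] f' F by metis
  have gV: "g ` V \<subseteq> G" using U by (auto simp: homeomorphism_def)
  then have Fg: "blinfun_apply (F (g y)) = f' (g y)" if "y \<in> V" for y using F that by blast
  have "Ck_on k V g" for k
  proof (induction k)
    case 0
    then show ?case using U(6) by (simp add: homeomorphism_def)
  next
    case (Suc k)
    show ?case
    proof (rule Ck_on_SucI[OF U(4)])
      show "(g has_derivative (\<lambda>v. inv (f' (g y)) v)) (at y)" if "y \<in> V" for y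
        using g[OF that] g'[OF that] Fg[OF that] by simp
      show "Ck_on k V (\<lambda>y. inv (f' (g y)) v)" for v
      proof (rule Ck_on_inv_linear[OF U(4)])
        show "linear (f' (g y))" if "y \<in> V" for y
          using bl gV that by (auto simp: linear_conv_bounded_linear)
        show "bij (f' (g y))" if "y \<in> V" for y using bij Fg that by metis
        show "Ck_on k V (\<lambda>y. f' (g y) z)" for z
          by (rule Ck_on_compose[OF U(4) Suc Ckf' gV])
      qed
    qed
  qed
  then have "smooth_on V g" using U(4) smooth_on_open_iff by blast
  then show thesis using that U by blast
qed

subsection \<open>Directional derivatives on relatively open subsets of a subspace\<close>

lemma line_in_relopen:
  fixes E :: "'e::real_normed_vector set"
  assumes "openin (top_of_set E) S" "subspace E" "x \<in> S" "v \<in> E"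
  obtains T where "open T" "(0::real) \<in> T" "\<And>t. t \<in> T \<Longrightarrow> x + t *\<^sub>R v \<in> S"
proof -
  obtain G where G: "open G" "S = E \<inter> G" using assms(1) by (auto simp: openin_open)
  let ?T = "(\<lambda>t. x + t *\<^sub>R v) -` G"
  have "open ?T" using G(1) by (intro open_vimage continuous_intros)
  moreover have "x + t *\<^sub>R v \<in> E" for t
    using assms G by (auto intro: subspace_add subspace_scale)
  ultimately show thesis using that[of ?T] G assms(3) by auto
qed

lemma has_vector_derivative_compose_within:
  assumes "(\<gamma> has_vector_derivative w) (at t0)" "open T" "t0 \<in> T" "\<gamma> ` T \<subseteq> S"
    and "(f has_derivative D) (at (\<gamma> t0) within S)"
  shows "((\<lambda>t. f (\<gamma> t)) has_vector_derivative D w) (at t0)"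
proof -
  have "(\<gamma> has_derivative (\<lambda>t. t *\<^sub>R w)) (at t0 within T)"
    using assms(1) by (auto simp: has_vector_derivative_def intro: has_derivative_at_withinI)
  moreover have "(f has_derivative D) (at (\<gamma> t0) within \<gamma> ` T)"
    using assms(5,4) by (rule has_derivative_subset)
  ultimately have "((\<lambda>t. f (\<gamma> t)) has_derivative (\<lambda>t. D (t *\<^sub>R w))) (at t0 within T)"
    by (rule has_derivative_in_compose)
  moreover have "D (t *\<^sub>R w) = t *\<^sub>R D w" for t
    by (rule linear_cmul[OF has_derivative_linear[OF assms(5)]])
  ultimately show ?thesis
    using assms(2,3) by (simp add: has_vector_derivative_def at_within_open[OF assms(3,2)])
qed

lemma has_vector_derivative_dir_deriv:
  fixes E :: "'e::real_normed_vector set"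
  assumes "openin (top_of_set E) S" "subspace E" "x \<in> S" "v \<in> E" "(f has_derivative D) (at x within S)"
  shows "((\<lambda>t. f (x + t *\<^sub>R v)) has_vector_derivative D v) (at 0)"
proof -
  obtain T where T: "open T" "(0::real) \<in> T" "\<And>t. t \<in> T \<Longrightarrow> x + t *\<^sub>R v \<in> S"
    using line_in_relopen[OF assms(1-4)] by metis
  have "((\<lambda>t. x + t *\<^sub>R v) has_vector_derivative v) (at 0)"
    by (auto intro!: derivative_eq_intros)
  then show ?thesis
    by (rule has_vector_derivative_compose_within[OF _ T(1,2)]) (use T assms(5) in auto)
qed

lemma dir_deriv_eq:
  fixes E :: "'e::real_normed_vector set"
  assumes "openin (top_of_set E) S" "subspace E" "x \<in> S" "v \<in> E" "(f has_derivative D) (at x within S)"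
  shows "dir_deriv f x v = D v"
  using has_vector_derivative_dir_deriv[OF assms] by (simp add: dir_deriv_def vector_derivative_at)

lemma dir_deriv_cong:
  fixes E :: "'e::real_normed_vector set"
  assumes "openin (top_of_set E) S" "subspace E" "x \<in> S" "v \<in> E" "\<And>y. y \<in> S \<Longrightarrow> f y = g y"
  shows "dir_deriv f x v = dir_deriv g x v"
proof -
  obtain T where T: "open T" "(0::real) \<in> T" "\<And>t. t \<in> T \<Longrightarrow> x + t *\<^sub>R v \<in> S"
    using line_in_relopen[OF assms(1-4)] by metis
  have "eventually (\<lambda>t. f (x + t *\<^sub>R v) = g (x + t *\<^sub>R v)) (nhds 0)"
    using T assms(5) by (auto simp: eventually_nhds)
  then show ?thesis unfolding dir_deriv_def by (intro vector_derivative_cong_eq) auto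
qed

lemma smooth_on_dir_deriv_linear:
  fixes E :: "'e::real_normed_vector set"
  assumes "openin (top_of_set E) S" "subspace E" "smooth_on S f" "x \<in> S"
  obtains D where "bounded_linear D" "(f has_derivative D) (at x within S)" "\<And>v. v \<in> E \<Longrightarrow> dir_deriv f x v = D v"
proof -
  obtain D where D: "(f has_derivative D) (at x within S)"
    using smooth_on_has_derivative[OF assms(3,4)] by metis
  then show thesis using that has_derivative_bounded_linear dir_deriv_eq[OF assms(1,2,4)] by metis
qed

section \<open>Orthogonal projection onto a subspace\<close>

definition is_proj :: "'e::euclidean_space set \<Rightarrow> ('e \<Rightarrow> 'e) \<Rightarrow> bool" where
  "is_proj F P \<longleftrightarrow> linear P \<and> (\<forall>x. P x \<in> F) \<and> (\<forall>x\<in>F. P x = x) \<and>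
     (\<forall>x. \<forall>y\<in>F. (x - P x) \<bullet> y = 0) \<and> (\<forall>x. norm (x - P x) \<le> norm x)"

definition proj :: "'e::euclidean_space set \<Rightarrow> 'e \<Rightarrow> 'e" where
  "proj F = (SOME P. is_proj F P)"

lemma is_proj_proj:
  fixes F :: "'e::euclidean_space set"
  assumes "subspace F"
  shows "is_proj F (proj F)"
proof -
  obtain B where B: "B \<subseteq> F" "pairwise orthogonal B" "\<And>x. x \<in> B \<Longrightarrow> norm x = 1" "independent B" "span B = F"
    using orthonormal_basis_subspace[OF assms] by metis
  have fin: "finite B" using B(4) by (rule independent_imp_finite)
  define P where "P x = (\<Sum>b\<in>B. (x \<bullet> b) *\<^sub>R b)" for x
  have lin: "linear P"
    unfolding P_def by (auto intro!: linearI simp: inner_add_left scaleR_add_left sum.distrib scaleR_sum_right)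
  have P_in: "P x \<in> F" for x
    unfolding P_def using B(1) by (intro subspace_sum[OF assms] subspace_scale[OF assms]) auto
  have Pb: "P x \<bullet> b = x \<bullet> b" if "b \<in> B" for x b
  proof -
    have "P x \<bullet> b = (\<Sum>c\<in>B. (x \<bullet> c) * (c \<bullet> b))" by (simp add: P_def inner_sum_left)
    also have "\<dots> = (\<Sum>c\<in>B. if c = b then x \<bullet> b else 0)"
    proof (rule sum.cong)
      fix c assume "c \<in> B"
      then show "(x \<bullet> c) * (c \<bullet> b) = (if c = b then x \<bullet> b else 0)"
        using B(2) B(3)[OF that] that by (auto simp: pairwise_def orthogonal_def dot_square_norm)
    qed simp
    also have "\<dots> = x \<bullet> b" using fin that by simp
    finally show ?thesis .
  qed
  have orth: "(x - P x) \<bullet> y = 0" if "y \<in> F" for x y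
  proof -
    have "y \<in> span B" using that B(5) by simp
    then show ?thesis
      by (induction rule: span_induct) (auto simp: inner_diff_left Pb subspace_def inner_add_right)
  qed
  have P_id: "P x = x" if "x \<in> F" for x
  proof -
    have "x - P x \<in> F" using that P_in by (intro subspace_diff assms)
    from orth[OF this, of x] show ?thesis by simp
  qed
  have "norm (x - P x) \<le> norm x" for x
  proof -
    have "(norm x)\<^sup>2 = (norm (x - P x))\<^sup>2 + (norm (P x))\<^sup>2"
      using norm_add_Pythagorean[of "x - P x" "P x"] orth[OF P_in] by (simp add: orthogonal_def)
    then have "(norm (x - P x))\<^sup>2 \<le> (norm x)\<^sup>2" by simp
    then show ?thesis by (simp add: power2_le_iff_abs_le)
  qed
  then have "is_proj F P" unfolding is_proj_def using lin P_in P_id orth by blast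
  then show ?thesis unfolding proj_def by (rule someI[of "is_proj F"])
qed

lemma
  fixes F :: "'e::euclidean_space set"
  assumes "subspace F"
  shows linear_proj: "linear (proj F)"
    and proj_in: "proj F x \<in> F"
    and proj_id: "x \<in> F \<Longrightarrow> proj F x = x"
    and proj_orthogonal: "y \<in> F \<Longrightarrow> (x - proj F x) \<bullet> y = 0"
    and norm_diff_proj_le: "norm (x - proj F x) \<le> norm x"
proof -
  note P = is_proj_proj[OF assms, unfolded is_proj_def]
  show "linear (proj F)" by (rule conjunct1[OF P])
  show "proj F x \<in> F" by (rule spec[OF conjunct1[OF conjunct2[OF P]]])
  show "proj F x = x" if "x \<in> F" by (rule bspec[OF conjunct1[OF conjunct2[OF conjunct2[OF P]]] that])
  show "(x - proj F x) \<bullet> y = 0" if "y \<in> F"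
    by (rule bspec[OF spec[OF conjunct1[OF conjunct2[OF conjunct2[OF conjunct2[OF P]]]]] that])
  show "norm (x - proj F x) \<le> norm x"
    by (rule spec[OF conjunct2[OF conjunct2[OF conjunct2[OF conjunct2[OF P]]]]])
qed

lemma bounded_linear_proj: "subspace F \<Longrightarrow> bounded_linear (proj F)"
  using linear_proj by (simp add: linear_conv_bounded_linear)

text \<open>The complementary projection annihilates the curve near \<open>t0\<close>, hence also
  its derivative.\<close>

lemma has_vector_derivative_in_subspace:
  fixes f :: "real \<Rightarrow> 'f::euclidean_space"
  assumes "(f has_vector_derivative w) (at t0)" "open T" "t0 \<in> T" "f ` T \<subseteq> E" "subspace E"
  shows "w \<in> E"
proof -
  let ?P = "proj E"
  have "((\<lambda>t. f t - ?P (f t)) has_vector_derivative w - ?P w) (at t0)"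
    by (rule has_vector_derivative_diff[OF assms(1)
          bounded_linear.has_vector_derivative[OF bounded_linear_proj[OF assms(5)] assms(1)]])
  then have "((\<lambda>t. 0) has_vector_derivative w - ?P w) (at t0)"
    by (rule has_vector_derivative_transform_within_open[OF _ assms(2,3)])
      (use proj_id[OF assms(5)] assms(4) in auto)
  then have "w - ?P w = 0"
    using vector_derivative_at[of "\<lambda>t. 0" "w - ?P w"] by simp
  then show ?thesis using proj_in[OF assms(5), of w] by simp
qed

lemma dir_deriv_in_subspace:
  fixes f :: "'e::euclidean_space \<Rightarrow> 'f::euclidean_space"
  assumes "openin (top_of_set E) S" "subspace E" "smooth_on S f" "x \<in> S" "v \<in> E"
    and "f ` S \<subseteq> E'" "subspace E'"
  shows "dir_deriv f x v \<in> E'"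
proof -
  obtain D where D: "(f has_derivative D) (at x within S)" "dir_deriv f x v = D v"
    using smooth_on_dir_deriv_linear[OF assms(1-4)] assms(5) by metis
  obtain T where T: "open T" "(0::real) \<in> T" "\<And>t. t \<in> T \<Longrightarrow> x + t *\<^sub>R v \<in> S"
    using line_in_relopen[OF assms(1,2,4,5)] by metis
  show ?thesis unfolding D(2)
    by (rule has_vector_derivative_in_subspace[OF has_vector_derivative_dir_deriv[OF assms(1,2,4,5) D(1)] T(1,2)])
      (use T(3) assms(6,7) in auto)
qed

lemma dir_deriv_compose:
  fixes f :: "'e::euclidean_space \<Rightarrow> 'f::euclidean_space"
  assumes S: "openin (top_of_set E) S" "subspace E" "smooth_on S f" "x \<in> S" "v \<in> E"
    and T: "openin (top_of_set E') T" "subspace E'" "smooth_on T g" "f ` S \<subseteq> T"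
  shows "dir_deriv (\<lambda>y. g (f y)) x v = dir_deriv g (f x) (dir_deriv f x v)"
proof -
  obtain D where D: "(f has_derivative D) (at x within S)" "dir_deriv f x v = D v"
    using smooth_on_dir_deriv_linear[OF S(1-4)] S(5) by metis
  have "T \<subseteq> E'" using T(1) openin_imp_subset by blast
  then have "dir_deriv f x v \<in> E'"
    using dir_deriv_in_subspace[OF S _ T(2)] T(4) by blast
  moreover obtain D' where D': "(g has_derivative D') (at (f x) within T)" "\<And>w. w \<in> E' \<Longrightarrow> dir_deriv g (f x) w = D' w"
    using smooth_on_dir_deriv_linear[OF T(1-3), of "f x"] S(4) T(4) by blast
  moreover have "((\<lambda>y. g (f y)) has_derivative (\<lambda>v. D' (D v))) (at x within S)"
    by (rule has_derivative_in_compose[OF D(1) has_derivative_subset[OF D'(1) T(4)]])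
  ultimately show ?thesis
    using dir_deriv_eq[OF S(1,2,4,5)] D(2) by metis
qed

text \<open>Smoothness jointly in point and direction, since the vectors transported between charts
  later vary with the base point. Locally the expression is the derivative of a smooth extension,
  expanded in the coordinates of the direction.\<close>

lemma smooth_on_dir_deriv:
  fixes f :: "'e::euclidean_space \<Rightarrow> 'f::euclidean_space"
  assumes S: "openin (top_of_set E) S" "subspace E" "smooth_on S f"
  shows "smooth_on (S \<times> E) (\<lambda>z. dir_deriv f (fst z) (snd z))"
proof (rule smooth_onI)
  fix z assume z: "z \<in> S \<times> E"
  then obtain G g where G: "open G" "fst z \<in> G" "smooth_on G g" "\<And>y. y \<in> G \<Longrightarrow> y \<in> S \<Longrightarrow> g y = f y"
    using smooth_onE[OF S(3), of "fst z"] by (metis mem_Times_iff)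
  have Ck: "Ck_on k G g" for k using G smooth_on_open_iff by blast
  let ?g' = "\<lambda>x. frechet_derivative g (at x)"
  have g': "(g has_derivative ?g' x) (at x)" if "x \<in> G" for x
    using Ck_on_SucE(1)[OF Ck] that by blast
  have sm: "smooth_on G (\<lambda>x. ?g' x b)" for b
    using Ck_on_SucE(2)[OF Ck] G(1) by (simp add: smooth_on_open_iff)
  let ?d = "\<lambda>z. \<Sum>b\<in>Basis. (snd z \<bullet> b) *\<^sub>R ?g' (fst z) b"
  have "smooth_on (G \<times> UNIV) ?d"
    by (intro smooth_on_sum smooth_on_scaleR smooth_on_inner smooth_on_snd smooth_on_const smooth_on_id
        smooth_on_compose[OF sm smooth_on_fst]) auto
  moreover have "?d y = dir_deriv f (fst y) (snd y)" if y: "y \<in> (G \<times> UNIV) \<inter> (S \<times> E)" for y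
  proof -
    obtain x v where y: "y = (x, v)" "x \<in> G" "x \<in> S" "v \<in> E" using y by auto
    have "openin (top_of_set E) (S \<inter> G)" using S(1) G(1) by (simp add: openin_Int_open)
    then have "dir_deriv f x v = dir_deriv g x v"
      using y G(4) by (intro dir_deriv_cong[of E "S \<inter> G"]) (auto simp: S(2))
    also have "\<dots> = ?g' x v"
      by (rule dir_deriv_eq[OF S(1,2) y(3,4)]) (rule has_derivative_at_withinI[OF g'[OF y(2)]])
    also have "\<dots> = ?d y"
      using linear_sum_Basis[OF has_derivative_linear[OF g'[OF y(2)]], of v] y by simp
    finally show ?thesis by (simp add: y)
  qed
  moreover have "open (G \<times> (UNIV::'e set))" "z \<in> G \<times> UNIV"
    using G z by (auto intro: open_Times)
  ultimately show "\<exists>G g. open G \<and> z \<in> G \<and> smooth_on G g \<and> (\<forall>y\<in>G \<inter> S \<times> E. g y = dir_deriv f (fst y) (snd y))"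
    by (intro exI[of _ "G \<times> UNIV"] exI[of _ ?d]) auto
qed

text \<open>Only the derivative in the direction of the segment has to vanish. This suits maps that
  are constant along plaques but not elsewhere.\<close>

lemma zero_derivative_on_segment:
  assumes "convex S" "x \<in> S" "y \<in> S"
    and D: "\<And>z. z \<in> S \<Longrightarrow> \<exists>D. (f has_derivative D) (at z within S) \<and> D (y - x) = 0"
  shows "f x = f y"
proof -
  let ?\<gamma> = "\<lambda>t::real. x + t *\<^sub>R (y - x)"
  have \<gamma>: "?\<gamma> t \<in> S" if "t \<in> {0..1}" for t
    using convexD_alt[OF assms(1-3), of t] that by (simp add: algebra_simps)
  have "((\<lambda>t. f (?\<gamma> t)) has_derivative (\<lambda>h. 0)) (at t within {0..1})" if t: "t \<in> {0..1}" for t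
  proof -
    obtain D where D: "(f has_derivative D) (at (?\<gamma> t) within S)" "D (y - x) = 0"
      using assms(4)[OF \<gamma>[OF t]] by blast
    have "(?\<gamma> has_derivative (\<lambda>h. h *\<^sub>R (y - x))) (at t within {0..1})"
      by (auto intro!: derivative_eq_intros)
    from has_derivative_in_compose[OF this has_derivative_subset[OF D(1)]] \<gamma>
    have "((\<lambda>t. f (?\<gamma> t)) has_derivative (\<lambda>h. D (h *\<^sub>R (y - x)))) (at t within {0..1})" by blast
    moreover have "D (h *\<^sub>R (y - x)) = 0" for h
      using linear_cmul[OF has_derivative_linear[OF D(1)], of h "y - x"] D(2) by simp
    ultimately show ?thesis by simp
  qed
  from has_derivative_zero_unique[OF _ this, of 0 1] show ?thesis by simp
qed

lemma smooth_on_eqI: "smooth_on S g \<Longrightarrow> (\<And>x. x \<in> S \<Longrightarrow> f x = g x) \<Longrightarrow> smooth_on S f"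
  by (subst smooth_on_cong) auto

subsection \<open>Charts and tangent vectors\<close>

abbreviation transition :: "('a, 'e) chart \<Rightarrow> ('a, 'f) chart \<Rightarrow> 'e \<Rightarrow> 'f" where
  "transition c d \<equiv> snd d \<circ> chart_inv c"

text \<open>The locale speaks of arbitrary atlases, so that it also applies to an atlas enlarged by
  one chart and to the atlas of a leaf.\<close>

locale atlas_space =
  fixes E :: "'e::euclidean_space set" and X :: "'a topology" and A :: "('a, 'e) chart set"
  assumes subspace_E: "subspace E" and atlas: "smooth_atlas E X A"
begin

lemma openin_chart: "c \<in> A \<Longrightarrow> openin X (fst c)"
  and openin_chart_image: "c \<in> A \<Longrightarrow> openin (top_of_set E) (snd c ` fst c)"
  and homeomorphic_chart: "c \<in> A \<Longrightarrow> homeomorphic_map (subtopology X (fst c)) (top_of_set (snd c ` fst c)) (snd c)"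
  and smooth_transition: "c \<in> A \<Longrightarrow> d \<in> A \<Longrightarrow> smooth_on (snd c ` (fst c \<inter> fst d)) (transition c d)"
  and charts_cover: "(\<Union>c\<in>A. fst c) = topspace X"
  using atlas by (simp_all add: smooth_atlas_def)

lemma chart_subset: "c \<in> A \<Longrightarrow> fst c \<subseteq> topspace X"
  using openin_chart openin_subset by blast

lemma obtain_chart:
  assumes "p \<in> topspace X" obtains c where "c \<in> A" "p \<in> fst c"
  using charts_cover assms by blast

lemma inj_on_chart:
  assumes "c \<in> A" shows "inj_on (snd c) (fst c)"
  using homeomorphic_imp_injective_map[OF homeomorphic_chart[OF assms]] chart_subset[OF assms]
  by (simp add: Int_absorb1)

lemma chart_inv_left: "c \<in> A \<Longrightarrow> p \<in> fst c \<Longrightarrow> chart_inv c (snd c p) = p"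
  unfolding chart_inv_def using inj_on_chart by (simp add: inv_into_f_f)

lemma chart_inv_right: "y \<in> snd c ` fst c \<Longrightarrow> snd c (chart_inv c y) = y"
  unfolding chart_inv_def by (rule f_inv_into_f)

lemma chart_inv_in: "y \<in> snd c ` fst c \<Longrightarrow> chart_inv c y \<in> fst c"
  unfolding chart_inv_def by (rule inv_into_into)

lemma chart_in_E: "c \<in> A \<Longrightarrow> p \<in> fst c \<Longrightarrow> snd c p \<in> E"
  using openin_chart_image openin_imp_subset by blast

lemma openin_image_open:
  assumes "c \<in> A" "openin X G" "G \<subseteq> fst c"
  shows "openin (top_of_set E) (snd c ` G)"
proof -
  have "openin (subtopology X (fst c)) G"
    using assms by (simp add: openin_open_subtopology openin_chart)
  then have "openin (top_of_set (snd c ` fst c)) (snd c ` G)"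
    using homeomorphic_imp_open_map[OF homeomorphic_chart[OF assms(1)]] by (simp add: open_map_def)
  then show ?thesis using openin_chart_image[OF assms(1)] openin_trans by blast
qed

lemma continuous_chart: "c \<in> A \<Longrightarrow> continuous_map (subtopology X (fst c)) (top_of_set (snd c ` fst c)) (snd c)"
  by (rule homeomorphic_imp_continuous_map[OF homeomorphic_chart])

lemma openin_preimage_fun:
  assumes c: "c \<in> A" and G: "openin X G" "G \<subseteq> fst c" and f: "continuous_on (snd c ` G) f" and "open H"
  shows "openin X {p \<in> G. f (snd c p) \<in> H}"
proof -
  have "openin (top_of_set (snd c ` G)) (snd c ` G \<inter> f -` H)"
    using f \<open>open H\<close> by (rule continuous_openin_preimage_gen)
  then have "openin (top_of_set E) (snd c ` G \<inter> f -` H)"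
    using openin_image_open[OF c G] openin_trans by blast
  then have "openin (top_of_set (snd c ` fst c)) (snd c ` G \<inter> f -` H)"
    by (rule openin_subset_trans) (use G openin_imp_subset[OF openin_chart_image[OF c]] in auto)
  then have "openin (subtopology X (fst c)) {p \<in> topspace (subtopology X (fst c)). snd c p \<in> snd c ` G \<inter> f -` H}"
    using continuous_chart[OF c] openin_continuous_map_preimage by blast
  moreover have "{p \<in> topspace (subtopology X (fst c)). snd c p \<in> snd c ` G \<inter> f -` H} = {p \<in> G. f (snd c p) \<in> H}"
  proof -
    have "snd c p \<in> snd c ` G \<longleftrightarrow> p \<in> G" if "p \<in> fst c" for p
      using inj_on_image_mem_iff[OF inj_on_chart[OF c] that G(2)] .
    then show ?thesis using G(2) chart_subset[OF c] by auto
  qed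
  ultimately show ?thesis using openin_chart[OF c] by (simp add: openin_open_subtopology)
qed

lemma openin_preimage:
  assumes "c \<in> A" "open H"
  shows "openin X {p \<in> fst c. snd c p \<in> H}"
  using openin_preimage_fun[OF assms(1) openin_chart[OF assms(1)] order_refl continuous_on_id assms(2)] .

lemma openin_transition_domain:
  assumes "c \<in> A" "d \<in> A" shows "openin (top_of_set E) (snd c ` (fst c \<inter> fst d))"
  using assms by (intro openin_image_open openin_Int openin_chart) auto

lemma transition_in_E:
  assumes "c \<in> A" "d \<in> A" shows "transition c d ` snd c ` (fst c \<inter> fst d) \<subseteq> E"
  using assms chart_in_E chart_inv_left by fastforce

section \<open>Tangent vectors in coordinates\<close>

definition tderiv :: "('a, 'e) chart \<Rightarrow> ('a, 'e) chart \<Rightarrow> 'a \<Rightarrow> 'e \<Rightarrow> 'e" where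
  "tderiv c d p u = dir_deriv (transition c d) (snd c p) u"

lemma tderiv_linear:
  assumes "c \<in> A" "d \<in> A" "p \<in> fst c" "p \<in> fst d"
  obtains L where "bounded_linear L"
    "(transition c d has_derivative L) (at (snd c p) within snd c ` (fst c \<inter> fst d))"
    "\<And>v. v \<in> E \<Longrightarrow> tderiv c d p v = L v"
proof -
  have "snd c p \<in> snd c ` (fst c \<inter> fst d)" using assms by blast
  then show thesis
    using smooth_on_dir_deriv_linear[OF openin_transition_domain[OF assms(1,2)] subspace_E
        smooth_transition[OF assms(1,2)]] that unfolding tderiv_def by blast
qed

lemma tderiv_in_E:
  assumes "c \<in> A" "d \<in> A" "p \<in> fst c" "p \<in> fst d" "u \<in> E"
  shows "tderiv c d p u \<in> E"
  unfolding tderiv_def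
  by (rule dir_deriv_in_subspace[OF openin_transition_domain[OF assms(1,2)] subspace_E
        smooth_transition[OF assms(1,2)] _ assms(5) transition_in_E[OF assms(1,2)] subspace_E])
    (use assms in auto)

lemma tderiv_chain:
  assumes "c \<in> A" "d \<in> A" "e \<in> A" "p \<in> fst c" "p \<in> fst d" "p \<in> fst e" "u \<in> E"
  shows "tderiv d e p (tderiv c d p u) = tderiv c e p u"
proof -
  let ?S = "snd c ` (fst c \<inter> fst d \<inter> fst e)"
  have S: "openin (top_of_set E) ?S"
    using assms by (intro openin_image_open openin_Int openin_chart) auto
  have pS: "snd c p \<in> ?S" using assms by blast
  have "dir_deriv (transition c e) (snd c p) u = dir_deriv (\<lambda>y. transition d e (transition c d y)) (snd c p) u"
    by (rule dir_deriv_cong[OF S subspace_E pS assms(7)])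
      (use chart_inv_left[OF assms(1)] chart_inv_left[OF assms(2)] in auto)
  also have "\<dots> = dir_deriv (transition d e) (transition c d (snd c p)) (dir_deriv (transition c d) (snd c p) u)"
  proof (rule dir_deriv_compose[OF S subspace_E _ pS assms(7) openin_transition_domain[OF assms(2,3)] subspace_E
        smooth_transition[OF assms(2,3)]])
    show "smooth_on ?S (transition c d)"
      by (rule smooth_on_subset[OF smooth_transition[OF assms(1,2)]]) auto
    show "transition c d ` ?S \<subseteq> snd d ` (fst d \<inter> fst e)"
      using chart_inv_left[OF assms(1)] by auto
  qed
  also have "transition c d (snd c p) = snd d p" using assms chart_inv_left by simp
  finally show ?thesis unfolding tderiv_def by (rule sym)
qed

lemma tderiv_self:
  assumes "c \<in> A" "p \<in> fst c" "u \<in> E"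
  shows "tderiv c c p u = u"
proof -
  have "tderiv c c p u = dir_deriv (\<lambda>y. y) (snd c p) u" unfolding tderiv_def
    by (rule dir_deriv_cong[OF openin_chart_image[OF assms(1)] subspace_E _ assms(3)])
      (use assms(2) chart_inv_left[OF assms(1)] in auto)
  also have "\<dots> = u"
    by (rule dir_deriv_eq[OF openin_chart_image[OF assms(1)] subspace_E _ assms(3)])
      (use assms in auto)
  finally show ?thesis .
qed

definition tvec :: "('a, 'e) chart \<Rightarrow> 'a \<Rightarrow> 'e \<Rightarrow> ('a, 'e) tvec" where
  "tvec c p u = (\<lambda>d. if d \<in> A \<and> p \<in> fst d then tderiv c d p u else 0)"

lemma tvec_coord: "d \<in> A \<Longrightarrow> p \<in> fst d \<Longrightarrow> tvec c p u d = tderiv c d p u"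
  by (simp add: tvec_def)

lemma tvec_self: "c \<in> A \<Longrightarrow> p \<in> fst c \<Longrightarrow> u \<in> E \<Longrightarrow> tvec c p u c = u"
  by (simp add: tvec_def tderiv_self)

lemma tangent_space_iff:
  "v \<in> tangent_space E A p \<longleftrightarrow> (\<forall>c. \<not> (c \<in> A \<and> p \<in> fst c) \<longrightarrow> v c = 0) \<and>
     (\<forall>c\<in>A. p \<in> fst c \<longrightarrow> v c \<in> E) \<and>
     (\<forall>c\<in>A. \<forall>d\<in>A. p \<in> fst c \<and> p \<in> fst d \<longrightarrow> v d = tderiv c d p (v c))"
  by (simp add: tangent_space_def tderiv_def)

lemma tvec_in_tangent_space:
  assumes "c \<in> A" "p \<in> fst c" "u \<in> E"
  shows "tvec c p u \<in> tangent_space E A p"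
  unfolding tangent_space_iff
  using assms by (auto simp: tvec_def tderiv_in_E tderiv_chain)

lemma tangent_space_tvec:
  assumes "v \<in> tangent_space E A p" "c \<in> A" "p \<in> fst c"
  shows "v = tvec c p (v c)"
  using assms unfolding tangent_space_iff tvec_def by (intro ext) metis

lemma tangent_in_E: "v \<in> tangent_space E A p \<Longrightarrow> c \<in> A \<Longrightarrow> p \<in> fst c \<Longrightarrow> v c \<in> E"
  unfolding tangent_space_iff by blast

lemma tangent_space_eqI:
  assumes "v \<in> tangent_space E A p" "w \<in> tangent_space E A p" "c \<in> A" "p \<in> fst c" "v c = w c"
  shows "v = w"
  using tangent_space_tvec[OF assms(1,3,4)] tangent_space_tvec[OF assms(2,3,4)] assms(5) by simp

lemma tangent_coord_change:
  assumes "v \<in> tangent_space E A p" "c \<in> A" "p \<in> fst c" "d \<in> A" "p \<in> fst d"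
  shows "v d = tderiv c d p (v c)"
  using assms unfolding tangent_space_iff by blast

lemma tangent_space_sum:
  assumes "\<And>i. i \<in> I \<Longrightarrow> v i \<in> tangent_space E A p"
  shows "(\<lambda>d. \<Sum>i\<in>I. r i *\<^sub>R v i d) \<in> tangent_space E A p"
  unfolding tangent_space_iff
proof (intro conjI allI ballI impI)
  show "(\<Sum>i\<in>I. r i *\<^sub>R v i c) = 0" if "\<not> (c \<in> A \<and> p \<in> fst c)" for c
  proof (intro sum.neutral ballI)
    fix i assume "i \<in> I"
    then have "v i c = 0" using assms that unfolding tangent_space_iff by blast
    then show "r i *\<^sub>R v i c = 0" by simp
  qed
  show "(\<Sum>i\<in>I. r i *\<^sub>R v i c) \<in> E" if "c \<in> A" "p \<in> fst c" for c
    using tangent_in_E[OF assms that] by (intro subspace_sum subspace_scale subspace_E)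
  fix c d assume cd: "c \<in> A" "d \<in> A" "p \<in> fst c \<and> p \<in> fst d"
  obtain L where L: "bounded_linear L" "\<And>v. v \<in> E \<Longrightarrow> tderiv c d p v = L v"
    using tderiv_linear cd by metis
  have lin: "linear L" using L(1) by (simp add: linear_conv_bounded_linear)
  have E: "v i c \<in> E" if "i \<in> I" for i using tangent_in_E[OF assms[OF that]] cd by blast
  have "(\<Sum>i\<in>I. r i *\<^sub>R v i d) = (\<Sum>i\<in>I. r i *\<^sub>R L (v i c))"
  proof (rule sum.cong)
    fix i assume i: "i \<in> I"
    have "v i d = tderiv c d p (v i c)" using tangent_coord_change[OF assms[OF i]] cd by blast
    then show "r i *\<^sub>R v i d = r i *\<^sub>R L (v i c)" using L(2)[OF E[OF i]] by (simp only:)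
  qed simp
  also have "\<dots> = L (\<Sum>i\<in>I. r i *\<^sub>R v i c)" by (simp add: linear_sum[OF lin] linear_cmul[OF lin])
  also have "\<dots> = tderiv c d p (\<Sum>i\<in>I. r i *\<^sub>R v i c)"
    using E by (intro L(2)[symmetric] subspace_sum subspace_scale subspace_E) auto
  finally show "(\<Sum>i\<in>I. r i *\<^sub>R v i d) = tderiv c d p (\<Sum>i\<in>I. r i *\<^sub>R v i c)" .
qed

lemma tangent_space_add:
  assumes "v \<in> tangent_space E A p" "w \<in> tangent_space E A p"
  shows "tadd v w \<in> tangent_space E A p"
  using tangent_space_sum[of "{True, False}" "\<lambda>b. if b then v else w" p "\<lambda>_. 1"] assms
  by (simp add: tadd_def)

lemma tangent_space_zero: "tzero \<in> tangent_space E A p"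
  using tangent_space_sum[of "{}"] by (simp add: tzero_def)

text \<open>A chart restricted to \<open>V\<close> and followed by a diffeomorphism \<open>f\<close>
  of its image is compatible with the atlas. Together with maximality this is the source of new
  charts.\<close>

lemma smooth_atlas_insertI:
  assumes c: "c \<in> A" and V: "openin X V" "V \<subseteq> fst c"
    and f: "smooth_on (snd c ` V) f" and fV: "openin (top_of_set E) (f ` snd c ` V)"
    and g: "smooth_on (f ` snd c ` V) g" and gf: "\<And>p. p \<in> V \<Longrightarrow> g (f (snd c p)) = snd c p"
  shows "smooth_atlas E X (insert (V, f \<circ> snd c) A)"
proof -
  let ?c = "(V, f \<circ> snd c)"
  have inv: "chart_inv ?c z = chart_inv c (g z)" if z: "z \<in> f ` snd c ` V" for z
  proof -
    obtain p where p: "p \<in> V" "z = f (snd c p)" using z by blast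
    have "inj_on (f \<circ> snd c) V"
      by (rule inj_on_inverseI[where g="\<lambda>z. chart_inv c (g z)"]) (use gf V chart_inv_left[OF c] in auto)
    then have "chart_inv ?c z = p" unfolding chart_inv_def using p by (simp add: inv_into_f_eq)
    also have "p = chart_inv c (g z)" using p gf chart_inv_left[OF c] V by auto
    finally show ?thesis .
  qed
  have inv': "chart_inv ?c (f (snd c p)) = p" if "p \<in> V" for p
    using inv[of "f (snd c p)"] gf[OF that] chart_inv_left[OF c] V that by auto
  have homeo1: "homeomorphic_map (subtopology X V) (top_of_set (snd c ` V)) (snd c)"
  proof -
    have "homeomorphic_map (subtopology (subtopology X (fst c)) V) (subtopology (top_of_set (snd c ` fst c)) (snd c ` V)) (snd c)"
      by (rule homeomorphic_map_subtopologies[OF homeomorphic_chart[OF c]])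
        (use V chart_subset[OF c] in auto)
    then show ?thesis using V(2) by (simp add: subtopology_subtopology Int_absorb1 image_mono)
  qed
  have "homeomorphic_maps (top_of_set (snd c ` V)) (top_of_set (f ` snd c ` V)) f g"
    unfolding homeomorphic_maps_def
    using smooth_on_imp_continuous_on[OF f] smooth_on_imp_continuous_on[OF g] gf by auto
  then have "homeomorphic_map (top_of_set (snd c ` V)) (top_of_set (f ` snd c ` V)) f"
    by (rule homeomorphic_maps_imp_map)
  from homeomorphic_map_compose[OF homeo1 this]
  have homeo: "homeomorphic_map (subtopology X V) (top_of_set (f ` snd c ` V)) (f \<circ> snd c)" .
  have trans_to: "smooth_on ((f \<circ> snd c) ` (V \<inter> fst d)) (transition ?c d)" if d: "d \<in> A" for d
  proof -
    have "smooth_on ((f \<circ> snd c) ` (V \<inter> fst d)) (\<lambda>z. transition c d (g z))"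
      by (rule smooth_on_compose[OF smooth_transition[OF c d] smooth_on_subset[OF g]])
        (use gf V in auto)
    then show ?thesis
      by (subst smooth_on_cong[where g="\<lambda>z. transition c d (g z)"]) (auto simp: inv)
  qed
  have trans_from: "smooth_on (snd d ` (fst d \<inter> V)) (f \<circ> snd c \<circ> chart_inv d)" if d: "d \<in> A" for d
  proof -
    have "smooth_on (snd d ` (fst d \<inter> V)) (\<lambda>z. f (transition d c z))"
      by (rule smooth_on_compose[OF f smooth_on_subset[OF smooth_transition[OF d c]]])
        (use V chart_inv_left[OF d] in auto)
    then show ?thesis by (simp add: comp_def)
  qed
  have self: "smooth_on ((f \<circ> snd c) ` V) (f \<circ> snd c \<circ> chart_inv ?c)"
    by (subst smooth_on_cong[where g="\<lambda>z. z"]) (auto simp: inv' smooth_on_id)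
  show ?thesis
    unfolding smooth_atlas_def
  proof (intro conjI ballI)
    fix a assume a: "a \<in> insert ?c A"
    then consider "a = ?c" | "a \<in> A" by blast
    note a_cases = this
    show "openin X (fst a)"
      by (cases rule: a_cases) (use V openin_chart[of a] in simp_all)
    show "openin (top_of_set E) (snd a ` fst a)"
      by (cases rule: a_cases) (use fV openin_chart_image[of a] in \<open>simp_all add: image_comp\<close>)
    show "homeomorphic_map (subtopology X (fst a)) (top_of_set (snd a ` fst a)) (snd a)"
      by (cases rule: a_cases) (use homeo homeomorphic_chart[of a] in \<open>simp_all add: image_comp\<close>)
    fix b assume b: "b \<in> insert ?c A"
    then consider "b = ?c" | "b \<in> A" by blast
    note b_cases = this
    show "smooth_on (snd a ` (fst a \<inter> fst b)) (snd b \<circ> chart_inv a)"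
    proof (cases rule: a_cases)
      case 1
      then show ?thesis by (cases rule: b_cases) (use self trans_to[of b] in simp_all)
    next
      case 2
      then show ?thesis
        by (cases rule: b_cases) (use trans_from[of a] smooth_transition[of a b] in simp_all)
    qed
  next
    show "(\<Union>c\<in>insert ?c A. fst c) = topspace X"
      using charts_cover openin_subset[OF V(1)] by auto
  qed
qed

text \<open>\<open>sub_tangent_space\<close> asks for smoothness of a curve in some chart, while its
  velocity has to be computed in another, such as a slice chart. The time interval shrinks because
  the curve may leave the domain of \<open>d\<close>.\<close>

lemma smooth_curve_velocity:
  assumes c: "c \<in> A" "0 < \<epsilon>" "\<gamma> ` {-\<epsilon><..<\<epsilon>} \<subseteq> fst c" "smooth_on {-\<epsilon><..<\<epsilon>} (snd c \<circ> \<gamma>)"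
    and d: "d \<in> A" "\<gamma> 0 \<in> fst d"
  obtains \<delta> where "0 < \<delta>" "\<delta> \<le> \<epsilon>" "\<gamma> ` {-\<delta><..<\<delta>} \<subseteq> fst d"
    "((snd d \<circ> \<gamma>) has_vector_derivative velocity A \<gamma> d) (at 0)"
proof -
  let ?I = "{-\<epsilon><..<\<epsilon>}"
  have 0: "0 \<in> ?I" using c(2) by simp
  have "openin (top_of_set E) (snd c ` (fst c \<inter> fst d))" by (rule openin_transition_domain[OF c(1) d(1)])
  then obtain G where G: "open G" "snd c ` (fst c \<inter> fst d) = E \<inter> G" by (auto simp: openin_open)
  let ?J = "?I \<inter> (snd c \<circ> \<gamma>) -` G"
  have J: "open ?J"
    by (rule continuous_open_preimage[OF smooth_on_imp_continuous_on[OF c(4)] _ G(1)]) simp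
  have "\<gamma> 0 \<in> fst c" using c(3) 0 by blast
  then have 0: "0 \<in> ?J" using 0 d(2) G(2) by auto
  have inJ: "\<gamma> t \<in> fst c \<inter> fst d" if "t \<in> ?J" for t
  proof -
    have "\<gamma> t \<in> fst c" using that c(3) by blast
    have "snd c (\<gamma> t) \<in> snd c ` (fst c \<inter> fst d)"
      using that G(2) chart_in_E[OF c(1) \<open>\<gamma> t \<in> fst c\<close>] by auto
    then obtain q where q: "q \<in> fst c" "q \<in> fst d" "snd c (\<gamma> t) = snd c q" by auto
    then have "\<gamma> t = q" using inj_onD[OF inj_on_chart[OF c(1)] q(3) \<open>\<gamma> t \<in> fst c\<close> q(1)] by simp
    then show ?thesis using q by simp
  qed
  obtain \<delta> where \<delta>: "0 < \<delta>" "ball 0 \<delta> \<subseteq> ?J" using J 0 by (metis openE)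
  have "ball 0 \<delta> = {-\<delta><..<\<delta>}" by (auto simp: dist_real_def)
  with \<delta> have \<delta>J: "{-\<delta><..<\<delta>} \<subseteq> ?J" by simp
  have "\<delta> \<le> \<epsilon>"
  proof (rule ccontr)
    assume "\<not> \<delta> \<le> \<epsilon>"
    then have "\<epsilon> \<in> {-\<delta><..<\<delta>}" using c(2) by auto
    then show False using \<delta>J by auto
  qed
  moreover have "\<gamma> ` {-\<delta><..<\<delta>} \<subseteq> fst d" using inJ \<delta>J by blast
  moreover have "((snd d \<circ> \<gamma>) has_vector_derivative velocity A \<gamma> d) (at 0)"
  proof -
    obtain D where "((snd c \<circ> \<gamma>) has_derivative D) (at 0 within ?I)"
      using smooth_on_has_derivative[OF c(4), of 0] c(2) by auto
    then have "((snd c \<circ> \<gamma>) has_derivative D) (at 0)"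
      using c(2) at_within_open[of 0 ?I] by simp
    then have D: "((snd c \<circ> \<gamma>) has_vector_derivative D 1) (at 0)"
    proof -
      have "D = (\<lambda>t. t *\<^sub>R D 1)"
      proof
        fix t
        have "linear D" using \<open>(_ has_derivative D) (at 0)\<close> by (rule has_derivative_linear)
        from linear_cmul[OF this, of t 1] show "D t = t *\<^sub>R D 1" by simp
      qed
      then show ?thesis
        using \<open>(_ has_derivative D) (at 0)\<close> unfolding has_vector_derivative_def by metis
    qed
    obtain L where L: "(transition c d has_derivative L) (at (snd c (\<gamma> 0)) within snd c ` (fst c \<inter> fst d))"
      using tderiv_linear[OF c(1) d(1) _ d(2)] inJ[OF 0] by blast
    have "((\<lambda>t. transition c d ((snd c \<circ> \<gamma>) t)) has_vector_derivative L (D 1)) (at 0)"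
    proof (rule has_vector_derivative_compose_within[OF D J 0])
      show "(snd c \<circ> \<gamma>) ` ?J \<subseteq> snd c ` (fst c \<inter> fst d)" using inJ by auto
      show "(transition c d has_derivative L) (at ((snd c \<circ> \<gamma>) 0) within snd c ` (fst c \<inter> fst d))"
        unfolding comp_apply[of "snd c" \<gamma>] by (rule L)
    qed
    then have "((snd d \<circ> \<gamma>) has_vector_derivative L (D 1)) (at 0)"
      by (rule has_vector_derivative_transform_within_open[OF _ J 0]) (use inJ chart_inv_left[OF c(1)] in auto)
    then show ?thesis
      using d by (simp add: velocity_def vector_derivative_at)
  qed
  ultimately show thesis using that \<delta>(1) by blast
qed

end

text \<open>Two charts compatible with \<open>B0\<close> are compatible with each other, because
  near any point their transition map factors through a chart \<open>e\<close> of \<open>B0\<close>.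
  A leaf is given by a single chart, whereas \<open>smooth_manifold\<close> demands a maximal
  atlas.\<close>

lemma maximal_atlas:
  assumes E: "subspace E" and B0: "smooth_atlas E X B0"
  defines "B \<equiv> {c. smooth_atlas E X (insert c B0)}"
  shows "B0 \<subseteq> B" "smooth_atlas E X B" "\<And>c. smooth_atlas E X (insert c B) \<Longrightarrow> c \<in> B"
proof -
  interpret B0: atlas_space E X B0 by unfold_locales fact+
  show sub: "B0 \<subseteq> B" using B0 by (auto simp: B_def insert_absorb)
  have one: "atlas_space E X (insert c B0)" if "c \<in> B" for c
    using that E by (simp add: B_def atlas_space_def)
  show "smooth_atlas E X B"
    unfolding smooth_atlas_def
  proof (intro conjI ballI)
    fix c assume c: "c \<in> B"
    interpret c: atlas_space E X "insert c B0" by (rule one[OF c])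
    show "openin X (fst c)" by (rule c.openin_chart) simp
    show "openin (top_of_set E) (snd c ` fst c)" by (rule c.openin_chart_image) simp
    show "homeomorphic_map (subtopology X (fst c)) (top_of_set (snd c ` fst c)) (snd c)"
      by (rule c.homeomorphic_chart) simp
    fix d assume d: "d \<in> B"
    interpret d: atlas_space E X "insert d B0" by (rule one[OF d])
    show "smooth_on (snd c ` (fst c \<inter> fst d)) (snd d \<circ> chart_inv c)"
    proof (rule smooth_on_local)
      fix y assume "y \<in> snd c ` (fst c \<inter> fst d)"
      then obtain p where p: "p \<in> fst c" "p \<in> fst d" "y = snd c p" by blast
      then have "p \<in> topspace X" using c.chart_subset by blast
      then obtain e where e: "e \<in> B0" "p \<in> fst e" by (rule B0.obtain_chart)
      have "openin (top_of_set E) (snd c ` (fst c \<inter> fst e))"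
        using e by (intro c.openin_transition_domain) auto
      then obtain G where G: "open G" "snd c ` (fst c \<inter> fst e) = E \<inter> G" by (auto simp: openin_open)
      let ?S = "snd c ` (fst c \<inter> fst d) \<inter> G"
      have S: "chart_inv c z \<in> fst c \<inter> fst d \<inter> fst e" if "z \<in> ?S" for z
      proof -
        have "z \<in> E" using that c.chart_in_E[of c] by auto
        then have "z \<in> snd c ` (fst c \<inter> fst e)" using that G(2) by blast
        then obtain q where "q \<in> fst c" "q \<in> fst e" "z = snd c q" by blast
        moreover have "chart_inv c z \<in> fst d" using that c.chart_inv_left[of c] by auto
        ultimately show ?thesis using c.chart_inv_left[of c] by auto
      qed
      have "smooth_on ?S (\<lambda>z. transition e d (transition c e z))"
      proof (rule smooth_on_compose[where g="transition e d" and f="transition c e"])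
        show "smooth_on (snd e ` (fst e \<inter> fst d)) (transition e d)"
          using e by (intro d.smooth_transition) auto
        show "smooth_on ?S (transition c e)"
          by (rule smooth_on_subset[OF c.smooth_transition[of c e]])
            (use e G c.chart_in_E[of c] in auto)
        show "transition c e ` ?S \<subseteq> snd e ` (fst e \<inter> fst d)" using S by auto
      qed
      then have "smooth_on ?S (transition c d)"
      proof (rule smooth_on_eqI)
        show "transition c d z = transition e d (transition c e z)" if "z \<in> ?S" for z
          using S[OF that] B0.chart_inv_left[OF e(1)] by auto
      qed
      moreover have "y \<in> G" using p e G(2) by blast
      ultimately show "\<exists>G. open G \<and> y \<in> G \<and> smooth_on (snd c ` (fst c \<inter> fst d) \<inter> G) (transition c d)"
        using G(1) by blast
    qed
  next
    have "fst c \<subseteq> topspace X" if "c \<in> B" for c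
      using atlas_space.chart_subset[OF one[OF that]] by blast
    then show "(\<Union>c\<in>B. fst c) = topspace X" using B0.charts_cover sub by blast
  qed
  show "c \<in> B" if c: "smooth_atlas E X (insert c B)" for c
  proof -
    interpret c: atlas_space E X "insert c B" using E c by unfold_locales
    have "smooth_atlas E X (insert c B0)"
      unfolding smooth_atlas_def
    proof (intro conjI ballI)
      have sub': "insert c B0 \<subseteq> insert c B" using sub by blast
      fix a assume a: "a \<in> insert c B0"
      then have a': "a \<in> insert c B" using sub' by blast
      show "openin X (fst a)" by (rule c.openin_chart[OF a'])
      show "openin (top_of_set E) (snd a ` fst a)" by (rule c.openin_chart_image[OF a'])
      show "homeomorphic_map (subtopology X (fst a)) (top_of_set (snd a ` fst a)) (snd a)"
        by (rule c.homeomorphic_chart[OF a'])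
      fix b assume "b \<in> insert c B0"
      then have b': "b \<in> insert c B" using sub' by blast
      show "smooth_on (snd a ` (fst a \<inter> fst b)) (snd b \<circ> chart_inv a)"
        by (rule c.smooth_transition[OF a' b'])
    next
      show "(\<Union>a\<in>insert c B0. fst a) = topspace X"
        using B0.charts_cover c.chart_subset[of c] by auto
    qed
    then show ?thesis by (simp add: B_def)
  qed
qed

subsection \<open>Charts adapted to the foliation and the submanifold\<close>

locale foliated_submanifold = atlas_space E X A
  for E :: "'e::euclidean_space set" and X :: "'a topology" and A :: "('a, 'e) chart set" +
  fixes W :: "'a \<Rightarrow> ('a, 'e) tvec set" and N :: "'a set" and F :: "'e set"
  assumes maximal: "smooth_atlas E X (insert c A) \<Longrightarrow> c \<in> A"
    and subspace_F: "subspace F" and F_E: "F \<subseteq> E"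
    and foliated: "p \<in> topspace X \<Longrightarrow> \<exists>c\<in>A. p \<in> fst c \<and> (\<forall>q\<in>fst c. (\<lambda>v. v c) ` W q = F)"
    and W_tangent: "p \<in> topspace X \<Longrightarrow> W p \<subseteq> tangent_space E A p"
    and N_X: "N \<subseteq> topspace X"
    and slices: "p \<in> N \<Longrightarrow> \<exists>c\<in>A. \<exists>S. p \<in> fst c \<and> subspace S \<and> S \<subseteq> E \<and> snd c ` (fst c \<inter> N) = snd c ` fst c \<inter> S"
    and compl: "complementary E A W N"
begin

abbreviation P :: "'e \<Rightarrow> 'e" where "P \<equiv> proj F"

text \<open>In the charts constructed below, \<open>P\<close> is the coordinate along the plaques
  and \<open>Q\<close> the coordinate along \<open>N\<close>.\<close>

definition Q :: "'e \<Rightarrow> 'e" where "Q y = y - P y"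

lemma linear_P: "linear P" and linear_Q: "linear Q"
  and bounded_linear_P: "bounded_linear P" and bounded_linear_Q: "bounded_linear Q"
proof -
  show "linear P" by (rule linear_proj[OF subspace_F])
  then show "linear Q" unfolding Q_def by (intro linear_compose_sub linear_id[unfolded id_def])
  then show "bounded_linear P" "bounded_linear Q"
    using \<open>linear P\<close> by (auto simp: linear_conv_bounded_linear)
qed

lemma P_in_F: "P y \<in> F" by (rule proj_in[OF subspace_F])
lemma P_id: "y \<in> F \<Longrightarrow> P y = y" by (rule proj_id[OF subspace_F])
lemma P_P: "P (P y) = P y" by (rule P_id[OF P_in_F])
lemma Q_plus_P: "Q y + P y = y" by (simp add: Q_def)
lemma Q_F: "y \<in> F \<Longrightarrow> Q y = 0" by (simp add: Q_def P_id)
lemma Q_P: "Q (P y) = 0" by (rule Q_F[OF P_in_F])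
lemma Q_id: "P y = 0 \<Longrightarrow> Q y = y" by (simp add: Q_def)
lemma P_Q: "P (Q y) = 0" unfolding Q_def by (simp add: linear_diff[OF linear_P] P_P)
lemma Q_Q: "Q (Q y) = Q y" by (rule Q_id[OF P_Q])
lemma P_in_E: "P y \<in> E" using P_in_F F_E by blast
lemma Q_in_E: "y \<in> E \<Longrightarrow> Q y \<in> E" unfolding Q_def by (intro subspace_diff subspace_E P_in_E)
lemma Q_eq_0: "Q y = 0 \<Longrightarrow> y \<in> F" unfolding Q_def using P_in_F[of y] by simp
lemma norm_Q: "norm (Q y) \<le> norm y" unfolding Q_def by (rule norm_diff_proj_le[OF subspace_F])
lemma P_add: "P (x + y) = P x + P y" by (rule linear_add[OF linear_P])
lemma Q_add: "Q (x + y) = Q x + Q y" by (rule linear_add[OF linear_Q])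

text \<open>Complementarity gives this without computing with curves: the sum of
  \<open>tzero\<close>, an element of \<open>W p\<close>, and \<open>a\<close> is tangent.\<close>

lemma sub_tangent_tangent:
  assumes "p \<in> N" "a \<in> sub_tangent_space A N p"
  shows "a \<in> tangent_space E A p"
proof -
  have "tzero \<in> W p" using compl assms(1) unfolding complementary_def by blast
  then have "tadd tzero a \<in> tangent_space E A p"
    using compl assms unfolding complementary_def by blast
  then show ?thesis by (simp add: tadd_def tzero_def)
qed

lemma sub_tangent_in_slice:
  assumes a: "a \<in> sub_tangent_space A N p" and e: "e \<in> A" "p \<in> fst e" and S: "subspace S"
    and N: "\<And>q. q \<in> fst e \<Longrightarrow> q \<in> N \<Longrightarrow> snd e q \<in> S"
  shows "a e \<in> S"
proof -
  obtain \<gamma> c \<epsilon> where \<gamma>: "a = velocity A \<gamma>" "\<gamma> 0 = p" "c \<in> A" "\<epsilon> > 0" "\<gamma> ` {-\<epsilon><..<\<epsilon>} \<subseteq> fst c \<inter> N"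
    "smooth_on {-\<epsilon><..<\<epsilon>} (snd c \<circ> \<gamma>)"
    using a unfolding sub_tangent_space_def by blast
  have "\<gamma> ` {-\<epsilon><..<\<epsilon>} \<subseteq> fst c" using \<gamma>(5) by blast
  moreover have "\<gamma> 0 \<in> fst e" using \<gamma>(2) e(2) by simp
  ultimately obtain \<delta> where \<delta>: "0 < \<delta>" "\<delta> \<le> \<epsilon>" "\<gamma> ` {-\<delta><..<\<delta>} \<subseteq> fst e"
    "((snd e \<circ> \<gamma>) has_vector_derivative velocity A \<gamma> e) (at 0)"
    using smooth_curve_velocity[OF \<gamma>(3,4) _ \<gamma>(6) e(1)] by blast
  have "{-\<delta><..<\<delta>} \<subseteq> {-\<epsilon><..<\<epsilon>}" using \<delta>(2) by auto
  then have "\<gamma> ` {-\<delta><..<\<delta>} \<subseteq> N" using \<gamma>(5) by blast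
  then have "(snd e \<circ> \<gamma>) ` {-\<delta><..<\<delta>} \<subseteq> S" using N \<delta>(3) by auto
  moreover have "0 \<in> {-\<delta><..<\<delta>}" using \<delta>(1) by simp
  ultimately show ?thesis
    unfolding \<gamma>(1) using has_vector_derivative_in_subspace[OF \<delta>(4) open_greaterThanLessThan _ _ S] by blast
qed

text \<open>The curve is the straight line in the slice chart. With
  \<open>sub_tangent_in_slice\<close> this identifies the tangent space of \<open>N\<close> with
  \<open>S\<close>.\<close>

lemma slice_in_sub_tangent:
  assumes p: "p \<in> N" and e: "e \<in> A" "p \<in> fst e" and S: "subspace S" "S \<subseteq> E"
    and N: "snd e ` (fst e \<inter> N) = snd e ` fst e \<inter> S" and s: "s \<in> S"
  shows "tvec e p s \<in> sub_tangent_space A N p"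
proof -
  let ?\<gamma> = "\<lambda>t. chart_inv e (snd e p + t *\<^sub>R s)"
  have "snd e p \<in> snd e ` (fst e \<inter> N)" using p e by blast
  then have pS: "snd e p \<in> S" using N by blast
  have "s \<in> E" using s S by blast
  then obtain T where T: "open T" "(0::real) \<in> T" "\<And>t. t \<in> T \<Longrightarrow> snd e p + t *\<^sub>R s \<in> snd e ` fst e"
    using line_in_relopen[OF openin_chart_image[OF e(1)] subspace_E] e(2) by (metis image_eqI)
  obtain \<epsilon> where \<epsilon>: "\<epsilon> > 0" "ball 0 \<epsilon> \<subseteq> T" using T(1,2) by (rule openE)
  have I: "{-\<epsilon><..<\<epsilon>} \<subseteq> T" using \<epsilon>(2) by (auto simp: dist_real_def subset_iff)
  have coord: "snd e (?\<gamma> t) = snd e p + t *\<^sub>R s" "?\<gamma> t \<in> fst e" if "t \<in> T" for t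
    by (rule chart_inv_right[OF T(3)[OF that]], rule chart_inv_in[OF T(3)[OF that]])
  have "?\<gamma> t \<in> N" if t: "t \<in> T" for t
  proof -
    have "snd e p + t *\<^sub>R s \<in> S" using pS s S(1) by (intro subspace_add subspace_scale)
    then have "snd e p + t *\<^sub>R s \<in> snd e ` (fst e \<inter> N)" using N T(3)[OF t] by blast
    then obtain q where "q \<in> fst e" "q \<in> N" "snd e p + t *\<^sub>R s = snd e q" by blast
    then show ?thesis using chart_inv_left[OF e(1)] by simp
  qed
  then have 1: "?\<gamma> ` {-\<epsilon><..<\<epsilon>} \<subseteq> fst e \<inter> N" using coord(2) I by blast
  have "smooth_on {-\<epsilon><..<\<epsilon>} (\<lambda>t. snd e p + t *\<^sub>R s)"
    by (intro smooth_on_add smooth_on_const smooth_on_scaleR smooth_on_id)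
  then have 2: "smooth_on {-\<epsilon><..<\<epsilon>} (snd e \<circ> ?\<gamma>)"
    by (rule smooth_on_eqI) (use coord(1) I in auto)
  have 3: "?\<gamma> 0 = p" using chart_inv_left[OF e] by simp
  have "velocity A ?\<gamma> = tvec e p s"
    unfolding velocity_def tvec_def tderiv_def dir_deriv_def 3 comp_def by (rule refl)
  then show ?thesis
    unfolding sub_tangent_space_def using 1 2 3 e(1) \<epsilon>(1) by (metis (mono_tags, lifting) mem_Collect_eq)
qed

text \<open>The image is a ball in \<open>E\<close> so that \<open>Q\<close> maps it into itself and
  concentric balls can be compared. Membership in \<open>W q\<close> is tested on tangent vectors
  only, since only these are determined by their coordinate in \<open>c\<close>.\<close>

definition adapted :: "('a, 'e) chart \<Rightarrow> real \<Rightarrow> bool" where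
  "adapted c r \<longleftrightarrow> c \<in> A \<and> 0 < r \<and> snd c ` fst c = E \<inter> ball 0 r \<and>
     (\<forall>q\<in>fst c. \<forall>v\<in>tangent_space E A q. v \<in> W q \<longleftrightarrow> v c \<in> F) \<and>
     (\<forall>q\<in>fst c. q \<in> N \<longleftrightarrow> P (snd c q) = 0)"

text \<open>With \<open>c\<close> a foliated chart, \<open>e\<close> a slice chart with slice \<open>S\<close> and \<open>K\<close> the inverse of
  \<open>Q \<circ> D(c \<circ> e\<^sup>-\<^sup>1) : S \<rightarrow> ker P\<close>, the map \<open>x \<mapsto> P x + (c \<circ> e\<^sup>-\<^sup>1) (e p + K (Q x))\<close> commutes with
  translations along \<open>F\<close>, sends \<open>ker P\<close> to \<open>c N\<close> and is a local diffeomorphism at 0. Its inverse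
  straightens \<open>N\<close> without moving the plaques.\<close>

lemma adapted_chart_exists:
  assumes p: "p \<in> N"
  shows "\<exists>c r. adapted c r \<and> p \<in> fst c \<and> snd c p = 0"
proof -
  have pX: "p \<in> topspace X" using p N_X by blast
  obtain c where c: "c \<in> A" "p \<in> fst c" and cF: "\<And>q. q \<in> fst c \<Longrightarrow> (\<lambda>v. v c) ` W q = F"
    using foliated[OF pX] by blast
  obtain e S where e: "e \<in> A" "p \<in> fst e" and S: "subspace S" "S \<subseteq> E"
    and eN: "snd e ` (fst e \<inter> N) = snd e ` fst e \<inter> S"
    using slices[OF p] by blast
  have W_iff: "v \<in> W q \<longleftrightarrow> v c \<in> F" if q: "q \<in> fst c" and v: "v \<in> tangent_space E A q" for q v
  proof
    show "v c \<in> F" if "v \<in> W q" using cF[OF q] that by blast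
    assume "v c \<in> F"
    then obtain w where w: "w \<in> W q" "v c = w c" using cF[OF q] by blast
    then have "w \<in> tangent_space E A q" using W_tangent q chart_subset[OF c(1)] by blast
    from tangent_space_eqI[OF v this c(1) q w(2)] show "v \<in> W q" using w by simp
  qed
  define \<tau> where "\<tau> = transition e c"
  let ?O = "snd e ` (fst e \<inter> fst c)"
  define x0 where "x0 = snd e p"
  have x0: "x0 \<in> ?O" "x0 \<in> S" "\<tau> x0 = snd c p"
  proof -
    show "x0 \<in> ?O" using c e by (auto simp: x0_def)
    have "snd e p \<in> snd e ` (fst e \<inter> N)" using p e by blast
    then show "x0 \<in> S" using eN by (simp add: x0_def)
    show "\<tau> x0 = snd c p" using chart_inv_left[OF e] by (simp add: \<tau>_def x0_def)
  qed
  obtain L where L: "bounded_linear L" and L\<tau>: "(\<tau> has_derivative L) (at x0 within ?O)"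
    and LE: "\<And>v. v \<in> E \<Longrightarrow> tderiv e c p v = L v"
    using tderiv_linear[OF e(1) c(1) e(2) c(2)] unfolding \<tau>_def x0_def by blast
  have linL: "linear L" using L by (simp add: linear_conv_bounded_linear)
  have L_in_E: "L v \<in> E" if "v \<in> E" for v
    using tderiv_in_E[OF e(1) c(1) e(2) c(2) that] LE[OF that] by simp
  have N_slice: "snd e q \<in> S" if "q \<in> fst e" "q \<in> N" for q using eN that by blast
  have linQL: "linear (\<lambda>v. Q (L v))" using linear_compose[OF linL linear_Q] by (simp add: comp_def)
  \<comment> \<open>A vector in the kernel is tangent both to \<open>N\<close> and to
    \<open>W\<close>: this is the trivial intersection in complementarity.\<close>
  have QL_inj: "s = 0" if s: "s \<in> S" and 0: "Q (L s) = 0" for s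
  proof -
    let ?v = "tvec e p s"
    have sE: "s \<in> E" using s S by blast
    have v: "?v \<in> tangent_space E A p" by (rule tvec_in_tangent_space[OF e sE])
    have "?v c = L s" using c LE[OF sE] by (simp add: tvec_coord)
    then have "?v \<in> W p" using W_iff[OF c(2) v] Q_eq_0[OF 0] by simp
    moreover have "?v \<in> sub_tangent_space A N p" by (rule slice_in_sub_tangent[OF p e S eN s])
    ultimately have "?v = tzero" using compl p unfolding complementary_def by blast
    then show "s = 0" using tvec_self[OF e sE] by (simp add: tzero_def)
  qed
  \<comment> \<open>This is the spanning half of complementarity: split the vector and discard its
    part in \<open>F\<close> by \<open>Q\<close>.\<close>
  have QL_surj: "y \<in> (\<lambda>v. Q (L v)) ` S" if y: "y \<in> E" "P y = 0" for y
  proof -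
    have "tvec c p y \<in> tangent_space E A p" by (rule tvec_in_tangent_space[OF c y(1)])
    then obtain w a where wa: "tvec c p y = tadd w a" "w \<in> W p" "a \<in> sub_tangent_space A N p"
      using compl p unfolding complementary_def by blast
    have a: "a \<in> tangent_space E A p" by (rule sub_tangent_tangent[OF p wa(3)])
    have aS: "a e \<in> S" by (rule sub_tangent_in_slice[OF wa(3) e S(1) N_slice])
    have "w c \<in> F" using W_iff[OF c(2)] wa(2) W_tangent[OF pX] by blast
    then have "Q (w c) = 0" by (rule Q_F)
    moreover have "y = w c + a c" using tvec_self[OF c y(1)] wa(1) by (simp add: tadd_def)
    moreover have "a c = L (a e)"
      using tangent_coord_change[OF a e c] LE tangent_in_E[OF a e] by simp
    ultimately have "Q y = Q (L (a e))" by (simp add: Q_add)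
    then show ?thesis using aS Q_id[OF y(2)] by auto
  qed
  obtain K where K: "range K \<subseteq> S" "linear K" and QLK: "\<And>y. y \<in> (\<lambda>v. Q (L v)) ` S \<Longrightarrow> Q (L (K y)) = y"
    using linear_exists_right_inverse_on[OF linQL S(1)] by blast
  have KS: "K y \<in> S" for y using K(1) by blast
  have KQL: "K (Q (L s)) = s" if s: "s \<in> S" for s
  proof -
    have "Q (L (K (Q (L s)) - s)) = 0"
      using QLK[of "Q (L s)"] s by (simp add: linear_diff[OF linQL])
    moreover have "K (Q (L s)) - s \<in> S" using KS s S(1) by (intro subspace_diff)
    ultimately show ?thesis using QL_inj by fastforce
  qed
  let ?P = "proj E"
  have linPE: "linear ?P" by (rule linear_proj[OF subspace_E])
  have PE_id: "?P x = x" if "x \<in> E" for x by (rule proj_id[OF subspace_E that])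
  have PE_in: "?P x \<in> E" for x by (rule proj_in[OF subspace_E])
  have PE_0: "?P x = x" if "x - ?P x \<in> E" for x
    using proj_orthogonal[OF subspace_E that, of x] by simp
  define m where "m x = x0 + K (Q (?P x))" for x
  \<comment> \<open>The first summand vanishes on \<open>E\<close>. It fills up the directions
    orthogonal to \<open>E\<close>, so that the derivative at 0 is injective on the whole
    space.\<close>
  define \<Theta> where "\<Theta> x = (x - ?P x) + P (?P x) + \<tau> (m x)" for x
  have mS: "m x \<in> S" for x unfolding m_def using x0 KS S(1) by (intro subspace_add)
  have m0: "m 0 = x0"
    by (simp add: m_def linear_0[OF linPE] linear_0[OF linear_Q] linear_0[OF K(2)])
  have blK: "bounded_linear (\<lambda>x. K (Q (?P x)))"
    using linear_compose[OF linear_compose[OF linPE linear_Q] K(2)]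
    by (simp add: comp_def linear_conv_bounded_linear)
  have m_smooth: "smooth_on UNIV m"
    unfolding m_def by (intro smooth_on_add smooth_on_const smooth_on_bounded_linear[OF blK] smooth_on_id)
  obtain G0 where G0: "open G0" "?O = E \<inter> G0"
    using openin_transition_domain[OF e(1) c(1)] by (auto simp: openin_open)
  define D0 where "D0 = m -` G0"
  have D0: "open D0" unfolding D0_def
    using continuous_open_preimage[OF smooth_on_imp_continuous_on[OF m_smooth] open_UNIV G0(1)] by simp
  have D0_O: "m x \<in> ?O" if "x \<in> D0" for x
    using that mS[of x] S(2) G0(2) by (auto simp: D0_def)
  have "0 \<in> D0" using x0(1) G0(2) by (simp add: D0_def m0)
  have smPE: "smooth_on T ?P" for T
    by (rule smooth_on_linear[OF linPE smooth_on_id])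
  have \<Theta>_smooth: "smooth_on D0 \<Theta>"
    unfolding \<Theta>_def
  proof (intro smooth_on_add smooth_on_diff smooth_on_id smPE smooth_on_bounded_linear[OF bounded_linear_P])
    show "smooth_on D0 (\<lambda>x. \<tau> (m x))"
      unfolding \<tau>_def
      by (rule smooth_on_compose[OF smooth_transition[OF e(1) c(1)] smooth_on_subset[OF m_smooth]])
        (use D0_O in auto)
  qed
  define D where "D v = (v - ?P v) + P (?P v) + L (K (Q (?P v)))" for v
  have \<Theta>_deriv: "(\<Theta> has_derivative D) (at 0)"
  proof -
    have "(m has_derivative (\<lambda>v. K (Q (?P v)))) (at 0 within D0)"
      unfolding m_def by (auto intro!: derivative_eq_intros bounded_linear_imp_has_derivative[OF blK])
    then have "((\<lambda>x. \<tau> (m x)) has_derivative (\<lambda>v. L (K (Q (?P v))))) (at 0 within D0)"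
      by (rule has_derivative_in_compose) (rule has_derivative_subset[of _ _ _ ?O], use L\<tau> m0 D0_O in auto)
    then have "((\<lambda>x. \<tau> (m x)) has_derivative (\<lambda>v. L (K (Q (?P v))))) (at 0)"
      using at_within_open[OF \<open>0 \<in> D0\<close> D0] by simp
    moreover have "bounded_linear (\<lambda>v. (v - ?P v) + P (?P v))"
      by (intro bounded_linear_add bounded_linear_sub bounded_linear_ident bounded_linear_proj subspace_E
          bounded_linear_compose[OF bounded_linear_P])
    then have "((\<lambda>v. (v - ?P v) + P (?P v)) has_derivative (\<lambda>v. (v - ?P v) + P (?P v))) (at 0)"
      by (rule bounded_linear_imp_has_derivative)
    ultimately show ?thesis
      unfolding \<Theta>_def D_def by (rule has_derivative_add[rotated])
  qed
  have "inj D"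
  proof -
    have "linear D" by (rule has_derivative_linear[OF \<Theta>_deriv])
    moreover have "v = 0" if "D v = 0" for v
    proof -
      have KE: "K y \<in> E" for y using KS S(2) by blast
      have "(v - ?P v) + (P (?P v) + L (K (Q (?P v)))) = 0"
        using that unfolding D_def by (simp only: add.assoc)
      then have "v - ?P v = - (P (?P v) + L (K (Q (?P v))))"
        by (rule eq_neg_iff_add_eq_0[THEN iffD2])
      also have "\<dots> \<in> E"
        by (intro subspace_neg subspace_add subspace_E P_in_E L_in_E KE)
      finally have v: "?P v = v" by (rule PE_0)
      then have vE: "v \<in> E" using PE_in[of v] by simp
      have eq: "P v + L (K (Q v)) = 0" using that v unfolding D_def by simp
      then have "Q (P v + L (K (Q v))) = 0" by (simp add: linear_0[OF linear_Q])
      then have "Q (L (K (Q v))) = 0" by (simp add: Q_add Q_P)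
      then have "Q v = 0" using QLK[OF QL_surj[OF Q_in_E[OF vE] P_Q]] by simp
      moreover from this have "P v = 0" using eq by (simp add: linear_0[OF K(2)] linear_0[OF linL])
      ultimately show "v = 0" using Q_plus_P[of v] by simp
    qed
    ultimately show ?thesis by (simp add: linear_injective_0)
  qed
  obtain U0 V0 g where U0: "open U0" "0 \<in> U0" "U0 \<subseteq> D0" and V0: "open V0"
    and hom: "homeomorphism U0 V0 \<Theta> g" and g: "smooth_on V0 g"
    by (rule smooth_inverse_function_theorem[OF D0 \<Theta>_smooth \<open>0 \<in> D0\<close> \<Theta>_deriv \<open>inj D\<close>])
  have g\<Theta>: "g (\<Theta> x) = x" "\<Theta> x \<in> V0" if "x \<in> U0" for x
    using hom that by (auto simp: homeomorphism_def)
  have \<Theta>g: "\<Theta> (g y) = y" "g y \<in> U0" if "y \<in> V0" for y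
    using hom that by (auto simp: homeomorphism_def)
  have \<tau>_in_E: "\<tau> y \<in> E" if "y \<in> ?O" for y
    using transition_in_E[OF e(1) c(1)] that unfolding \<tau>_def by blast
  have \<Theta>_E: "\<Theta> x = P x + \<tau> (m x)" if "x \<in> E" for x
    using PE_id[OF that] by (simp add: \<Theta>_def)
  \<comment> \<open>The inverse respects \<open>E\<close> because the part of \<open>g y\<close>
    orthogonal to \<open>E\<close> turns out to be a difference of elements of \<open>E\<close>,
    hence 0.\<close>
  have g_E: "g y \<in> E" if y: "y \<in> V0" "y \<in> E" for y
  proof -
    let ?x = "g y"
    have "?x - ?P ?x = y - (P (?P ?x) + \<tau> (m ?x))"
      using \<Theta>g(1)[OF y(1)] unfolding \<Theta>_def by (simp add: algebra_simps)
    also have "\<dots> \<in> E"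
      using \<Theta>g(2)[OF y(1)] U0(3) by (intro subspace_diff subspace_add subspace_E P_in_E \<tau>_in_E y(2) D0_O) auto
    finally show ?thesis using PE_0 PE_in by metis
  qed
  \<comment> \<open>\<open>m\<close> sees only the \<open>Q\<close> part of its argument. Hence the
    change of chart has the identity as its derivative along \<open>F\<close>, and \<open>W\<close>
    still reads as \<open>F\<close> in the new chart.\<close>
  have \<Theta>_shift: "\<Theta> (x + f) = \<Theta> x + f" if "f \<in> F" for x f
  proof -
    have "?P (x + f) = ?P x + f"
      using that F_E by (auto simp: linear_add[OF linPE] intro: PE_id)
    then have "m (x + f) = m x" "P (?P (x + f)) = P (?P x) + f"
      using that by (simp_all add: m_def Q_add Q_F P_add P_id)
    then show ?thesis using \<open>?P (x + f) = ?P x + f\<close> by (simp add: \<Theta>_def)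
  qed
  have \<Theta>0: "\<Theta> 0 = snd c p"
    by (simp add: \<Theta>_def m0 x0(3) linear_0[OF linPE] linear_0[OF linear_P])
  \<comment> \<open>For a point \<open>q\<close> of \<open>N\<close>, the vector
    \<open>Q (L (snd e q - x0))\<close> has \<open>P\<close> part 0 and is sent to
    \<open>snd c q\<close> by \<Theta>. Requiring it to lie in \<open>U0\<close>, where \<Theta> is
    injective, makes it the new coordinate of \<open>q\<close>.\<close>
  define M where "M = {q \<in> fst e \<inter> fst c. Q (L (snd e q - x0)) \<in> U0} \<inter> {q \<in> fst c. snd c q \<in> V0}"
  have M: "openin X M"
    unfolding M_def
  proof (rule openin_Int[OF openin_preimage_fun[OF e(1) _ _ _ U0(1)] openin_preimage[OF c(1) V0]])
    show "openin X (fst e \<inter> fst c)" using c(1) e(1) by (intro openin_Int openin_chart)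
    show "continuous_on (snd e ` (fst e \<inter> fst c)) (\<lambda>y. Q (L (y - x0)))"
      using linQL by (intro bounded_linear.continuous_on[of "\<lambda>v. Q (L v)"] continuous_intros)
        (simp add: linear_conv_bounded_linear)
  qed auto
  have M_sub: "M \<subseteq> fst c" "M \<subseteq> fst e" by (auto simp: M_def)
  have cM: "snd c ` M \<subseteq> V0" by (auto simp: M_def)
  have "p \<in> M"
    using c e U0(2) g\<Theta>(2)[OF U0(2)] unfolding M_def \<Theta>0
    by (simp add: x0_def linear_0[OF linQL])
  obtain G1 where G1: "open G1" "snd c ` M = E \<inter> G1"
    using openin_image_open[OF c(1) M M_sub(1)] by (auto simp: openin_open)
  have "open (U0 \<inter> \<Theta> -` G1)"
    using hom by (intro continuous_open_preimage[OF _ U0(1) G1(1)]) (simp add: homeomorphism_def)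
  moreover have "0 \<in> U0 \<inter> \<Theta> -` G1" using \<open>p \<in> M\<close> G1(2) U0(2) \<Theta>0 by auto
  \<comment> \<open>\<Theta> sends the points of \<open>E\<close> in this ball to coordinates of
    points of \<open>M\<close>, so that the image of the new chart can be exactly a ball.\<close>
  ultimately obtain r where r: "0 < r" "ball 0 r \<subseteq> U0 \<inter> \<Theta> -` G1" by (rule openE)
  define V where "V = {q \<in> M. g (snd c q) \<in> ball 0 r}"
  have V: "openin X V" unfolding V_def
    by (rule openin_preimage_fun[OF c(1) M M_sub(1)
          smooth_on_imp_continuous_on[OF smooth_on_subset[OF g cM]] open_ball])
  have V_sub: "V \<subseteq> fst c" "V \<subseteq> M" using M_sub by (auto simp: V_def)
  have cV: "snd c ` V \<subseteq> V0" using V_sub(2) cM by blast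
  have image: "g ` snd c ` V = E \<inter> ball 0 r"
  proof
    show "g ` snd c ` V \<subseteq> E \<inter> ball 0 r"
    proof
      fix x assume "x \<in> g ` snd c ` V"
      then obtain q where q: "q \<in> V" "x = g (snd c q)" by blast
      moreover have "snd c q \<in> V0" "snd c q \<in> E"
        using q cV chart_in_E[OF c(1)] V_sub by auto
      ultimately show "x \<in> E \<inter> ball 0 r" using g_E by (auto simp: V_def)
    qed
    show "E \<inter> ball 0 r \<subseteq> g ` snd c ` V"
    proof
      fix x assume x: "x \<in> E \<inter> ball 0 r"
      then have xU: "x \<in> U0" "\<Theta> x \<in> G1" using r(2) by auto
      have "\<Theta> x \<in> E" using x xU U0(3) \<Theta>_E[of x]
        by (auto intro!: subspace_add subspace_E P_in_E \<tau>_in_E D0_O)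
      then obtain q where q: "q \<in> M" "\<Theta> x = snd c q" using xU(2) G1(2) by blast
      then have "g (snd c q) = x" using g\<Theta>(1)[OF xU(1)] by simp
      then show "x \<in> g ` snd c ` V" using q x by (force simp: V_def)
    qed
  qed
  define c' where "c' = (V, g \<circ> snd c)"
  have fst_c': "fst c' = V" and snd_c': "snd c' q = g (snd c q)" for q by (simp_all add: c'_def)
  have "c' \<in> A"
    unfolding c'_def
  proof (rule maximal, rule smooth_atlas_insertI[OF c(1) V V_sub(1)])
    show "smooth_on (snd c ` V) g" by (rule smooth_on_subset[OF g cV])
    show "openin (top_of_set E) (g ` snd c ` V)" unfolding image by (simp add: openin_open_Int)
    show "smooth_on (g ` snd c ` V) \<Theta>" unfolding image
      by (rule smooth_on_subset[OF \<Theta>_smooth]) (use r U0(3) in auto)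
    show "\<Theta> (g (snd c q)) = snd c q" if "q \<in> V" for q using \<Theta>g(1) cV that by blast
  qed
  have c'_image: "snd c' ` fst c' = E \<inter> ball 0 r"
    using image by (simp add: c'_def image_comp)
  have c_\<Theta>: "snd c q = \<Theta> (snd c' q)" if "q \<in> V" for q
    using \<Theta>g(1)[of "snd c q"] cV that by (auto simp: snd_c')
  have c'_in: "snd c' q \<in> E" "snd c' q \<in> U0" if "q \<in> V" for q
    using c'_image that r(2) unfolding fst_c' by blast+
  have tderiv_F: "tderiv c' c q f = f" if q: "q \<in> V" and f: "f \<in> F" for q f
  proof -
    have "tderiv c' c q f = dir_deriv \<Theta> (snd c' q) f"
      unfolding tderiv_def
    proof (rule dir_deriv_cong[OF openin_chart_image[OF \<open>c' \<in> A\<close>] subspace_E])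
      show "snd c' q \<in> snd c' ` fst c'" using q by (simp add: fst_c')
      show "f \<in> E" using f F_E by blast
      fix y assume "y \<in> snd c' ` fst c'"
      then obtain q' where "q' \<in> V" "y = snd c' q'" unfolding fst_c' by blast
      then show "transition c' c y = \<Theta> y"
        using chart_inv_left[OF \<open>c' \<in> A\<close>] c_\<Theta> by (simp add: fst_c')
    qed
    also have "\<dots> = vector_derivative (\<lambda>t. \<Theta> (snd c' q) + t *\<^sub>R f) (at 0)"
      unfolding dir_deriv_def using f by (simp add: \<Theta>_shift subspace_scale[OF subspace_F])
    also have "\<dots> = f"
      by (rule vector_derivative_at) (auto intro!: derivative_eq_intros)
    finally show ?thesis .
  qed
  have "adapted c' r"
    unfolding adapted_def
  proof (intro conjI ballI \<open>c' \<in> A\<close> r(1) c'_image)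
    fix q assume "q \<in> fst c'"
    then have q: "q \<in> V" "q \<in> fst c'" "q \<in> fst c" using V_sub(1) by (auto simp: fst_c')
    {
      fix v assume v: "v \<in> tangent_space E A q"
      show "v \<in> W q \<longleftrightarrow> v c' \<in> F"
      proof
        assume "v \<in> W q"
        then have vF: "v c \<in> F" using W_iff[OF q(3) v] by blast
        then have vE: "v c \<in> E" using F_E by blast
        have "tvec c' q (v c) c = v c"
          using tderiv_F[OF q(1) vF] c(1) q(3) by (simp add: tvec_coord)
        then have "v = tvec c' q (v c)"
          by (intro tangent_space_eqI[OF v tvec_in_tangent_space[OF \<open>c' \<in> A\<close> q(2) vE] c(1) q(3)]) simp
        then have "v c' = v c" using tvec_self[OF \<open>c' \<in> A\<close> q(2) vE] by metis
        then show "v c' \<in> F" using vF by simp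
      next
        assume "v c' \<in> F"
        then have "v c \<in> F"
          using tangent_coord_change[OF v \<open>c' \<in> A\<close> q(2) c(1) q(3)] tderiv_F[OF q(1)] by simp
        then show "v \<in> W q" using W_iff[OF q(3) v] by blast
      qed
    }
    let ?x = "snd c' q"
    show "q \<in> N \<longleftrightarrow> P ?x = 0"
    proof
      assume 0: "P ?x = 0"
      have "m ?x \<in> ?O" using c'_in(2)[OF q(1)] U0(3) D0_O by blast
      then obtain q' where q': "q' \<in> fst e" "q' \<in> fst c" "m ?x = snd e q'" by blast
      have "snd e q' \<in> snd e ` (fst e \<inter> N)" using q' mS[of ?x] eN by auto
      then have "q' \<in> N" using inj_onD[OF inj_on_chart[OF e(1)]] q'(1) by blast
      have "snd c q = \<tau> (m ?x)" using c_\<Theta>[OF q(1)] \<Theta>_E[OF c'_in(1)[OF q(1)]] 0 by simp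
      also have "\<dots> = snd c q'" using q' chart_inv_left[OF e(1)] by (simp add: \<tau>_def)
      finally have "q = q'" using inj_onD[OF inj_on_chart[OF c(1)]] q(3) q'(2) by blast
      then show "q \<in> N" using \<open>q' \<in> N\<close> by simp
    next
      assume "q \<in> N"
      have qM: "q \<in> M" using q(1) V_sub by blast
      then have qe: "q \<in> fst e" using M_sub by blast
      let ?s = "snd e q"
      have s: "?s \<in> S" by (rule N_slice[OF qe \<open>q \<in> N\<close>])
      then have sx: "?s - x0 \<in> S" using x0(2) S(1) by (intro subspace_diff)
      let ?y = "Q (L (?s - x0))"
      have yU: "?y \<in> U0" using qM by (simp add: M_def)
      have yE: "?y \<in> E" using sx S(2) by (intro Q_in_E L_in_E) auto
      have "\<Theta> ?y = \<tau> (m ?y)" using \<Theta>_E[OF yE] by (simp add: P_Q)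
      also have "m ?y = ?s" using KQL[OF sx] by (simp add: m_def PE_id[OF yE] Q_Q)
      also have "\<tau> ?s = snd c q" using chart_inv_left[OF e(1) qe] by (simp add: \<tau>_def)
      finally have "?y = ?x" using g\<Theta>(1)[OF yU] by (simp add: snd_c')
      then show "P ?x = 0" using P_Q by metis
    qed
  qed
  moreover have "snd c' p = 0" using g\<Theta>(1)[OF U0(2)] \<Theta>0 by (simp add: snd_c')
  moreover have "p \<in> fst c'"
    unfolding fst_c' V_def using \<open>p \<in> M\<close> \<open>snd c' p = 0\<close> r(1) by (simp add: snd_c')
  ultimately show ?thesis by blast
qed

end

context atlas_space
begin

lemma chart_eqI: "c \<in> A \<Longrightarrow> p \<in> fst c \<Longrightarrow> q \<in> fst c \<Longrightarrow> snd c p = snd c q \<Longrightarrow> p = q"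
  using inj_onD[OF inj_on_chart] .

lemma smooth_on_chart_local:
  assumes c: "c \<in> A" "G \<subseteq> fst c"
    and loc: "\<And>p. p \<in> G \<Longrightarrow> \<exists>H. openin X H \<and> p \<in> H \<and> smooth_on (snd c ` (G \<inter> H)) f"
  shows "smooth_on (snd c ` G) f"
proof (rule smooth_on_local)
  fix y assume "y \<in> snd c ` G"
  then obtain p where p: "p \<in> G" "y = snd c p" by blast
  obtain H where H: "openin X H" "p \<in> H" "smooth_on (snd c ` (G \<inter> H)) f"
    using loc[OF p(1)] by (elim exE conjE) (rule that)
  have "openin (top_of_set E) (snd c ` (fst c \<inter> H))"
    by (rule openin_image_open[OF c(1) openin_Int[OF openin_chart[OF c(1)] H(1)]]) auto
  then obtain T where T: "open T" "snd c ` (fst c \<inter> H) = E \<inter> T" by (auto simp: openin_open)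
  have "snd c ` G \<inter> T \<subseteq> snd c ` (G \<inter> H)"
  proof
    fix z assume z: "z \<in> snd c ` G \<inter> T"
    then obtain q where q: "q \<in> G" "z = snd c q" by blast
    then have "z \<in> snd c ` (fst c \<inter> H)" using z T(2) chart_in_E[OF c(1)] c(2) by blast
    then obtain q' where q': "q' \<in> fst c" "q' \<in> H" "snd c q = snd c q'" using q by auto
    then have "q = q'" using chart_eqI[OF c(1) _ q'(1,3)] q(1) c(2) by blast
    then have "q \<in> H" using q'(2) by simp
    then show "z \<in> snd c ` (G \<inter> H)" using q by blast
  qed
  then have "smooth_on (snd c ` G \<inter> T) f" by (rule smooth_on_subset[OF H(3)])
  moreover have "y \<in> T" using p H(2) T(2) c(2) by blast
  ultimately show "\<exists>T. open T \<and> y \<in> T \<and> smooth_on (snd c ` G \<inter> T) f" using T(1) by blast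
qed

lemma continuous_chart_inv:
  assumes "c \<in> A"
  shows "continuous_map (top_of_set (snd c ` fst c)) X (chart_inv c)"
  unfolding continuous_map_def
proof (intro conjI allI impI)
  show "chart_inv c \<in> topspace (top_of_set (snd c ` fst c)) \<rightarrow> topspace X"
    using chart_inv_left[OF assms] chart_subset[OF assms] by auto
  fix U assume U: "openin X U"
  have "{y \<in> topspace (top_of_set (snd c ` fst c)). chart_inv c y \<in> U} = snd c ` (fst c \<inter> U)"
    using chart_inv_left[OF assms] by auto
  moreover have "openin (top_of_set E) (snd c ` (fst c \<inter> U))"
    by (rule openin_image_open[OF assms openin_Int[OF openin_chart[OF assms] U]]) auto
  then have "openin (top_of_set (snd c ` fst c)) (snd c ` (fst c \<inter> U))"
    by (rule openin_subset_trans) (use openin_imp_subset[OF openin_chart_image[OF assms]] in auto)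
  ultimately show "openin (top_of_set (snd c ` fst c)) {y \<in> topspace (top_of_set (snd c ` fst c)). chart_inv c y \<in> U}"
    by simp
qed

lemma openin_ball_finite:
  assumes "finite J" "openin X G" "\<And>j. j \<in> J \<Longrightarrow> openin X {p \<in> topspace X. R j p}"
  shows "openin X {p \<in> G. \<forall>j\<in>J. R j p}"
  using assms(1,3)
proof (induction J)
  case empty
  then show ?case using assms(2) by simp
next
  case (insert j J)
  have "{p \<in> G. \<forall>j\<in>insert j J. R j p} = {p \<in> G. \<forall>j\<in>J. R j p} \<inter> {p \<in> topspace X. R j p}"
    using openin_subset[OF assms(2)] by blast
  then show ?case using insert by (simp add: openin_Int)
qed

end

context foliated_submanifold
begin

lemma adapted_A: "adapted c r \<Longrightarrow> c \<in> A"
  and adapted_pos: "adapted c r \<Longrightarrow> 0 < r"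
  and adapted_image: "adapted c r \<Longrightarrow> snd c ` fst c = E \<inter> ball 0 r"
  and adapted_W: "adapted c r \<Longrightarrow> q \<in> fst c \<Longrightarrow> v \<in> tangent_space E A q \<Longrightarrow> v \<in> W q \<longleftrightarrow> v c \<in> F"
  and adapted_N: "adapted c r \<Longrightarrow> q \<in> fst c \<Longrightarrow> q \<in> N \<longleftrightarrow> P (snd c q) = 0"
  unfolding adapted_def by blast+

lemma adapted_tvec_W:
  assumes "adapted c r" "q \<in> fst c" "f \<in> F"
  shows "tvec c q f \<in> W q"
proof -
  have c: "c \<in> A" "f \<in> E" using assms F_E adapted_A by blast+
  show ?thesis
    using adapted_W[OF assms(1,2) tvec_in_tangent_space[OF c(1) assms(2) c(2)]] tvec_self[OF c(1) assms(2) c(2)] assms(3)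
    by simp
qed

lemma W_coord_F:
  assumes "adapted c r" "q \<in> fst c" "v \<in> W q"
  shows "v c \<in> F"
proof -
  have "v \<in> tangent_space E A q"
    using assms W_tangent chart_subset[OF adapted_A[OF assms(1)]] by blast
  then show ?thesis using adapted_W assms by blast
qed

text \<open>In both charts the coordinates of \<open>W q\<close> form \<open>F\<close>, so changing
  coordinates preserves \<open>F\<close>.\<close>

lemma tderiv_F:
  assumes "adapted c r" "adapted d s" "q \<in> fst c" "q \<in> fst d" "f \<in> F"
  shows "tderiv c d q f \<in> F"
  using W_coord_F[OF assms(2,4) adapted_tvec_W[OF assms(1,3,5)]] tvec_coord[OF adapted_A[OF assms(2)] assms(4)]
  by simp

definition pr :: "('a, 'e) chart \<Rightarrow> 'a \<Rightarrow> 'a" where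
  "pr c p = chart_inv c (Q (snd c p))"

text \<open>\<open>Q\<close> does not increase norms, so the projected coordinate remains in the
  ball which is the image of the chart.\<close>

lemma pr_props:
  assumes c: "adapted c r" and p: "p \<in> fst c"
  shows "pr c p \<in> fst c" and pr_coord: "snd c (pr c p) = Q (snd c p)" and pr_N: "pr c p \<in> N"
    and pr_id: "p \<in> N \<Longrightarrow> pr c p = p"
proof -
  have "snd c p \<in> E \<inter> ball 0 r" using adapted_image[OF c] p by blast
  then have "Q (snd c p) \<in> E \<inter> ball 0 r"
    using Q_in_E norm_Q[of "snd c p"] by (auto intro: le_less_trans)
  then have *: "Q (snd c p) \<in> snd c ` fst c" using adapted_image[OF c] by simp
  show 1: "pr c p \<in> fst c" unfolding pr_def by (rule chart_inv_in[OF *])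
  show 2: "snd c (pr c p) = Q (snd c p)" unfolding pr_def by (rule chart_inv_right[OF *])
  show "pr c p \<in> N" using adapted_N[OF c 1] 2 P_Q by simp
  show "pr c p = p" if "p \<in> N"
  proof -
    have "Q (snd c p) = snd c p" using adapted_N[OF c p] that Q_id by simp
    then show ?thesis unfolding pr_def using chart_inv_left[OF adapted_A[OF c] p] by simp
  qed
qed

text \<open>Transition maps have derivatives preserving \<open>F\<close>, so near a point of \<open>N\<close> they map plaques
  into plaques.\<close>

lemma pr_agree:
  assumes c: "adapted c r" and d: "adapted d s" and p: "p \<in> N" "p \<in> fst c" "p \<in> fst d"
  shows "\<exists>G. openin X G \<and> p \<in> G \<and> G \<subseteq> fst c \<inter> fst d \<and> (\<forall>q\<in>G. pr c q = pr d q)"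
proof -
  note cA = adapted_A[OF c] and dA = adapted_A[OF d]
  let ?\<tau> = "transition c d"
  let ?O = "snd c ` (fst c \<inter> fst d)"
  obtain G0 where G0: "open G0" "?O = E \<inter> G0"
    using openin_transition_domain[OF cA dA] by (auto simp: openin_open)
  let ?y0 = "snd c p"
  have "?y0 \<in> G0" using p G0(2) by blast
  then obtain \<epsilon> where \<epsilon>: "0 < \<epsilon>" "ball ?y0 \<epsilon> \<subseteq> G0" using G0(1) by (metis openE)
  let ?S = "E \<inter> ball ?y0 \<epsilon>"
  have S_O: "?S \<subseteq> ?O" using \<epsilon>(2) G0(2) by blast
  have Qy0: "Q ?y0 = ?y0" using adapted_N[OF c p(2)] p(1) Q_id by simp
  have convS: "convex ?S" by (intro convex_Int subspace_imp_convex subspace_E convex_ball)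
  have QS: "Q y \<in> ?S" if "y \<in> ?S" for y
  proof -
    have "Q y - ?y0 = Q (y - ?y0)" using Qy0 linear_diff[OF linear_Q] by simp
    then have "norm (Q y - ?y0) \<le> norm (y - ?y0)" using norm_Q by simp
    then show ?thesis using that Q_in_E by (auto simp: dist_norm norm_minus_commute)
  qed
  \<comment> \<open>The segment from \<open>y\<close> to \<open>Q y\<close> has direction in
    \<open>F\<close> and stays in \<open>?S\<close>, because the ball is centred at a point fixed by
    \<open>Q\<close>. Along \<open>F\<close> the derivative of the transition map takes values in
    \<open>F\<close>, which \<open>Q\<close> kills.\<close>
  have key: "Q (?\<tau> y) = Q (?\<tau> (Q y))" if y: "y \<in> ?S" for y
  proof (rule zero_derivative_on_segment[OF convS y QS[OF y]])
    fix z assume z: "z \<in> ?S"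
    then obtain q where q: "q \<in> fst c" "q \<in> fst d" "z = snd c q" using S_O by blast
    obtain L where L: "bounded_linear L" "(?\<tau> has_derivative L) (at (snd c q) within ?O)"
      "\<And>v. v \<in> E \<Longrightarrow> tderiv c d q v = L v"
      using tderiv_linear[OF cA dA q(1,2)] by blast
    have "((\<lambda>y. Q (?\<tau> y)) has_derivative (\<lambda>v. Q (L v))) (at z within ?S)"
      unfolding q(3)
      by (rule bounded_linear.has_derivative[OF bounded_linear_Q has_derivative_subset[OF L(2) S_O]])
    moreover have "Q (L (Q y - y)) = 0"
    proof -
      have *: "Q y - y = - P y" by (simp add: Q_def)
      have "- P y \<in> F" by (intro subspace_neg subspace_F P_in_F)
      then have "L (Q y - y) \<in> F"
        using tderiv_F[OF c d q(1,2)] L(3) F_E unfolding * by fastforce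
      then show ?thesis by (rule Q_F)
    qed
    ultimately show "\<exists>D. ((\<lambda>y. Q (?\<tau> y)) has_derivative D) (at z within ?S) \<and> D (Q y - y) = 0"
      by blast
  qed
  let ?G = "{q \<in> fst c. snd c q \<in> ball ?y0 \<epsilon>}"
  have G: "openin X ?G" by (rule openin_preimage[OF cA open_ball])
  have Gd: "q \<in> fst d" if "q \<in> ?G" for q
  proof -
    have "snd c q \<in> ?O" using that S_O chart_in_E[OF cA] by auto
    then show ?thesis using inj_onD[OF inj_on_chart[OF cA]] that by auto
  qed
  have "pr c q = pr d q" if q: "q \<in> ?G" for q
  proof -
    have qc: "q \<in> fst c" "snd c q \<in> ?S" using q chart_in_E[OF cA] by auto
    have qd: "q \<in> fst d" by (rule Gd[OF q])
    let ?n = "pr c q"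
    note n = pr_props[OF c qc(1)]
    have "?n \<in> ?G" using n QS[OF qc(2)] by simp
    then have nd: "?n \<in> fst d" by (rule Gd)
    have "snd d ?n = Q (snd d ?n)" using adapted_N[OF d nd] n(3) Q_id by simp
    also have "snd d ?n = ?\<tau> (Q (snd c q))"
      using n(2) chart_inv_left[OF cA n(1)] by simp
    also have "Q \<dots> = Q (?\<tau> (snd c q))" using key[OF qc(2)] by simp
    also have "\<dots> = Q (snd d q)" using chart_inv_left[OF cA qc(1)] by simp
    also have "\<dots> = snd d (pr d q)" using pr_props(2)[OF d qd] by simp
    finally show ?thesis
      using inj_onD[OF inj_on_chart[OF dA]] nd pr_props(1)[OF d qd] n(2) chart_inv_left[OF cA n(1)] by simp
  qed
  then show ?thesis using G p Gd \<epsilon>(1) by (intro exI[of _ ?G]) auto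
qed

end

subsection \<open>Gluing the local projections and the local fibre coordinates\<close>

text \<open>The charts are indexed by natural numbers, and everything about the \<open>i\<close>-th chart is arranged
  to be compatible with the finitely many previous ones only; no local finiteness is needed.
  The factors \<open>1/4 < 1/3 < 1/2 < 2/3\<close> are relative radii: \<open>dball i (1/4)\<close> cover \<open>N\<close>, and \<open>bump i\<close> is
  1 on \<open>dball i (1/2)\<close> and supported in \<open>dcball i (2/3)\<close>.\<close>

locale tube = foliated_submanifold E X A W N F
  for E :: "'e::euclidean_space set" and X :: "'a topology" and A :: "('a, 'e) chart set"
    and W N F +
  fixes c :: "nat \<Rightarrow> ('a, 'e) chart" and r :: "nat \<Rightarrow> real" and s :: "real \<Rightarrow> real"
  assumes adapted: "adapted (c i) (r i)"
    and N_cover: "p \<in> N \<Longrightarrow> \<exists>i. p \<in> fst (c i) \<and> norm (snd (c i) p) < r i / 4"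
    and Hausdorff: "Hausdorff_space X"
    and s_smooth: "smooth_on UNIV s" and s_0: "t \<le> 0 \<Longrightarrow> s t = 0" and s_1: "t \<ge> 1 \<Longrightarrow> s t = 1"
begin

lemmas cA = adapted_A[OF adapted] and r_pos = adapted_pos[OF adapted]

section \<open>Concentric balls, domains of agreement and the global projection\<close>

definition dball :: "nat \<Rightarrow> real \<Rightarrow> 'a set" where
  "dball i a = {p \<in> fst (c i). norm (snd (c i) p) < a * r i}"

definition dcball :: "nat \<Rightarrow> real \<Rightarrow> 'a set" where
  "dcball i a = {p \<in> fst (c i). norm (snd (c i) p) \<le> a * r i}"

lemma openin_dball: "openin X (dball i a)"
  using openin_preimage[OF cA open_ball, of i 0 "a * r i"] by (simp add: dball_def)

text \<open>For a < 1 the closed ball is compact inside the chart image. Its preimage is compact,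
  hence closed in the Hausdorff space \<open>X\<close> and not merely in the chart domain, so that
  its complement may be used as an open set of the manifold.\<close>

lemma closedin_dcball:
  assumes "a < 1" shows "closedin X (dcball i a)"
proof -
  have "a * r i < r i" using assms r_pos[of i] by simp
  then have sub: "E \<inter> cball 0 (a * r i) \<subseteq> snd (c i) ` fst (c i)"
    using adapted_image[OF adapted] by auto
  have "dcball i a = chart_inv (c i) ` (E \<inter> cball 0 (a * r i))"
  proof
    show "dcball i a \<subseteq> chart_inv (c i) ` (E \<inter> cball 0 (a * r i))"
    proof
      fix p assume p: "p \<in> dcball i a"
      then have "p = chart_inv (c i) (snd (c i) p)" using chart_inv_left[OF cA] by (simp add: dcball_def)
      then show "p \<in> chart_inv (c i) ` (E \<inter> cball 0 (a * r i))"
        using p chart_in_E[OF cA] by (intro image_eqI[of _ _ "snd (c i) p"]) (auto simp: dcball_def)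
    qed
    show "chart_inv (c i) ` (E \<inter> cball 0 (a * r i)) \<subseteq> dcball i a"
    proof
      fix p assume "p \<in> chart_inv (c i) ` (E \<inter> cball 0 (a * r i))"
      then obtain y where y: "y \<in> E" "norm y \<le> a * r i" "p = chart_inv (c i) y" by auto
      then have "y \<in> snd (c i) ` fst (c i)" using sub by auto
      then show "p \<in> dcball i a"
        using chart_inv_in[of y "c i"] chart_inv_right[of y "c i"] y by (simp add: dcball_def)
    qed
  qed
  moreover have "compact (E \<inter> cball 0 (a * r i))"
    by (intro closed_Int_compact closed_subspace subspace_E compact_cball)
  then have "compactin (top_of_set (snd (c i) ` fst (c i))) (E \<inter> cball 0 (a * r i))"
    using sub by (simp add: compactin_subtopology)
  then have "compactin X (chart_inv (c i) ` (E \<inter> cball 0 (a * r i)))"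
    by (rule image_compactin[OF _ continuous_chart_inv[OF cA]])
  ultimately show ?thesis using compactin_imp_closedin[OF Hausdorff] by simp
qed

lemma openin_compl_dcball: "a < 1 \<Longrightarrow> openin X (topspace X - dcball i a)"
  using closedin_dcball by (simp add: closedin_def)

text \<open>A union of open sets, since the set where two projections coincide need not be open
  itself.\<close>

definition agree :: "nat \<Rightarrow> nat \<Rightarrow> 'a set" where
  "agree i j = \<Union>{G. openin X G \<and> G \<subseteq> fst (c i) \<inter> fst (c j) \<and> (\<forall>q\<in>G. pr (c i) q = pr (c j) q)}"

lemma openin_agree: "openin X (agree i j)"
  unfolding agree_def by (rule openin_Union) blast

lemma agreeD:
  assumes "p \<in> agree i j"
  shows "p \<in> fst (c i)" "p \<in> fst (c j)" "pr (c i) p = pr (c j) p"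
  using assms unfolding agree_def by blast+

lemma agree_N: "p \<in> N \<Longrightarrow> p \<in> fst (c i) \<Longrightarrow> p \<in> fst (c j) \<Longrightarrow> p \<in> agree i j"
proof -
  assume "p \<in> N" "p \<in> fst (c i)" "p \<in> fst (c j)"
  from pr_agree[OF adapted adapted this]
  obtain G where "openin X G" "p \<in> G" "G \<subseteq> fst (c i) \<inter> fst (c j)" "\<forall>q\<in>G. pr (c i) q = pr (c j) q"
    by (elim exE conjE) (rule that)
  then show ?thesis unfolding agree_def by (intro UnionI[of G]) simp_all
qed

lemma agree_self: "agree i i = fst (c i)"
  unfolding agree_def using openin_chart[OF cA[of i]] by auto

text \<open>Chart \<open>i\<close> must agree with each earlier chart whose bump function can be
  nonzero at the point. Later charts impose no condition: the \<open>i\<close>-th bump function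
  equals 1 on \<open>dball i (1/2)\<close>, which switches off their weights.\<close>

definition dom :: "nat \<Rightarrow> 'a set" where
  "dom i = {p \<in> dball i (1/2). \<forall>j\<in>{..<i}. p \<notin> dcball j (2/3) \<or> p \<in> agree i j}"

lemma openin_dom: "openin X (dom i)"
  unfolding dom_def
proof (rule openin_ball_finite[OF _ openin_dball])
  fix j
  have "{p \<in> topspace X. p \<notin> dcball j (2/3) \<or> p \<in> agree i j} = (topspace X - dcball j (2/3)) \<union> agree i j"
    using openin_subset[OF openin_agree] by auto
  then show "openin X {p \<in> topspace X. p \<notin> dcball j (2/3) \<or> p \<in> agree i j}"
    using openin_Un[OF openin_compl_dcball[of "2/3" j] openin_agree[of i j]] by simp
qed simp

lemma dom_sub: "dom i \<subseteq> fst (c i)"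
  by (auto simp: dom_def dball_def)

lemma dom_agree:
  assumes "p \<in> dom i" "j \<le> i" "p \<in> dcball j (2/3)"
  shows "p \<in> agree i j"
  using assms agree_self dom_sub by (cases "j = i") (auto simp: dom_def)

lemma N_dom: "p \<in> N \<Longrightarrow> p \<in> dball i (1/2) \<Longrightarrow> p \<in> dom i"
  unfolding dom_def using agree_N by (auto simp: dball_def dcball_def)

definition proj_N :: "'a \<Rightarrow> 'a" where
  "proj_N p = pr (c (LEAST i. p \<in> dom i)) p"

text \<open>The least index j is at most i, and \<open>dom j\<close> lies in
  \<open>dball j (1/2)\<close>, hence in \<open>dcball j (2/3)\<close>; so agreement of the charts i
  and j is built into \<open>dom i\<close>.\<close>

lemma proj_N_eq:
  assumes "p \<in> dom i" shows "proj_N p = pr (c i) p"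
proof -
  let ?j = "LEAST i. p \<in> dom i"
  have j: "p \<in> dom ?j" "?j \<le> i" using assms by (auto intro: LeastI Least_le)
  then have "p \<in> dcball ?j (2/3)"
    using r_pos[of ?j] by (auto simp: dom_def dball_def dcball_def)
  then show ?thesis using agreeD(3)[OF dom_agree[OF assms j(2)]] by (simp add: proj_N_def)
qed

section \<open>A partition of unity\<close>

definition bump :: "nat \<Rightarrow> 'a \<Rightarrow> real" where
  "bump i p = (if p \<in> fst (c i) then s ((4/9 - (snd (c i) p \<bullet> snd (c i) p) / (r i)\<^sup>2) * (36/7)) else 0)"

lemma bump_1:
  assumes p: "p \<in> dball i (1/2)" shows "bump i p = 1"
proof -
  \<comment> \<open>The squared norm keeps \<open>bump\<close> smooth at the centre. The constants
    come from 4/9 = (2/3)^2 and 4/9 - (1/2)^2 = 7/36: the argument of \<open>s\<close> is 0 at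
    relative radius 2/3 and 1 at relative radius 1/2.\<close>
  define x where "x = (snd (c i) p \<bullet> snd (c i) p) / (r i)\<^sup>2"
  have "norm (snd (c i) p) / r i \<le> 1/2" using p r_pos[of i] by (simp add: dball_def field_simps)
  then have "(norm (snd (c i) p) / r i)\<^sup>2 \<le> (1/2)\<^sup>2"
    using r_pos[of i] by (intro power_mono) auto
  then have "x \<le> 1/4" by (simp add: x_def power_divide power2_norm_eq_inner)
  then have "1 \<le> (4/9 - x) * (36/7)" by simp
  then have "s ((4/9 - x) * (36/7)) = 1" by (rule s_1)
  then show ?thesis using p by (simp add: bump_def dball_def x_def)
qed

lemma bump_0:
  assumes p: "p \<notin> dcball i (2/3)" shows "bump i p = 0"
proof (cases "p \<in> fst (c i)")
  case True
  define x where "x = (snd (c i) p \<bullet> snd (c i) p) / (r i)\<^sup>2"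
  have "2/3 \<le> norm (snd (c i) p) / r i" using p True r_pos[of i] by (simp add: dcball_def field_simps)
  then have "(2/3)\<^sup>2 \<le> (norm (snd (c i) p) / r i)\<^sup>2" by (intro power_mono) auto
  then have "4/9 \<le> x" by (simp add: x_def power_divide power2_norm_eq_inner)
  then have "(4/9 - x) * (36/7) \<le> 0" by simp
  then have "s ((4/9 - x) * (36/7)) = 0" by (rule s_0)
  then show ?thesis using True by (simp add: bump_def x_def)
qed (simp add: bump_def)

lemma bump_smooth: "smooth_on (snd (c i) ` fst (c i)) (\<lambda>y. bump j (chart_inv (c i) y))"
proof (rule smooth_on_chart_local[OF cA order_refl])
  fix p assume p: "p \<in> fst (c i)"
  show "\<exists>H. openin X H \<and> p \<in> H \<and> smooth_on (snd (c i) ` (fst (c i) \<inter> H)) (\<lambda>y. bump j (chart_inv (c i) y))"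
  proof (cases "p \<in> fst (c j)")
    case True
    have "smooth_on (snd (c i) ` (fst (c i) \<inter> fst (c j)))
        (\<lambda>y. s ((4/9 - (transition (c i) (c j) y \<bullet> transition (c i) (c j) y) / (r j)\<^sup>2) * (36/7)))"
      unfolding divide_inverse
      by (intro smooth_on_compose[OF s_smooth] smooth_on_mult smooth_on_diff smooth_on_const smooth_on_inner
          smooth_transition cA subset_UNIV)
    then have "smooth_on (snd (c i) ` (fst (c i) \<inter> fst (c j))) (\<lambda>y. bump j (chart_inv (c i) y))"
      by (rule smooth_on_eqI) (use chart_inv_left[OF cA[of i]] in \<open>auto simp: bump_def\<close>)
    then show ?thesis using openin_chart[OF cA] True by blast
  next
    case False
    let ?H = "topspace X - dcball j (2/3)"
    have "smooth_on (snd (c i) ` (fst (c i) \<inter> ?H)) (\<lambda>y. bump j (chart_inv (c i) y))"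
      by (rule smooth_on_eqI[OF smooth_on_const[of _ 0]])
        (use chart_inv_left[OF cA[of i]] in \<open>auto intro: bump_0\<close>)
    moreover have "p \<in> ?H" using False p chart_subset[OF cA] by (auto simp: dcball_def)
    ultimately show ?thesis using openin_compl_dcball[of "2/3" j] by auto
  qed
qed

text \<open>The sums telescope to 1 minus a product of factors \<open>1 - bump j p\<close>, which is
  0 as soon as one bump function equals 1. Thus the weights add up to 1 without division, and a
  point of \<open>dom i\<close> involves only indices up to \<open>i\<close>.\<close>

definition weight :: "nat \<Rightarrow> 'a \<Rightarrow> real" where
  "weight i p = bump i p * (\<Prod>j<i. 1 - bump j p)"

lemma weight_smooth: "smooth_on (snd (c i) ` fst (c i)) (\<lambda>y. weight j (chart_inv (c i) y))"
  unfolding weight_def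
  by (intro smooth_on_mult smooth_on_prod smooth_on_diff smooth_on_const bump_smooth)

lemma sum_weight: "(\<Sum>j<n. weight j p) = 1 - (\<Prod>j<n. 1 - bump j p)"
  by (induction n) (auto simp: weight_def algebra_simps)

lemma weight_support: "weight j p \<noteq> 0 \<Longrightarrow> p \<in> dcball j (2/3)"
  using bump_0 unfolding weight_def by fastforce

lemma prod_bump_0:
  assumes "p \<in> dom i" "i < j" shows "(\<Prod>k<j. 1 - bump k p) = 0"
proof (rule prod_zero)
  have "bump i p = 1" using assms(1) by (intro bump_1) (simp add: dom_def)
  then show "\<exists>k\<in>{..<j}. 1 - bump k p = 0" using assms(2) by (intro bexI[of _ i]) auto
qed simp

lemma weight_later: "p \<in> dom i \<Longrightarrow> i < j \<Longrightarrow> weight j p = 0"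
  by (simp add: weight_def prod_bump_0)

lemma sum_weight_dom: "p \<in> dom i \<Longrightarrow> (\<Sum>j\<le>i. weight j p) = 1"
  using sum_weight[where n="Suc i"] prod_bump_0[of p i "Suc i"] by (simp add: lessThan_Suc_atMost)

lemma weight_agree:
  assumes "p \<in> dom i" "weight j p \<noteq> 0"
  shows "j \<le> i" "p \<in> agree i j"
proof -
  show "j \<le> i" using weight_later[OF assms(1)] assms(2) by (meson not_le)
  then show "p \<in> agree i j" using dom_agree[OF assms(1)] weight_support[OF assms(2)] by blast
qed

text \<open>All summands lie in the one fibre over \<open>proj_N p\<close>. Restricting the sum to
  nonzero weights makes it finite on every \<open>dom i\<close> and independent of the choice of
  \<open>i\<close>.\<close>

definition fib :: "'a \<Rightarrow> ('a, 'e) tvec" where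
  "fib p = (\<lambda>d. \<Sum>j | weight j p \<noteq> 0. weight j p *\<^sub>R tvec (c j) (proj_N p) (P (snd (c j) p)) d)"

lemma proj_N_in:
  assumes "p \<in> dom i"
  shows "proj_N p \<in> N" "proj_N p \<in> fst (c i)" "snd (c i) (proj_N p) = Q (snd (c i) p)"
  using proj_N_eq[OF assms] pr_props[OF adapted subsetD[OF dom_sub assms]] by simp_all

lemma proj_N_agree:
  assumes "p \<in> dom i" "p \<in> agree i j"
  shows "proj_N p \<in> fst (c j)" "snd (c j) (proj_N p) = Q (snd (c j) p)"
proof -
  have "proj_N p = pr (c j) p" using proj_N_eq[OF assms(1)] agreeD(3)[OF assms(2)] by simp
  then show "proj_N p \<in> fst (c j)" "snd (c j) (proj_N p) = Q (snd (c j) p)"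
    using pr_props[OF adapted agreeD(2)[OF assms(2)]] by simp_all
qed

lemma proj_N_id:
  assumes "p \<in> N" "p \<in> dom i" shows "proj_N p = p"
  using proj_N_eq[OF assms(2)] pr_id[OF adapted subsetD[OF dom_sub assms(2)] assms(1)] by simp

lemma fib_tangent: 
  assumes "p \<in> dom i" shows "fib p \<in> tangent_space E A (proj_N p)"
  unfolding fib_def
proof (rule tangent_space_sum)
  fix j assume "j \<in> {j. weight j p \<noteq> 0}"
  then have "proj_N p \<in> fst (c j)" using proj_N_agree(1)[OF assms weight_agree(2)[OF assms]] by blast
  then show "tvec (c j) (proj_N p) (P (snd (c j) p)) \<in> tangent_space E A (proj_N p)"
    by (rule tvec_in_tangent_space[OF cA _ P_in_E])
qed

lemma fib_coord:
  assumes "p \<in> dom i"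
  shows "fib p (c i) = (\<Sum>j\<le>i. weight j p *\<^sub>R tderiv (c j) (c i) (proj_N p) (P (snd (c j) p)))"
proof -
  have "fib p (c i) = (\<Sum>j | weight j p \<noteq> 0. weight j p *\<^sub>R tderiv (c j) (c i) (proj_N p) (P (snd (c j) p)))"
    unfolding fib_def using proj_N_in(2)[OF assms] by (simp add: tvec_coord[OF cA])
  also have "\<dots> = (\<Sum>j\<le>i. weight j p *\<^sub>R tderiv (c j) (c i) (proj_N p) (P (snd (c j) p)))"
    by (rule sum.mono_neutral_left) (use weight_agree(1)[OF assms] in auto)
  finally show ?thesis .
qed

lemma fib_coord_F: 
  assumes "p \<in> dom i" shows "fib p (c i) \<in> F"
  unfolding fib_coord[OF assms]
proof (rule subspace_sum[OF subspace_F])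
  fix j
  show "weight j p *\<^sub>R tderiv (c j) (c i) (proj_N p) (P (snd (c j) p)) \<in> F"
  proof (cases "weight j p = 0")
    case False
    then have "proj_N p \<in> fst (c j)" using proj_N_agree(1)[OF assms weight_agree(2)[OF assms]] by blast
    then show ?thesis
      by (intro subspace_scale subspace_F tderiv_F[OF adapted adapted _ proj_N_in(2)[OF assms] P_in_F])
  qed (simp add: subspace_0 subspace_F)
qed

lemma fib_W: "p \<in> dom i \<Longrightarrow> fib p \<in> W (proj_N p)"
  using adapted_W[OF adapted proj_N_in(2) fib_tangent] fib_coord_F by blast

lemma weight_zero_tderiv:
  assumes "p \<in> N" "p \<in> dom i"
  shows "weight j p *\<^sub>R tderiv (c j) (c i) p (P (snd (c j) p)) = 0"
proof (cases "weight j p = 0")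
  case False
  then have j: "p \<in> fst (c j)" using agreeD(2)[OF weight_agree(2)[OF assms(2)]] by blast
  have i: "p \<in> fst (c i)" using assms(2) dom_sub by blast
  have 0: "P (snd (c j) p) = 0" using adapted_N[OF adapted j] assms(1) by blast
  obtain L where L: "bounded_linear L" "\<And>v. v \<in> E \<Longrightarrow> tderiv (c j) (c i) p v = L v"
    using tderiv_linear[OF cA cA j i] by blast
  have "tderiv (c j) (c i) p 0 = 0"
    using L(2)[OF subspace_0[OF subspace_E]] linear_0[OF bounded_linear.linear[OF L(1)]] by simp
  then show ?thesis by (simp add: 0)
qed simp

lemma fib_N:
  assumes "p \<in> N" "p \<in> dom i" shows "fib p = tzero"
proof (rule tangent_space_eqI[OF fib_tangent[OF assms(2)] tangent_space_zero cA proj_N_in(2)[OF assms(2)]])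
  show "fib p (c i) = tzero (c i)"
    unfolding fib_coord[OF assms(2)] proj_N_id[OF assms] tzero_def
    by (rule sum.neutral) (simp add: weight_zero_tderiv[OF assms])
qed

section \<open>The fibre coordinate in a chart and its derivative along \<open>N\<close>\<close>

definition loc :: "nat \<Rightarrow> 'e \<Rightarrow> 'e" where
  "loc i y = fib (chart_inv (c i) y) (c i)"

text \<open>The fibre coordinate of chart \<open>j\<close>, transported to chart \<open>i\<close>.
  The derivative is taken at the projected point, not at the point itself, because the vector lives
  in the fibre over \<open>proj_N\<close>.\<close>

abbreviation lterm :: "nat \<Rightarrow> nat \<Rightarrow> 'e \<Rightarrow> 'e" where
  "lterm i j y \<equiv> dir_deriv (transition (c j) (c i)) (Q (transition (c i) (c j) y)) (P (transition (c i) (c j) y))"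

lemma lterm_smooth: "smooth_on (snd (c i) ` (dom i \<inter> agree i j)) (lterm i j)"
proof -
  let ?S = "snd (c j) ` (fst (c j) \<inter> fst (c i))"
  let ?\<tau> = "transition (c i) (c j)"
  have \<tau>: "smooth_on (snd (c i) ` (dom i \<inter> agree i j)) ?\<tau>"
    by (rule smooth_on_subset[OF smooth_transition[OF cA[of i] cA[of j]]]) (auto dest: agreeD(1,2))
  have "smooth_on (snd (c i) ` (dom i \<inter> agree i j))
      (\<lambda>y. (\<lambda>z. dir_deriv (transition (c j) (c i)) (fst z) (snd z)) (Q (?\<tau> y), P (?\<tau> y)))"
  proof (rule smooth_on_compose[OF smooth_on_dir_deriv[OF openin_transition_domain[OF cA cA] subspace_E smooth_transition[OF cA cA]]])
    show "smooth_on (snd (c i) ` (dom i \<inter> agree i j)) (\<lambda>y. (Q (?\<tau> y), P (?\<tau> y)))"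
      by (intro smooth_on_Pair smooth_on_linear[OF linear_Q \<tau>] smooth_on_linear[OF linear_P \<tau>])
    show "(\<lambda>y. (Q (?\<tau> y), P (?\<tau> y))) ` (snd (c i) ` (dom i \<inter> agree i j)) \<subseteq> ?S \<times> E"
    proof clarsimp
      fix p assume p: "p \<in> dom i" "p \<in> agree i j"
      have "chart_inv (c i) (snd (c i) p) = p"
        using chart_inv_left[OF cA] p(1) dom_sub by blast
      moreover have "Q (snd (c j) p) \<in> ?S"
        using proj_N_agree[OF p] proj_N_in(2)[OF p(1)] by (metis IntI image_eqI)
      ultimately show "Q (snd (c j) (chart_inv (c i) (snd (c i) p))) \<in> ?S \<and> P (snd (c j) (chart_inv (c i) (snd (c i) p))) \<in> E"
        using P_in_E by simp
    qed
  qed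
  then show ?thesis by simp
qed

lemma lterm_eq:
  assumes "p \<in> dom i" "p \<in> agree i j"
  shows "lterm i j (snd (c i) p) = tderiv (c j) (c i) (proj_N p) (P (snd (c j) p))"
  using chart_inv_left[OF cA subsetD[OF dom_sub assms(1)]] proj_N_agree(2)[OF assms]
  by (simp add: tderiv_def)

lemma loc_eq:
  assumes "p \<in> dom i"
  shows "loc i (snd (c i) p) = (\<Sum>j\<le>i. weight j p *\<^sub>R lterm i j (snd (c i) p))"
proof -
  have "loc i (snd (c i) p) = (\<Sum>j\<le>i. weight j p *\<^sub>R tderiv (c j) (c i) (proj_N p) (P (snd (c j) p)))"
    unfolding loc_def using chart_inv_left[OF cA subsetD[OF dom_sub assms]] fib_coord[OF assms] by simp
  also have "\<dots> = (\<Sum>j\<le>i. weight j p *\<^sub>R lterm i j (snd (c i) p))"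
  proof (rule sum.cong)
    fix j
    show "weight j p *\<^sub>R tderiv (c j) (c i) (proj_N p) (P (snd (c j) p)) = weight j p *\<^sub>R lterm i j (snd (c i) p)"
      using lterm_eq[OF assms weight_agree(2)[OF assms]] by (cases "weight j p = 0") auto
  qed simp
  finally show ?thesis .
qed

text \<open>Around a point of \<open>dcball j (2/3)\<close> with j at most i the charts agree and
  \<open>lterm\<close> is smooth. Around all other points the weight is identically 0, so the
  possibly meaningless \<open>lterm\<close> does no harm.\<close>

lemma lsummand_smooth: "smooth_on (snd (c i) ` dom i) (\<lambda>y. weight j (chart_inv (c i) y) *\<^sub>R lterm i j y)"
proof (rule smooth_on_chart_local[OF cA dom_sub])
  fix p assume p: "p \<in> dom i"
  show "\<exists>H. openin X H \<and> p \<in> H \<and> smooth_on (snd (c i) ` (dom i \<inter> H)) (\<lambda>y. weight j (chart_inv (c i) y) *\<^sub>R lterm i j y)"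
  proof (cases "j \<le> i \<and> p \<in> dcball j (2/3)")
    case True
    then have "p \<in> agree i j" using dom_agree[OF p] by blast
    moreover have "smooth_on (snd (c i) ` (dom i \<inter> agree i j)) (\<lambda>y. weight j (chart_inv (c i) y) *\<^sub>R lterm i j y)"
      by (intro smooth_on_scaleR lterm_smooth smooth_on_subset[OF weight_smooth]) (use dom_sub in auto)
    ultimately show ?thesis using openin_agree by blast
  next
    case False
    define H where "H = (if j \<le> i then topspace X - dcball j (2/3) else topspace X)"
    have "weight j q = 0" if "q \<in> dom i" "q \<in> H" for q
      using that weight_later[OF that(1)] weight_support[of j q] by (auto simp: H_def split: if_splits)
    then have "smooth_on (snd (c i) ` (dom i \<inter> H)) (\<lambda>y. weight j (chart_inv (c i) y) *\<^sub>R lterm i j y)"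
      by (intro smooth_on_eqI[OF smooth_on_const[of _ 0]])
        (use chart_inv_left[OF cA subsetD[OF dom_sub]] in auto)
    moreover have "openin X H" using openin_compl_dcball[of "2/3" j] by (simp add: H_def)
    moreover have "p \<in> H" using False p dom_sub chart_subset[OF cA] by (auto simp: H_def)
    ultimately show ?thesis by blast
  qed
qed

lemma loc_smooth: "smooth_on (snd (c i) ` dom i) (loc i)"
proof (rule smooth_on_eqI)
  show "smooth_on (snd (c i) ` dom i) (\<lambda>y. \<Sum>j\<le>i. weight j (chart_inv (c i) y) *\<^sub>R lterm i j y)"
    by (intro smooth_on_sum lsummand_smooth)
  fix y assume "y \<in> snd (c i) ` dom i"
  then obtain p where p: "p \<in> dom i" "y = snd (c i) p" by blast
  then show "loc i y = (\<Sum>j\<le>i. weight j (chart_inv (c i) y) *\<^sub>R lterm i j y)"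
    using loc_eq[OF p(1)] chart_inv_left[OF cA subsetD[OF dom_sub p(1)]] by simp
qed

lemma openin_dom_image: "openin (top_of_set E) (snd (c i) ` dom i)"
  by (rule openin_image_open[OF cA openin_dom dom_sub])

text \<open>In these directions the line stays in \<open>N\<close>, where the fibre coordinate is
  identically 0.\<close>

lemma loc_deriv_N:
  assumes p: "p \<in> N" "p \<in> dom i" and v: "v \<in> E" "P v = 0"
  shows "dir_deriv (loc i) (snd (c i) p) v = 0"
proof -
  have pi: "snd (c i) p \<in> snd (c i) ` dom i" using p by blast
  obtain T where T: "open T" "(0::real) \<in> T" "\<And>t. t \<in> T \<Longrightarrow> snd (c i) p + t *\<^sub>R v \<in> snd (c i) ` dom i"
    using line_in_relopen[OF openin_dom_image subspace_E pi v(1)] by blast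
  have "loc i (snd (c i) p + t *\<^sub>R v) = 0" if t: "t \<in> T" for t
  proof -
    obtain q where q: "q \<in> dom i" "snd (c i) p + t *\<^sub>R v = snd (c i) q" using T(3)[OF t] by blast
    have "P (snd (c i) p) = 0" using adapted_N[OF adapted subsetD[OF dom_sub p(2)]] p(1) by blast
    then have "P (snd (c i) q) = 0"
      using v(2) by (simp add: q(2)[symmetric] P_add linear_cmul[OF linear_P])
    then have "q \<in> N" using adapted_N[OF adapted subsetD[OF dom_sub q(1)]] by blast
    then show ?thesis
      unfolding q(2) loc_def using chart_inv_left[OF cA subsetD[OF dom_sub q(1)]] fib_N q(1)
      by (simp add: tzero_def)
  qed
  then have "eventually (\<lambda>t. loc i (snd (c i) p + t *\<^sub>R v) = 0) (nhds 0)"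
    using T(1,2) by (auto simp: eventually_nhds)
  then have "dir_deriv (loc i) (snd (c i) p) v = vector_derivative (\<lambda>t::real. 0) (at 0)"
    unfolding dir_deriv_def by (intro vector_derivative_cong_eq) auto
  then show ?thesis by simp
qed

text \<open>Along \<open>F\<close> the projection stays at \<open>p\<close>, so each transported
  local coordinate is a fixed linear map applied to a transition map. Transporting there and back is
  the identity on \<open>F\<close>; hence every summand contributes its weight times
  \<open>v\<close>.\<close>

lemma loc_deriv_F:
  assumes p: "p \<in> N" "p \<in> dom i" and v: "v \<in> F"
  shows "dir_deriv (loc i) (snd (c i) p) v = v"
proof -
  let ?y = "snd (c i) p"
  have pc: "p \<in> fst (c i)" using p dom_sub by blast
  have vE: "v \<in> E" using v F_E by blast
  have pi: "?y \<in> snd (c i) ` dom i" using p by blast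
  obtain T where T: "open T" "(0::real) \<in> T" "\<And>t. t \<in> T \<Longrightarrow> ?y + t *\<^sub>R v \<in> snd (c i) ` dom i"
    using line_in_relopen[OF openin_dom_image subspace_E pi vE] by blast
  have Qy: "Q ?y = ?y" using adapted_N[OF adapted pc] p(1) Q_id by blast
  let ?g = "\<lambda>j t. weight j (chart_inv (c i) (?y + t *\<^sub>R v)) *\<^sub>R lterm i j (?y + t *\<^sub>R v)"
  have summand: "(?g j has_vector_derivative weight j p *\<^sub>R v) (at 0)" if j: "j \<le> i" for j
  proof (cases "p \<in> dcball j (2/3)")
    case False
    let ?H = "dom i \<inter> (topspace X - dcball j (2/3))"
    have H: "openin (top_of_set E) (snd (c i) ` ?H)"
      by (rule openin_image_open[OF cA openin_Int[OF openin_dom openin_compl_dcball]]) (use dom_sub in auto)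
    have "?y \<in> snd (c i) ` ?H" using False p pc chart_subset[OF cA] by blast
    then obtain T' where T': "open T'" "(0::real) \<in> T'" "\<And>t. t \<in> T' \<Longrightarrow> ?y + t *\<^sub>R v \<in> snd (c i) ` ?H"
      using line_in_relopen[OF H subspace_E _ vE] by blast
    have "0 = ?g j t" if t: "t \<in> T'" for t
    proof -
      obtain q where "q \<in> dom i" "q \<notin> dcball j (2/3)" "?y + t *\<^sub>R v = snd (c i) q" using T'(3)[OF t] by blast
      then have "weight j (chart_inv (c i) (?y + t *\<^sub>R v)) = 0"
        using chart_inv_left[OF cA subsetD[OF dom_sub]] weight_support by metis
      then show ?thesis by simp
    qed
    then have "(?g j has_vector_derivative 0) (at 0)"
      by (rule has_vector_derivative_transform_within_open[OF has_vector_derivative_const T'(1,2)])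
    moreover have "weight j p = 0" using weight_support False by blast
    ultimately show ?thesis by simp
  next
    case True
    let ?\<tau> = "transition (c i) (c j)"
    let ?H = "dom i \<inter> agree i j"
    have pa: "p \<in> agree i j" by (rule dom_agree[OF p(2) j True])
    then have pj: "p \<in> fst (c j)" by (rule agreeD)
    have H: "openin (top_of_set E) (snd (c i) ` ?H)"
      by (rule openin_image_open[OF cA openin_Int[OF openin_dom openin_agree]]) (use dom_sub in auto)
    have yH: "?y \<in> snd (c i) ` ?H" using p pa by blast
    obtain T' where T': "open T'" "(0::real) \<in> T'" "\<And>t. t \<in> T' \<Longrightarrow> ?y + t *\<^sub>R v \<in> snd (c i) ` ?H"
      using line_in_relopen[OF H subspace_E yH vE] by blast
    obtain L where L: "bounded_linear L" "\<And>u. u \<in> E \<Longrightarrow> tderiv (c j) (c i) p u = L u"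
      using tderiv_linear[OF cA cA pj pc] by blast
    obtain L' where L': "(?\<tau> has_derivative L') (at ?y within snd (c i) ` (fst (c i) \<inter> fst (c j)))"
      "\<And>u. u \<in> E \<Longrightarrow> tderiv (c i) (c j) p u = L' u"
      using tderiv_linear[OF cA cA pc pj] by blast
    \<comment> \<open>The base point of the derivative in \<open>lterm\<close> does not move along
      this line, so a single \<open>L\<close> serves for all t.\<close>
    have lt: "L (P (?\<tau> (?y + t *\<^sub>R v))) = lterm i j (?y + t *\<^sub>R v)" if t: "t \<in> T'" for t
    proof -
      obtain q where q: "q \<in> dom i" "q \<in> agree i j" "?y + t *\<^sub>R v = snd (c i) q" using T'(3)[OF t] by blast
      have qc: "q \<in> fst (c i)" using q(1) dom_sub by blast
      have "snd (c i) (proj_N q) = ?y"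
        using proj_N_in(3)[OF q(1)] q(3)[symmetric] v
        by (simp add: Q_add Qy Q_F linear_cmul[OF linear_Q])
      then have "proj_N q = p"
        using inj_onD[OF inj_on_chart[OF cA]] proj_N_in(2)[OF q(1)] pc by blast
      then have "lterm i j (?y + t *\<^sub>R v) = L (P (snd (c j) q))"
        unfolding q(3) lterm_eq[OF q(1,2)] using L(2)[OF P_in_E] by simp
      then show ?thesis unfolding q(3) using chart_inv_left[OF cA qc] by simp
    qed
    have openO: "openin (top_of_set E) (snd (c i) ` (fst (c i) \<inter> fst (c j)))"
      by (rule openin_transition_domain[OF cA cA])
    have "((\<lambda>t. ?\<tau> (?y + t *\<^sub>R v)) has_vector_derivative L' v) (at 0)"
      by (rule has_vector_derivative_dir_deriv[OF openO subspace_E _ vE L'(1)]) (use pc pj in blast)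
    then have "((\<lambda>t. L (P (?\<tau> (?y + t *\<^sub>R v)))) has_vector_derivative L (P (L' v))) (at 0)"
      by (intro bounded_linear.has_vector_derivative[OF L(1)] bounded_linear.has_vector_derivative[OF bounded_linear_P])
    moreover have "L (P (L' v)) = v"
    proof -
      have F: "L' v \<in> F" using tderiv_F[OF adapted adapted pc pj v] L'(2)[OF vE] by simp
      have "L (L' v) = tderiv (c j) (c i) p (tderiv (c i) (c j) p v)"
        using L'(2)[OF vE] L(2) F F_E by auto
      also have "\<dots> = v" using tderiv_chain[OF cA cA cA pc pj pc vE] tderiv_self[OF cA pc vE] by simp
      finally show ?thesis using P_id[OF F] by simp
    qed
    ultimately have "((\<lambda>t. L (P (?\<tau> (?y + t *\<^sub>R v)))) has_vector_derivative v) (at 0)" by simp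
    then have dl: "((\<lambda>t. lterm i j (?y + t *\<^sub>R v)) has_vector_derivative v) (at 0)"
      by (rule has_vector_derivative_transform_within_open[OF _ T'(1,2)]) (rule lt)
    obtain D where "((\<lambda>y. weight j (chart_inv (c i) y)) has_derivative D) (at ?y within snd (c i) ` fst (c i))"
      using smooth_on_has_derivative[OF weight_smooth] pc by blast
    from has_vector_derivative_dir_deriv[OF openin_chart_image[OF cA] subspace_E _ vE this]
    have "((\<lambda>t. weight j (chart_inv (c i) (?y + t *\<^sub>R v))) has_vector_derivative D v) (at 0)"
      using pc by blast
    from has_vector_derivative_scaleR[OF this[folded has_real_derivative_iff_has_vector_derivative] dl]
    have "(?g j has_vector_derivative weight j (chart_inv (c i) (?y + 0 *\<^sub>R v)) *\<^sub>R v + D v *\<^sub>R lterm i j (?y + 0 *\<^sub>R v)) (at 0)" .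
    \<comment> \<open>This removes the term of the product rule that contains the derivative of the
      weight.\<close>
    moreover have "lterm i j ?y = 0"
    proof -
      have "P (snd (c j) p) = 0" using adapted_N[OF adapted pj] p(1) by blast
      then have "L (P (?\<tau> ?y)) = 0"
        using chart_inv_left[OF cA pc] linear_0[OF bounded_linear.linear[OF L(1)]] by simp
      then show ?thesis using lt[OF T'(2)] by simp
    qed
    ultimately show ?thesis using chart_inv_left[OF cA pc] by simp
  qed
  have "((\<lambda>t. \<Sum>j\<le>i. ?g j t) has_vector_derivative (\<Sum>j\<le>i. weight j p *\<^sub>R v)) (at 0)"
    by (intro has_vector_derivative_sum summand) simp
  moreover have "(\<Sum>j\<le>i. weight j p *\<^sub>R v) = v"
    using sum_weight_dom[OF p(2)] by (simp flip: scaleR_sum_left)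
  ultimately have "((\<lambda>t. \<Sum>j\<le>i. ?g j t) has_vector_derivative v) (at 0)" by simp
  then have "((\<lambda>t. loc i (?y + t *\<^sub>R v)) has_vector_derivative v) (at 0)"
  proof (rule has_vector_derivative_transform_within_open[OF _ T(1,2)])
    fix t assume "t \<in> T"
    then obtain q where q: "q \<in> dom i" "?y + t *\<^sub>R v = snd (c i) q" using T(3) by blast
    show "(\<Sum>j\<le>i. ?g j t) = loc i (?y + t *\<^sub>R v)"
      unfolding q(2) loc_eq[OF q(1)] using chart_inv_left[OF cA subsetD[OF dom_sub q(1)]] by simp
  qed
  then show ?thesis unfolding dir_deriv_def by (rule vector_derivative_at)
qed

lemma loc_has_derivative:
  assumes p: "p \<in> N" "p \<in> dom i"
  obtains D where "(loc i has_derivative D) (at (snd (c i) p) within snd (c i) ` dom i)"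
    "\<And>v. v \<in> E \<Longrightarrow> D v = P v"
proof -
  have pi: "snd (c i) p \<in> snd (c i) ` dom i" using p by blast
  obtain D where D: "bounded_linear D" "(loc i has_derivative D) (at (snd (c i) p) within snd (c i) ` dom i)"
    "\<And>v. v \<in> E \<Longrightarrow> dir_deriv (loc i) (snd (c i) p) v = D v"
    using smooth_on_dir_deriv_linear[OF openin_dom_image subspace_E loc_smooth pi] by blast
  have "D v = P v" if v: "v \<in> E" for v
  proof -
    have "D v = D (Q v) + D (P v)"
      using Q_plus_P[of v] linear_add[OF bounded_linear.linear[OF D(1)], of "Q v" "P v"] by simp
    also have "D (Q v) = 0" using loc_deriv_N[OF p Q_in_E[OF v] P_Q] D(3)[OF Q_in_E[OF v]] by simp
    also have "D (P v) = P v" using loc_deriv_F[OF p P_in_F] D(3)[OF P_in_E] by simp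
    finally show ?thesis by simp
  qed
  then show thesis using that D(2) by blast
qed

end

subsection \<open>The tubular neighbourhood\<close>

context atlas_space
begin

lemma tb_chart_inj:
  assumes "c \<in> A" shows "inj_on (snd (tb_chart E A c)) (fst (tb_chart E A c))"
proof (rule inj_onI)
  fix z w assume z: "z \<in> fst (tb_chart E A c)" and w: "w \<in> fst (tb_chart E A c)"
    and eq: "snd (tb_chart E A c) z = snd (tb_chart E A c) w"
  obtain p v where pv: "z = (p, v)" "p \<in> fst c" "v \<in> tangent_space E A p"
    using z by (auto simp: tb_chart_def)
  obtain q u where qu: "w = (q, u)" "q \<in> fst c" "u \<in> tangent_space E A q"
    using w by (auto simp: tb_chart_def)
  have eq': "snd c p = snd c q" "v c = u c" using eq by (simp_all add: pv qu tb_chart_def)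
  have "p = q" by (rule chart_eqI[OF assms pv(2) qu(2) eq'(1)])
  then have "u \<in> tangent_space E A p" using qu by simp
  from tangent_space_eqI[OF pv(3) this assms pv(2) eq'(2)] show "z = w" using \<open>p = q\<close> qu pv by simp
qed

lemma openin_tb_chart:
  assumes "c \<in> A" "open H"
  shows "openin (tb_topology E A) {z \<in> fst (tb_chart E A c). snd (tb_chart E A c) z \<in> H}"
  unfolding tb_topology_def
  by (rule topology_generated_by_Basis, rule CollectI, intro exI[of _ "tb_chart E A c"] exI[of _ H])
    (use assms in \<open>auto simp: tb_atlas_def\<close>)

end

context tube
begin

text \<open>The map \<open>(proj_N, fib)\<close> in the chart \<open>c i\<close>, with its two components added up. Projecting to \<open>E\<close>
  first makes it a map between open subsets of the whole space, as the inverse function theorem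
  requires.\<close>

definition str :: "nat \<Rightarrow> 'e \<Rightarrow> 'e" where
  "str i y = Q y + loc i (proj E y)"

lemma loc_F: "y \<in> snd (c i) ` dom i \<Longrightarrow> loc i y \<in> F"
  unfolding loc_def using fib_coord_F chart_inv_left[OF cA subsetD[OF dom_sub]] by auto

lemma loc_coord: "x \<in> dom i \<Longrightarrow> loc i (snd (c i) x) = fib x (c i)"
  unfolding loc_def using chart_inv_left[OF cA subsetD[OF dom_sub]] by simp

lemma str_coord: 
  assumes "x \<in> dom i"
  shows "str i (snd (c i) x) = Q (snd (c i) x) + fib x (c i)"
  using assms chart_in_E[OF cA subsetD[OF dom_sub assms]]
  by (simp add: str_def proj_id[OF subspace_E] loc_coord)

text \<open>At a point of \<open>N\<close> the derivative of \<open>str i\<close> is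
  \<open>Q v + P (proj E v)\<close> by \<open>loc_has_derivative\<close>. This is the identity on
  \<open>E\<close> and injective on the whole space, so the inverse function theorem applies; its
  domain is kept inside the preimage of the coordinates of \<open>G\<close>.\<close>

lemma straighten:
  assumes p: "p \<in> N" "p \<in> dom i" and G: "openin X G" "p \<in> G" "G \<subseteq> dom i"
  shows "\<exists>U V g. open U \<and> snd (c i) p \<in> U \<and> open V \<and> homeomorphism U V (str i) g \<and> smooth_on V g \<and>
    (\<forall>y\<in>U. proj E y \<in> snd (c i) ` G)"
proof -
  let ?P = "proj E" and ?y = "snd (c i) p"
  have G_c: "G \<subseteq> fst (c i)" using G(3) dom_sub by blast
  obtain T where T: "open T" "snd (c i) ` G = E \<inter> T"
    using openin_image_open[OF cA G(1) G_c] by (auto simp: openin_open)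
  let ?D = "?P -` T"
  have "continuous_on UNIV ?P"
    using bounded_linear_proj[OF subspace_E] by (simp add: linear_continuous_on)
  then have D: "open ?D" using T(1) by (simp add: open_vimage)
  have PE: "?P y \<in> snd (c i) ` G" if "y \<in> ?D" for y
    using that T(2) proj_in[OF subspace_E] by blast
  have yE: "?P ?y = ?y"
    by (rule proj_id[OF subspace_E chart_in_E[OF cA subsetD[OF dom_sub p(2)]]])
  have yD: "?y \<in> ?D" using G(2) T(2) yE by (simp add: vimage_def) blast
  have smP: "smooth_on ?D ?P"
    by (rule smooth_on_linear[OF linear_proj[OF subspace_E] smooth_on_id])
  have sm: "smooth_on ?D (str i)"
    unfolding str_def
  proof (intro smooth_on_add smooth_on_linear[OF linear_Q smooth_on_id])
    show "smooth_on ?D (\<lambda>y. loc i (?P y))"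
      by (rule smooth_on_compose[OF loc_smooth smP]) (use PE G(3) in blast)
  qed
  obtain L where L: "(loc i has_derivative L) (at ?y within snd (c i) ` dom i)"
    "\<And>v. v \<in> E \<Longrightarrow> L v = P v"
    by (rule loc_has_derivative[OF p]) (rule that)
  have "((\<lambda>y. loc i (?P y)) has_derivative (\<lambda>v. L (?P v))) (at ?y within ?D)"
  proof -
    have 1: "(?P has_derivative ?P) (at ?y within ?D)"
      by (rule bounded_linear_imp_has_derivative[OF bounded_linear_proj[OF subspace_E]])
    have 2: "(loc i has_derivative L) (at (?P ?y) within ?P ` ?D)"
      unfolding yE by (rule has_derivative_subset[OF L(1)]) (use PE G(3) in blast)
    show ?thesis by (rule has_derivative_in_compose[OF 1 2])
  qed
  then have "((\<lambda>y. loc i (?P y)) has_derivative (\<lambda>v. L (?P v))) (at ?y)"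
    using at_within_open[OF yD D] by simp
  moreover have "(\<lambda>v. L (?P v)) = (\<lambda>v. P (?P v))"
    using L(2) proj_in[OF subspace_E] by blast
  ultimately have "(str i has_derivative (\<lambda>v. Q v + P (?P v))) (at ?y)"
    unfolding str_def
    using has_derivative_add[OF bounded_linear_imp_has_derivative[OF bounded_linear_Q]] by simp
  moreover have "inj (\<lambda>v. Q v + P (?P v))"
  proof -
    have lin: "linear (\<lambda>v. Q v + P (?P v))" by (rule has_derivative_linear) fact
    have "v = 0" if v: "Q v + P (?P v) = 0" for v
    proof -
      have "P (Q v + P (?P v)) = P 0" using v by simp
      then have 1: "P (?P v) = 0" by (simp add: P_add P_Q P_P linear_0[OF linear_P])
      then have "Q v = 0" using v by simp
      then have "v \<in> F" by (rule Q_eq_0)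
      then have "P v = v" "?P v = v" using P_id F_E proj_id[OF subspace_E] by blast+
      then show "v = 0" using 1 by simp
    qed
    then show ?thesis unfolding linear_injective_0[OF lin] by blast
  qed
  ultimately obtain U V g where U: "open U" "?y \<in> U" "U \<subseteq> ?D" "open V" "homeomorphism U V (str i) g" "smooth_on V g"
    by (rule smooth_inverse_function_theorem[OF D sm yD])
  then have "\<forall>y\<in>U. ?P y \<in> snd (c i) ` G" using PE by blast
  then show ?thesis using U by blast
qed

definition sbox :: "nat \<Rightarrow> 'e \<Rightarrow> real \<Rightarrow> 'a set" where
  "sbox i a \<delta> = {x \<in> fst (c i). norm (Q (snd (c i) x) - a) < \<delta> \<and> norm (P (snd (c i) x)) < \<delta>}"

lemma openin_sbox: "openin X (sbox i a \<delta>)"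
proof -
  have "openin X {x \<in> fst (c i). Q (snd (c i) x) \<in> ball a \<delta>}"
    by (rule openin_preimage_fun[OF cA openin_chart[OF cA] order_refl _ open_ball])
      (rule linear_continuous_on[OF bounded_linear_Q])
  moreover have "openin X {x \<in> fst (c i). P (snd (c i) x) \<in> ball 0 \<delta>}"
    by (rule openin_preimage_fun[OF cA openin_chart[OF cA] order_refl _ open_ball])
      (rule linear_continuous_on[OF bounded_linear_P])
  ultimately have "openin X ({x \<in> fst (c i). Q (snd (c i) x) \<in> ball a \<delta>} \<inter> {x \<in> fst (c i). P (snd (c i) x) \<in> ball 0 \<delta>})"
    by (rule openin_Int)
  moreover have "{x \<in> fst (c i). Q (snd (c i) x) \<in> ball a \<delta>} \<inter> {x \<in> fst (c i). P (snd (c i) x) \<in> ball 0 \<delta>} = sbox i a \<delta>"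
    by (auto simp: sbox_def dist_norm norm_minus_commute)
  ultimately show ?thesis by simp
qed

text \<open>On each fibre of \<open>proj_N\<close>, the boxes are nested balls, so two points of a fibre of the union
  lie in a common box.\<close>

definition reg :: "nat \<Rightarrow> 'a set" where
  "reg i = \<Union>{sbox i a \<delta> | a \<delta>. sbox i a \<delta> \<subseteq> dom i \<and> inj_on (str i) (snd (c i) ` sbox i a \<delta>)}"

lemma openin_reg: "openin X (reg i)"
  unfolding reg_def by (rule openin_Union) (use openin_sbox in blast)

lemma reg_sub: "reg i \<subseteq> dom i"
  unfolding reg_def by blast

lemma N_reg:
  assumes "p \<in> N" "p \<in> dom i" shows "p \<in> reg i"
proof -
  let ?y = "snd (c i) p"
  obtain U V g where U: "open U" "?y \<in> U" "homeomorphism U V (str i) g" "\<forall>y\<in>U. proj E y \<in> snd (c i) ` dom i"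
    using straighten[OF assms openin_dom assms(2) order_refl] by blast
  obtain \<epsilon> where \<epsilon>: "0 < \<epsilon>" "ball ?y \<epsilon> \<subseteq> U" using U(1,2) by (rule openE)
  have pc: "p \<in> fst (c i)" using assms dom_sub by blast
  have P0: "P ?y = 0" using adapted_N[OF adapted pc] assms(1) by blast
  have inU: "snd (c i) x \<in> U" if x: "x \<in> sbox i ?y (\<epsilon>/2)" for x
  proof -
    have "snd (c i) x - ?y = (Q (snd (c i) x) - ?y) + P (snd (c i) x)"
      by (simp add: Q_def)
    then have "norm (snd (c i) x - ?y) \<le> norm (Q (snd (c i) x) - ?y) + norm (P (snd (c i) x))"
      by (metis norm_triangle_ineq)
    also have "\<dots> < \<epsilon>" using x by (simp add: sbox_def)
    finally show ?thesis using \<epsilon>(2) by (auto simp: dist_norm norm_minus_commute)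
  qed
  have "sbox i ?y (\<epsilon>/2) \<subseteq> dom i"
  proof
    fix x assume x: "x \<in> sbox i ?y (\<epsilon>/2)"
    then have xc: "x \<in> fst (c i)" by (simp add: sbox_def)
    have "proj E (snd (c i) x) = snd (c i) x" by (rule proj_id[OF subspace_E chart_in_E[OF cA xc]])
    moreover have "proj E (snd (c i) x) \<in> snd (c i) ` dom i" using U(4) inU[OF x] by blast
    ultimately have "snd (c i) x \<in> snd (c i) ` dom i" by (simp only:)
    then obtain x' where x': "x' \<in> dom i" "snd (c i) x = snd (c i) x'" by blast
    then have "x = x'" using chart_eqI[OF cA xc _ x'(2)] dom_sub by blast
    then show "x \<in> dom i" using x'(1) by simp
  qed
  moreover have "inj_on (str i) U"
    using U(3) by (intro inj_on_inverseI[where g=g]) (simp add: homeomorphism_def)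
  then have "inj_on (str i) (snd (c i) ` sbox i ?y (\<epsilon>/2))"
    by (rule inj_on_subset) (use inU in blast)
  moreover have "p \<in> sbox i ?y (\<epsilon>/2)"
    using pc P0 \<epsilon>(1) by (simp add: sbox_def Q_id)
  ultimately show ?thesis unfolding reg_def by blast
qed

definition Phi :: "'a \<Rightarrow> 'a \<times> ('a, 'e) tvec" where
  "Phi x = (proj_N x, fib x)"

lemma reg_inj:
  assumes x: "x \<in> reg i" and y: "y \<in> reg i" and eq: "Phi x = Phi y"
  shows "x = y"
proof -
  \<comment> \<open>Equal projections mean equal \<open>Q\<close> parts, and the bound on the
    \<open>P\<close> part is the weaker one for the larger box; so both points lie in the larger
    box, where \<open>str i\<close> is injective.\<close>
  have *: "x = y" if x: "x \<in> sbox i a \<delta>" and y: "y \<in> sbox i b \<eta>" and "\<eta> \<le> \<delta>"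
    and sub: "sbox i a \<delta> \<subseteq> dom i" "sbox i b \<eta> \<subseteq> dom i"
    and inj: "inj_on (str i) (snd (c i) ` sbox i a \<delta>)" and eq: "Phi x = Phi y" for x y a b \<delta> \<eta>
  proof -
    have dom: "x \<in> dom i" "y \<in> dom i" using x y sub by blast+
    have Q: "Q (snd (c i) x) = Q (snd (c i) y)"
      using proj_N_in(3)[OF dom(1)] proj_N_in(3)[OF dom(2)] eq by (simp add: Phi_def)
    then have y': "y \<in> sbox i a \<delta>" using x y \<open>\<eta> \<le> \<delta>\<close> by (simp add: sbox_def)
    have "str i (snd (c i) x) = str i (snd (c i) y)"
      using str_coord[OF dom(1)] str_coord[OF dom(2)] Q eq by (simp add: Phi_def)
    then have "snd (c i) x = snd (c i) y" using inj_onD[OF inj] x y' by blast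
    then show "x = y" using chart_eqI[OF cA subsetD[OF dom_sub dom(1)] subsetD[OF dom_sub dom(2)]] by blast
  qed
  obtain a \<delta> where a: "x \<in> sbox i a \<delta>" "sbox i a \<delta> \<subseteq> dom i" "inj_on (str i) (snd (c i) ` sbox i a \<delta>)"
    using x unfolding reg_def by blast
  obtain b \<eta> where b: "y \<in> sbox i b \<eta>" "sbox i b \<eta> \<subseteq> dom i" "inj_on (str i) (snd (c i) ` sbox i b \<eta>)"
    using y unfolding reg_def by blast
  show ?thesis
  proof (cases "\<eta> \<le> \<delta>")
    case True
    show ?thesis by (rule *[OF a(1) b(1) True a(2) b(2) a(3) eq])
  next
    case False
    then have "\<delta> \<le> \<eta>" by simp
    from *[OF b(1) a(1) this b(2) a(2) b(3) eq[symmetric]] show ?thesis by simp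
  qed
qed

text \<open>Continuity of \<open>proj_N\<close> on \<open>dom i\<close>: in the chart it is the
  linear map \<open>Q\<close>.\<close>

lemma openin_proj_N_preimage:
  assumes "openin X H" shows "openin X {x \<in> dom i. proj_N x \<in> H}"
proof -
  obtain T where T: "open T" "snd (c i) ` (fst (c i) \<inter> H) = E \<inter> T"
    using openin_image_open[OF cA openin_Int[OF openin_chart[OF cA[of i]] assms] Int_lower1]
    by (auto simp: openin_open)
  have "proj_N x \<in> H \<longleftrightarrow> Q (snd (c i) x) \<in> T" if x: "x \<in> dom i" for x
  proof -
    note n = proj_N_in[OF x]
    have "proj_N x \<in> H \<longleftrightarrow> snd (c i) (proj_N x) \<in> snd (c i) ` (fst (c i) \<inter> H)"
    proof
      assume "snd (c i) (proj_N x) \<in> snd (c i) ` (fst (c i) \<inter> H)"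
      then obtain q where "q \<in> fst (c i)" "q \<in> H" "snd (c i) (proj_N x) = snd (c i) q" by blast
      then show "proj_N x \<in> H" using chart_eqI[OF cA n(2)] by blast
    qed (use n in blast)
    also have "\<dots> \<longleftrightarrow> snd (c i) (proj_N x) \<in> T" using T(2) chart_in_E[OF cA n(2)] by blast
    finally show ?thesis using n(3) by simp
  qed
  then have "{x \<in> dom i. proj_N x \<in> H} = {x \<in> dom i. Q (snd (c i) x) \<in> T}" by blast
  moreover have "openin X {x \<in> dom i. Q (snd (c i) x) \<in> T}"
    by (rule openin_preimage_fun[OF cA openin_dom dom_sub _ T(1)])
      (rule linear_continuous_on[OF bounded_linear_Q])
  ultimately show ?thesis by simp
qed

text \<open>For \<open>i \<le> j\<close>, a point of \<open>core j\<close> over the same point of \<open>N\<close> as some point of \<open>core i\<close> lies in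
  \<open>reg i\<close>, where \<open>Phi\<close> is injective.\<close>

definition core :: "nat \<Rightarrow> 'a set" where
  "core i = {x \<in> reg i \<inter> {x \<in> dom i. proj_N x \<in> dball i (1/4)}.
     \<forall>j\<in>{..<i}. x \<in> {x \<in> dom i. proj_N x \<in> topspace X - dcball j (1/3)} \<union> reg j}"

lemma openin_core: "openin X (core i)"
  unfolding core_def
proof (rule openin_ball_finite)
  show "openin X (reg i \<inter> {x \<in> dom i. proj_N x \<in> dball i (1/4)})"
    by (intro openin_Int openin_reg openin_proj_N_preimage openin_dball)
  fix j
  have *: "openin X ({x \<in> dom i. proj_N x \<in> topspace X - dcball j (1/3)} \<union> reg j)"
    by (intro openin_Un openin_reg openin_proj_N_preimage openin_compl_dcball) simp
  have "{p \<in> topspace X. p \<in> {x \<in> dom i. proj_N x \<in> topspace X - dcball j (1/3)} \<union> reg j} =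
      {x \<in> dom i. proj_N x \<in> topspace X - dcball j (1/3)} \<union> reg j"
    using openin_subset[OF *] by blast
  then show "openin X {p \<in> topspace X. p \<in> {x \<in> dom i. proj_N x \<in> topspace X - dcball j (1/3)} \<union> reg j}"
    using * by simp
qed simp

lemma core_sub: "core i \<subseteq> reg i" "core i \<subseteq> dom i"
  using reg_sub by (auto simp: core_def)

lemma dball_mono: "a \<le> b \<Longrightarrow> dball i a \<subseteq> dball i b"
  and dball_dcball: "a \<le> b \<Longrightarrow> dball i a \<subseteq> dcball i b"
  and dcball_dball: "a < b \<Longrightarrow> dcball i a \<subseteq> dball i b"
proof -
  show "dball i a \<subseteq> dball i b" "dball i a \<subseteq> dcball i b" if "a \<le> b"
  proof -
    have "a * r i \<le> b * r i" using that r_pos[of i] by simp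
    then show "dball i a \<subseteq> dball i b" "dball i a \<subseteq> dcball i b" by (auto simp: dball_def dcball_def)
  qed
  show "dcball i a \<subseteq> dball i b" if "a < b"
  proof -
    have "a * r i < b * r i" using that r_pos[of i] by simp
    then show ?thesis by (auto simp: dball_def dcball_def)
  qed
qed

text \<open>Here the gap between 1/3 and 1/2 matters: a point of \<open>N\<close> in
  \<open>dcball j (1/3)\<close> lies in \<open>dball j (1/2)\<close>, hence in \<open>dom j\<close>
  and in \<open>reg j\<close>.\<close>

lemma N_core:
  assumes "p \<in> N" "p \<in> dball i (1/4)" shows "p \<in> core i"
proof -
  have dom: "p \<in> dom i" using N_dom[OF assms(1)] dball_mono[of "1/4" "1/2" i] assms(2) by auto
  have "p \<in> {x \<in> dom i. proj_N x \<in> topspace X - dcball j (1/3)} \<union> reg j" if "j < i" for j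
  proof (cases "p \<in> dcball j (1/3)")
    case True
    then have "p \<in> dball j (1/2)" using dcball_dball[of "1/3" "1/2" j] by auto
    then show ?thesis using N_reg[OF assms(1) N_dom[OF assms(1)]] by blast
  next
    case False
    then show ?thesis using dom proj_N_id[OF assms(1) dom] N_X assms(1) by auto
  qed
  then show ?thesis
    using dom proj_N_id[OF assms(1) dom] N_reg[OF assms(1) dom] assms(2) by (simp add: core_def)
qed

lemma core_inj:
  assumes x: "x \<in> core i" and y: "y \<in> core j" and eq: "Phi x = Phi y"
  shows "x = y"
proof -
  have *: "x = y" if x: "x \<in> core i" and y: "y \<in> core j" and eq: "Phi x = Phi y" and "i \<le> j" for x y i j
  proof -
    have "proj_N y = proj_N x" using eq by (simp add: Phi_def)
    moreover have "proj_N x \<in> dcball i (1/3)"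
      using x dball_dcball[of "1/4" "1/3" i] by (auto simp: core_def)
    ultimately have "y \<in> reg i"
      using y \<open>i \<le> j\<close> by (cases "i = j") (auto simp: core_def)
    then show ?thesis using reg_inj[OF _ _ eq] x core_sub by blast
  qed
  show ?thesis
    using *[OF x y eq] *[OF y x eq[symmetric]] by (cases "i \<le> j") auto
qed

section \<open>\<open>Phi\<close> as a diffeomorphism onto an open part of the bundle\<close>

definition tbox :: "nat \<Rightarrow> 'e \<Rightarrow> real \<Rightarrow> ('a \<times> ('a, 'e) tvec) set" where
  "tbox i a \<delta> = {(q, v). q \<in> N \<and> q \<in> fst (c i) \<and> v \<in> W q \<and> norm (snd (c i) q - a) < \<delta> \<and> norm (v (c i)) < \<delta>}"

text \<open>It guarantees that every element of \<open>tbox i a \<delta>\<close> has a preimage in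
  \<open>core i\<close>. The bound \<open>2 * \<delta>\<close> is the triangle inequality for the
  sum of base and fibre coordinates, each within \<delta>.\<close>

definition good :: "nat \<Rightarrow> 'e \<Rightarrow> real \<Rightarrow> 'e set \<Rightarrow> ('e \<Rightarrow> 'e) \<Rightarrow> bool" where
  "good i a \<delta> V g \<longleftrightarrow> open V \<and> smooth_on V g \<and> (\<forall>y\<in>V. str i (g y) = y \<and> proj E (g y) \<in> snd (c i) ` core i) \<and>
     (\<forall>y\<in>E. norm (y - a) < 2 * \<delta> \<longrightarrow> y \<in> V)"

lemma good_exists:
  assumes "p \<in> N"
  shows "\<exists>i \<delta> V g. good i (snd (c i) p) \<delta> V g \<and> 0 < \<delta> \<and> p \<in> core i"
proof -
  obtain i where "p \<in> fst (c i)" "norm (snd (c i) p) < r i / 4" using N_cover[OF assms] by blast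
  then have "p \<in> dball i (1/4)" by (simp add: dball_def)
  then have core: "p \<in> core i" by (rule N_core[OF assms])
  then have dom: "p \<in> dom i" using core_sub by blast
  let ?y = "snd (c i) p"
  obtain U V g where U: "?y \<in> U" "open V" "homeomorphism U V (str i) g" "smooth_on V g" "\<forall>y\<in>U. proj E y \<in> snd (c i) ` core i"
    using straighten[OF assms dom openin_core core core_sub(2)] by blast
  have P0: "P ?y = 0" using adapted_N[OF adapted subsetD[OF dom_sub dom]] assms by blast
  have "str i ?y = ?y"
    using str_coord[OF dom] fib_N[OF assms dom] P0 by (simp add: tzero_def Q_id)
  then have "?y \<in> V" using U(1,3) by (metis homeomorphism_image1 imageI)
  then obtain \<epsilon> where \<epsilon>: "0 < \<epsilon>" "ball ?y \<epsilon> \<subseteq> V" using U(2) by (metis openE)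
  have "good i ?y (\<epsilon>/2) V g"
    unfolding good_def
  proof (intro conjI ballI impI U)
    fix y assume "y \<in> V"
    then show "str i (g y) = y" "proj E (g y) \<in> snd (c i) ` core i"
      using U(3,5) by (auto simp: homeomorphism_def)
  next
    fix y assume "norm (y - ?y) < 2 * (\<epsilon>/2)"
    then show "y \<in> V" using \<epsilon>(2) by (auto simp: dist_norm norm_minus_commute)
  qed
  then show ?thesis using \<epsilon>(1) core half_gt_zero by blast
qed

text \<open>Adding up the two components loses nothing: applying \<open>Q\<close> recovers the base
  coordinate, since the fibre coordinate lies in \<open>F\<close>.\<close>

lemma Phi_coord:
  assumes x: "x \<in> dom i" and q: "q \<in> N" "q \<in> fst (c i)" and v: "v \<in> W q"
  shows "Phi x = (q, v) \<longleftrightarrow> str i (snd (c i) x) = snd (c i) q + v (c i)"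
proof
  have qN: "Q (snd (c i) q) = snd (c i) q" "P (snd (c i) q) = 0"
    using adapted_N[OF adapted q(2)] q(1) Q_id by blast+
  have vF: "v (c i) \<in> F" by (rule W_coord_F[OF adapted q(2) v])
  have n: "proj_N x \<in> fst (c i)" "snd (c i) (proj_N x) = Q (snd (c i) x)" using proj_N_in[OF x] by auto
  show "str i (snd (c i) x) = snd (c i) q + v (c i)" if "Phi x = (q, v)"
    using that n(2) by (simp add: str_coord[OF x] Phi_def)
  assume "str i (snd (c i) x) = snd (c i) q + v (c i)"
  then have eq: "Q (snd (c i) x) + fib x (c i) = snd (c i) q + v (c i)" by (simp add: str_coord[OF x])
  then have "Q (Q (snd (c i) x) + fib x (c i)) = Q (snd (c i) q + v (c i))" by simp
  then have "Q (snd (c i) x) = snd (c i) q"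
    by (simp add: Q_add Q_Q Q_F[OF vF] Q_F[OF fib_coord_F[OF x]] qN)
  then have "proj_N x = q" using chart_eqI[OF cA n(1) q(2)] n(2) by simp
  moreover have "fib x (c i) = v (c i)" using eq \<open>Q (snd (c i) x) = snd (c i) q\<close> by simp
  moreover have "v \<in> tangent_space E A q" using v W_tangent N_X q(1) by blast
  ultimately show "Phi x = (q, v)"
    unfolding Phi_def using tangent_space_eqI[OF _ _ cA q(2)] fib_tangent[OF x] by blast
qed

lemma good_inverse:
  assumes g: "good i a \<delta> V g" and qv: "(q, v) \<in> tbox i a \<delta>"
  defines "y \<equiv> g (snd (c i) q + v (c i))"
  shows "chart_inv (c i) y \<in> core i" "snd (c i) (chart_inv (c i) y) = y" "Phi (chart_inv (c i) y) = (q, v)"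
    and "snd (c i) q + v (c i) \<in> V"
proof -
  have q: "q \<in> N" "q \<in> fst (c i)" and v: "v \<in> W q"
    and nm: "norm (snd (c i) q - a) < \<delta>" "norm (v (c i)) < \<delta>" using qv by (auto simp: tbox_def)
  let ?z = "snd (c i) q + v (c i)"
  have vF: "v (c i) \<in> F" by (rule W_coord_F[OF adapted q(2) v])
  have zE: "?z \<in> E" using vF F_E chart_in_E[OF cA q(2)] by (intro subspace_add subspace_E) auto
  have "norm (?z - a) \<le> norm (snd (c i) q - a) + norm (v (c i))"
    using norm_triangle_ineq[of "snd (c i) q - a" "v (c i)"] by (simp add: algebra_simps)
  then have "norm (?z - a) < 2 * \<delta>" using nm by simp
  then show zV: "?z \<in> V" using g zE by (simp add: good_def)
  have sy: "str i y = ?z" and Py: "proj E y \<in> snd (c i) ` core i" using g zV by (auto simp: good_def y_def)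
  then have locF: "loc i (proj E y) \<in> F" using loc_F core_sub by blast
  \<comment> \<open>A priori \<open>y\<close> lies in the surrounding space only. This equation puts
    its \<open>Q\<close> part into \<open>E\<close>; its \<open>P\<close> part always lies there, so
    \<open>y\<close> is a genuine chart coordinate.\<close>
  have "Q y = ?z - loc i (proj E y)" using sy by (simp add: str_def algebra_simps)
  then have "Q y \<in> E" using zE locF F_E by (auto intro: subspace_diff subspace_E)
  then have "Q y + P y \<in> E" using P_in_E by (intro subspace_add subspace_E)
  then have "proj E y = y" using Q_plus_P proj_id[OF subspace_E] by simp
  then obtain x where x: "x \<in> core i" "y = snd (c i) x" using Py by auto
  have xd: "x \<in> dom i" using x core_sub by blast
  have inv: "chart_inv (c i) y = x" using chart_inv_left[OF cA subsetD[OF dom_sub xd]] x by simp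
  show "chart_inv (c i) y \<in> core i" "snd (c i) (chart_inv (c i) y) = y" using inv x by simp_all
  show "Phi (chart_inv (c i) y) = (q, v)"
    unfolding inv Phi_coord[OF xd q v] using sy x(2) by simp
qed

text \<open>The neighbourhood is shrunk on the image side: each box bounds the norm of the fibre
  coordinate, so with a vector \<open>v\<close> the target contains all its multiples by numbers in
  [0, 1].\<close>

definition target :: "('a \<times> ('a, 'e) tvec) set" where
  "target = \<Union>{tbox i a \<delta> | i a \<delta>. \<exists>V g. good i a \<delta> V g}"

definition nbhd :: "'a set" where
  "nbhd = {x \<in> (\<Union>i. core i). Phi x \<in> target}"

lemma target_good:
  assumes "z \<in> target"
  obtains i a \<delta> V g where "good i a \<delta> V g" "z \<in> tbox i a \<delta>"
  using assms unfolding target_def by blast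

lemma good_target: "good i a \<delta> V g \<Longrightarrow> tbox i a \<delta> \<subseteq> target"
  unfolding target_def by blast

lemma inj_Phi: "inj_on Phi nbhd"
  by (rule inj_onI) (use core_inj in \<open>auto simp: nbhd_def\<close>)

lemma Phi_nbhd: "Phi ` nbhd = target"
proof
  show "target \<subseteq> Phi ` nbhd"
  proof
    fix z assume z: "z \<in> target"
    then obtain i a \<delta> V g where g: "good i a \<delta> V g" "z \<in> tbox i a \<delta>" by (rule target_good)
    obtain q v where qv: "z = (q, v)" by (cases z)
    note inv = good_inverse[OF g(1) g(2)[unfolded qv]]
    let ?x = "chart_inv (c i) (g (snd (c i) q + v (c i)))"
    have "?x \<in> nbhd" unfolding nbhd_def using inv z qv by auto
    then show "z \<in> Phi ` nbhd" using inv(3) qv by force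
  qed
qed (auto simp: nbhd_def)

lemma nbhd_dom: "x \<in> nbhd \<Longrightarrow> \<exists>i. x \<in> dom i"
  unfolding nbhd_def using core_sub by blast

lemma inv_Phi:
  assumes "good i a \<delta> V g" "(q, v) \<in> tbox i a \<delta>"
  shows "inv_into nbhd Phi (q, v) = chart_inv (c i) (g (snd (c i) q + v (c i)))"
proof (rule inv_into_f_eq[OF inj_Phi])
  show "chart_inv (c i) (g (snd (c i) q + v (c i))) \<in> nbhd"
    unfolding nbhd_def using good_inverse[OF assms] assms(2) good_target[OF assms(1)] by auto
qed (rule good_inverse(3)[OF assms])

lemma openin_nbhd: "openin X nbhd"
proof (subst openin_subopen, rule ballI)
  fix x assume x: "x \<in> nbhd"
  then obtain i a \<delta> V g where g: "good i a \<delta> V g" "Phi x \<in> tbox i a \<delta>"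
    unfolding nbhd_def using target_good by blast
  obtain q v where qv: "Phi x = (q, v)" by (cases "Phi x")
  note inv = good_inverse[OF g(1) g(2)[unfolded qv]]
  \<comment> \<open>The index of the box may differ from the index for which \<open>x\<close> was
    known to lie in a core. Injectivity across cores identifies \<open>x\<close> with the preimage
    found in \<open>core i\<close>.\<close>
  have "x \<in> core i"
    using core_inj[OF _ inv(1)] x inv(1,3) qv by (auto simp: nbhd_def)
  let ?S = "{x \<in> core i. (Q (snd (c i) x), loc i (snd (c i) x)) \<in> ball a \<delta> \<times> ball 0 \<delta>}"
  have "openin X ?S"
  proof (rule openin_preimage_fun[OF cA openin_core])
    show "continuous_on (snd (c i) ` core i) (\<lambda>y. (Q y, loc i y))"
      by (intro continuous_on_Pair linear_continuous_on[OF bounded_linear_Q]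
          smooth_on_imp_continuous_on[OF smooth_on_subset[OF loc_smooth]] image_mono core_sub)
  qed (use core_sub dom_sub in \<open>blast intro: open_Times open_ball\<close>)+
  moreover have S: "y \<in> ?S \<longleftrightarrow> Phi y \<in> tbox i a \<delta>" if y: "y \<in> core i" for y
  proof -
    have yd: "y \<in> dom i" using y core_sub by blast
    show ?thesis
      using y proj_N_in[OF yd] fib_W[OF yd] loc_coord[OF yd]
      by (auto simp: tbox_def Phi_def dist_norm norm_minus_commute)
  qed
  moreover have "?S \<subseteq> nbhd"
    unfolding nbhd_def using S good_target[OF g(1)] by auto
  ultimately show "\<exists>T. openin X T \<and> x \<in> T \<and> T \<subseteq> nbhd"
    using S[OF \<open>x \<in> core i\<close>] g(2) by blast
qed

lemma Phi_N:
  assumes "p \<in> N" shows "p \<in> nbhd" "Phi p = zero_section p"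
proof -
  obtain i \<delta> V g where g: "good i (snd (c i) p) \<delta> V g" "0 < \<delta>" "p \<in> core i"
    using good_exists[OF assms] by blast
  have d: "p \<in> dom i" using g(3) core_sub by blast
  show 1: "Phi p = zero_section p"
    using proj_N_id[OF assms d] fib_N[OF assms d] by (simp add: Phi_def zero_section_def)
  have "tzero \<in> W p" using fib_W[OF d] proj_N_id[OF assms d] fib_N[OF assms d] by simp
  then have "Phi p \<in> tbox i (snd (c i) p) \<delta>"
    unfolding 1 zero_section_def using assms g(2) d dom_sub by (auto simp: tbox_def tzero_def)
  then show "p \<in> nbhd" using g(3) good_target[OF g(1)] by (auto simp: nbhd_def)
qed

lemma tbox_open:
  "tbox i a \<delta> = {z \<in> fst (tb_chart E A (c i)). snd (tb_chart E A (c i)) z \<in> ball a \<delta> \<times> ball 0 \<delta>} \<inter> restricted_bundle W N"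
  using W_tangent N_X
  by (fastforce simp: tbox_def tb_chart_def restricted_bundle_def dist_norm norm_minus_commute)

lemma target_sub: "target \<subseteq> restricted_bundle W N"
  unfolding target_def using tbox_open by blast

lemma openin_target: "openin (subtopology (tb_topology E A) (restricted_bundle W N)) target"
  unfolding target_def
proof (rule openin_Union)
  fix B assume "B \<in> {tbox i a \<delta> | i a \<delta>. \<exists>V g. good i a \<delta> V g}"
  then obtain i a \<delta> where B: "B = tbox i a \<delta>" by blast
  show "openin (subtopology (tb_topology E A) (restricted_bundle W N)) B"
    unfolding openin_subtopology B
    by (intro exI conjI, rule openin_tb_chart[OF cA open_Times[OF open_ball open_ball]], rule tbox_open)
qed

lemma Phi_smooth: "smooth_map_on X A (tb_atlas E A) nbhd Phi"
  unfolding smooth_map_on_def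
proof
  fix x assume x: "x \<in> nbhd"
  then obtain i where i: "x \<in> dom i" using nbhd_dom by blast
  let ?C = "tb_chart E A (c i)"
  have "smooth_on (snd (c i) ` (dom i \<inter> nbhd)) (\<lambda>y. (Q y, loc i y))"
    by (intro smooth_on_Pair smooth_on_linear[OF linear_Q smooth_on_id] smooth_on_subset[OF loc_smooth]) auto
  then have "smooth_on (snd (c i) ` (dom i \<inter> nbhd)) (snd ?C \<circ> Phi \<circ> chart_inv (c i))"
  proof (rule smooth_on_eqI)
    fix y assume "y \<in> snd (c i) ` (dom i \<inter> nbhd)"
    then obtain x where x: "x \<in> dom i" "y = snd (c i) x" by blast
    show "(snd ?C \<circ> Phi \<circ> chart_inv (c i)) y = (Q y, loc i y)"
      using chart_inv_left[OF cA subsetD[OF dom_sub x(1)]] proj_N_in(3)[OF x(1)] loc_coord[OF x(1)] x(2)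
      by (simp add: tb_chart_def Phi_def)
  qed
  moreover have "Phi ` (dom i \<inter> nbhd) \<subseteq> fst ?C"
    using proj_N_in fib_tangent by (auto simp: tb_chart_def Phi_def)
  moreover have "?C \<in> tb_atlas E A" using cA by (simp add: tb_atlas_def)
  ultimately show "\<exists>c\<in>A. \<exists>d\<in>tb_atlas E A. \<exists>G. openin X G \<and> x \<in> G \<and> G \<subseteq> fst c \<and> Phi ` (G \<inter> nbhd) \<subseteq> fst d \<and>
      smooth_on (snd c ` (G \<inter> nbhd)) (snd d \<circ> Phi \<circ> chart_inv c)"
    using cA[of i] openin_dom[of i] i dom_sub[of i]
    by (intro bexI[of _ "c i"] bexI[of _ ?C] exI[of _ "local.dom i"] conjI)
qed

lemma inv_Phi_smooth: "smooth_map_on (tb_topology E A) (tb_atlas E A) A target (inv_into nbhd Phi)"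
  unfolding smooth_map_on_def
proof
  fix z assume z: "z \<in> target"
  then obtain i a \<delta> V g where g: "good i a \<delta> V g" "z \<in> tbox i a \<delta>" by (rule target_good)
  let ?C = "tb_chart E A (c i)"
  let ?G = "{z \<in> fst ?C. snd ?C z \<in> ball a \<delta> \<times> ball 0 \<delta>}"
  have GT: "?G \<inter> target = tbox i a \<delta>"
  proof -
    have *: "T = G \<inter> R \<Longrightarrow> T \<subseteq> S \<Longrightarrow> S \<subseteq> R \<Longrightarrow> G \<inter> S = T" for T G R S :: "'z set" by blast
    show ?thesis by (rule *[OF tbox_open good_target[OF g(1)] target_sub])
  qed
  have inv: "inv_into nbhd Phi (q, v) \<in> core i" "snd (c i) (inv_into nbhd Phi (q, v)) = g (snd (c i) q + v (c i))"
    "snd (c i) q + v (c i) \<in> V" if "(q, v) \<in> tbox i a \<delta>" for q v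
    unfolding inv_Phi[OF g(1) that] using good_inverse[OF g(1) that] by blast+
  \<comment> \<open>In charts, the inverse of \<open>Phi\<close> is \<open>g\<close> applied to the
    sum of base and fibre coordinates.\<close>
  have "smooth_on (snd ?C ` tbox i a \<delta>) (\<lambda>y. g (fst y + snd y))"
  proof (rule smooth_on_compose[where g=g and f="\<lambda>y. fst y + snd y"])
    show "smooth_on V g" using g(1) by (simp add: good_def)
    show "smooth_on (snd ?C ` tbox i a \<delta>) (\<lambda>y. fst y + snd y)"
      by (intro smooth_on_add smooth_on_fst smooth_on_snd smooth_on_id)
    show "(\<lambda>y. fst y + snd y) ` (snd ?C ` tbox i a \<delta>) \<subseteq> V"
      using inv(3) by (auto simp: tb_chart_def)
  qed
  then have "smooth_on (snd ?C ` (?G \<inter> target)) (snd (c i) \<circ> inv_into nbhd Phi \<circ> chart_inv ?C)"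
    unfolding GT
  proof (rule smooth_on_eqI)
    fix y assume "y \<in> snd ?C ` tbox i a \<delta>"
    then obtain w where w: "w \<in> tbox i a \<delta>" "y = snd ?C w" by (rule imageE) (rule that)
    obtain q v where "w = (q, v)" by (cases w)
    then have qv: "(q, v) \<in> tbox i a \<delta>" "y = snd ?C (q, v)" using w by simp_all
    have "(q, v) \<in> fst ?C" using qv(1) tbox_open by blast
    then have "chart_inv ?C y = (q, v)"
      unfolding qv(2) chart_inv_def by (rule inv_into_f_f[OF tb_chart_inj[OF cA]])
    then show "(snd (c i) \<circ> inv_into nbhd Phi \<circ> chart_inv ?C) y = g (fst y + snd y)"
      using inv(2)[OF qv(1)] by (simp add: qv(2) tb_chart_def)
  qed
  moreover have "inv_into nbhd Phi ` (?G \<inter> target) \<subseteq> fst (c i)"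
    unfolding GT using inv(1) core_sub dom_sub by fast
  moreover have "z \<in> ?G" using g(2) GT by blast
  moreover have "?C \<in> tb_atlas E A" using cA by (simp add: tb_atlas_def)
  moreover have "openin (tb_topology E A) ?G" by (rule openin_tb_chart[OF cA open_Times[OF open_ball open_ball]])
  ultimately show "\<exists>C\<in>tb_atlas E A. \<exists>d\<in>A. \<exists>G. openin (tb_topology E A) G \<and> z \<in> G \<and> G \<subseteq> fst C \<and>
      inv_into nbhd Phi ` (G \<inter> target) \<subseteq> fst d \<and>
      smooth_on (snd C ` (G \<inter> target)) (snd d \<circ> inv_into nbhd Phi \<circ> chart_inv C)"
    using cA by (intro bexI[of _ ?C] bexI[of _ "c i"] exI[of _ ?G]) auto
qed

lemma Phi_diffeomorphism:
  "diffeomorphism_on X A (tb_topology E A) (tb_atlas E A) nbhd (Phi ` nbhd) Phi"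
  unfolding diffeomorphism_on_def Phi_nbhd
  using inj_Phi Phi_nbhd Phi_smooth inv_Phi_smooth by (simp add: bij_betw_def)

end

subsection \<open>The differential along the submanifold\<close>

context atlas_space
begin

lemma dir_deriv_chart_change:
  fixes f :: "'a \<Rightarrow> 'b::euclidean_space"
  assumes cd: "c \<in> A" "d \<in> A" and G: "openin X G" "G \<subseteq> fst c" "G \<subseteq> fst d" "p \<in> G"
    and f: "smooth_on (snd d ` G) (f \<circ> chart_inv d)" and u: "u \<in> E"
  shows "dir_deriv (f \<circ> chart_inv d) (snd d p) (tderiv c d p u) = dir_deriv (f \<circ> chart_inv c) (snd c p) u"
proof -
  have S: "openin (top_of_set E) (snd c ` G)" "openin (top_of_set E) (snd d ` G)"
    by (rule openin_image_open[OF cd(1) G(1,2)], rule openin_image_open[OF cd(2) G(1,3)])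
  have pG: "snd c p \<in> snd c ` G" using G(4) by blast
  have \<tau>: "smooth_on (snd c ` G) (transition c d)"
    by (rule smooth_on_subset[OF smooth_transition[OF cd]]) (use G in blast)
  have im: "transition c d ` snd c ` G \<subseteq> snd d ` G"
    using chart_inv_left[OF cd(1)] G by auto
  have "dir_deriv (f \<circ> chart_inv c) (snd c p) u = dir_deriv (\<lambda>y. (f \<circ> chart_inv d) (transition c d y)) (snd c p) u"
  proof (rule dir_deriv_cong[OF S(1) subspace_E pG u])
    fix y assume "y \<in> snd c ` G"
    then obtain q where q: "q \<in> fst c" "q \<in> fst d" "y = snd c q" using G by blast
    show "(f \<circ> chart_inv c) y = (f \<circ> chart_inv d) (transition c d y)"
      using chart_inv_left[OF cd(1) q(1)] chart_inv_left[OF cd(2) q(2)] q(3) by simp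
  qed
  also have "\<dots> = dir_deriv (f \<circ> chart_inv d) (transition c d (snd c p)) (dir_deriv (transition c d) (snd c p) u)"
    by (rule dir_deriv_compose[OF S(1) subspace_E \<tau> pG u S(2) subspace_E f im])
  also have "transition c d (snd c p) = snd d p"
    using chart_inv_left[OF cd(1), of p] G by auto
  finally show ?thesis unfolding tderiv_def by (rule sym)
qed

text \<open>The definition evaluates the differential in a chart picked by \<open>SOME\<close>; this
  replaces it by any chart in which the map is known to be smooth.\<close>

lemma differential_coord:
  fixes B :: "('b, 'f::euclidean_space) chart set"
  assumes c: "c \<in> A" and G: "openin X G" "G \<subseteq> fst c" "p \<in> G"
    and d: "d \<in> B" "f p \<in> fst d" and sm: "smooth_on (snd c ` G) (snd d \<circ> f \<circ> chart_inv c)"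
    and v: "v \<in> tangent_space E A p"
  shows "differential A B f p v d = dir_deriv (snd d \<circ> f \<circ> chart_inv c) (snd c p) (v c)"
proof -
  define c0 where "c0 = (SOME c. c \<in> A \<and> p \<in> fst c)"
  have "c \<in> A \<and> p \<in> fst c" using c G by blast
  then have c0: "c0 \<in> A" "p \<in> fst c0"
    unfolding c0_def using someI[of "\<lambda>c. c \<in> A \<and> p \<in> fst c"] by blast+
  let ?G = "G \<inter> fst c0"
  have G': "openin X ?G" "?G \<subseteq> fst c0" "?G \<subseteq> fst c" "p \<in> ?G"
    using openin_Int[OF G(1) openin_chart[OF c0(1)]] G c0 by auto
  have "differential A B f p v d = dir_deriv (snd d \<circ> f \<circ> chart_inv c0) (snd c0 p) (v c0)"
    using d by (simp add: differential_def c0_def[symmetric] Let_def)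
  also have "\<dots> = dir_deriv (snd d \<circ> f \<circ> chart_inv c) (snd c p) (tderiv c0 c p (v c0))"
    by (rule dir_deriv_chart_change[OF c0(1) c G' smooth_on_subset[OF sm] tangent_in_E[OF v c0], symmetric]) auto
  also have "tderiv c0 c p (v c0) = v c"
    using tangent_coord_change[OF v c0 c] G by auto
  finally show ?thesis .
qed

end

context tube
begin

text \<open>By linearity the two summands can be treated separately. Along \<open>N\<close> the map
  coincides with the zero section; along \<open>W p\<close> it stays in the fibre over
  \<open>p\<close> and agrees to first order with the linear inclusion of that fibre.\<close>

lemma Phi_differential:
  assumes p: "p \<in> N" and a: "a \<in> sub_tangent_space A N p" and b: "b \<in> W p"
  shows "differential A (tb_atlas E A) Phi p (tadd a b) =
    tadd (differential A (tb_atlas E A) zero_section p a) (vertical_lift E A p b)"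
proof
  fix d :: "('a \<times> ('a, 'e) tvec, 'e \<times> 'e) chart"
  have Phi_p: "Phi p = (p, tzero)" using Phi_N(2)[OF p] by (simp add: zero_section_def)
  have lift: "vertical_lift E A p b d =
      (if d \<in> tb_atlas E A \<and> (p, tzero) \<in> fst d then vector_derivative (snd d \<circ> (\<lambda>t. (p, tscale t b))) (at 0) else 0)"
    by (simp add: vertical_lift_def velocity_def tscale_def tzero_def)
  show "differential A (tb_atlas E A) Phi p (tadd a b) d =
    tadd (differential A (tb_atlas E A) zero_section p a) (vertical_lift E A p b) d"
  proof (cases "d \<in> tb_atlas E A \<and> (p, tzero) \<in> fst d")
    case False
    then show ?thesis
      using lift by (auto simp: differential_def tadd_def Phi_p zero_section_def Let_def)
  next
    case True
    then obtain c' where c': "c' \<in> A" "d = tb_chart E A c'" by (auto simp: tb_atlas_def)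
    have snd_d: "snd d (q, v) = (snd c' q, v c')" for q v by (simp add: c'(2) tb_chart_def)
    have pc': "p \<in> fst c'" using True by (auto simp: c'(2) tb_chart_def)
    obtain i where i: "p \<in> dom i" using nbhd_dom[OF Phi_N(1)[OF p]] by blast
    have pc: "p \<in> fst (c i)" using i dom_sub by blast
    let ?\<tau> = "transition (c i) c'"
    let ?y = "snd (c i) p"
    let ?H = "{x \<in> dom i. proj_N x \<in> fst c'}"
    let ?f = "snd d \<circ> Phi \<circ> chart_inv (c i)"
    have H: "openin X ?H" "?H \<subseteq> fst (c i)" "p \<in> ?H"
      using openin_proj_N_preimage[OF openin_chart[OF c'(1)]] dom_sub i proj_N_id[OF p i] pc' by auto
    have SH: "openin (top_of_set E) (snd (c i) ` ?H)" by (rule openin_image_open[OF cA H(1,2)])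
    have yH: "?y \<in> snd (c i) ` ?H" using H(3) by blast
    let ?S = "snd (c i) ` (fst (c i) \<inter> fst c')"
    have QH: "Q (snd (c i) x) \<in> ?S" if "x \<in> ?H" for x
      using proj_N_in(2,3)[of x i] that by (metis (no_types, lifting) IntI image_eqI mem_Collect_eq)
    \<comment> \<open>An arbitrary bundle chart is reached from that of \<open>c i\<close>: the base
      coordinate by the transition map, the fibre coordinate by its derivative at the projected
      point.\<close>
    have f_eq: "?f (snd (c i) x) = (?\<tau> (Q (snd (c i) x)), dir_deriv ?\<tau> (Q (snd (c i) x)) (loc i (snd (c i) x)))"
      if x: "x \<in> ?H" for x
    proof -
      have xd: "x \<in> dom i" "proj_N x \<in> fst c'" using x by auto
      note n = proj_N_in[OF xd(1)]
      have "chart_inv (c i) (snd (c i) x) = x" using chart_inv_left[OF cA subsetD[OF dom_sub xd(1)]] .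
      moreover have "?\<tau> (Q (snd (c i) x)) = snd c' (proj_N x)"
        using n(3) chart_inv_left[OF cA n(2)] by simp
      moreover have "fib x c' = tderiv (c i) c' (proj_N x) (fib x (c i))"
        by (rule tangent_coord_change[OF fib_tangent[OF xd(1)] cA n(2) c'(1) xd(2)])
      ultimately show ?thesis
        using loc_coord[OF xd(1)] n(3) by (simp add: Phi_def snd_d tderiv_def)
    qed
    have f_smooth: "smooth_on (snd (c i) ` ?H) ?f"
    proof (rule smooth_on_eqI)
      have locs: "smooth_on (snd (c i) ` ?H) (loc i)" by (rule smooth_on_subset[OF loc_smooth]) blast
      have Qs: "smooth_on (snd (c i) ` ?H) Q" by (rule smooth_on_linear[OF linear_Q smooth_on_id])
      have "smooth_on (snd (c i) ` ?H) (\<lambda>y. ?\<tau> (Q y))"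
        by (rule smooth_on_compose[OF smooth_transition[OF cA c'(1)] Qs]) (use QH in blast)
      moreover have "smooth_on (snd (c i) ` ?H)
          (\<lambda>y. (\<lambda>z. dir_deriv ?\<tau> (fst z) (snd z)) (Q y, loc i y))"
      proof (rule smooth_on_compose[OF smooth_on_dir_deriv[OF openin_transition_domain[OF cA c'(1)] subspace_E
              smooth_transition[OF cA c'(1)]] smooth_on_Pair[OF Qs locs]])
        show "(\<lambda>y. (Q y, loc i y)) ` snd (c i) ` ?H \<subseteq> ?S \<times> E"
          using QH loc_F F_E by blast
      qed
      ultimately show "smooth_on (snd (c i) ` ?H) (\<lambda>y. (?\<tau> (Q y), dir_deriv ?\<tau> (Q y) (loc i y)))"
        by (intro smooth_on_Pair) simp_all
    qed (use f_eq in blast)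
    have aT: "a \<in> tangent_space E A p" by (rule sub_tangent_tangent[OF p a])
    have bT: "b \<in> tangent_space E A p" using b W_tangent N_X p by blast
    let ?a = "a (c i)" and ?b = "b (c i)"
    have aE: "?a \<in> E" by (rule tangent_in_E[OF aT cA pc])
    have bF: "?b \<in> F" by (rule W_coord_F[OF adapted pc b])
    then have bE: "?b \<in> E" using F_E by blast
    have Py: "P ?y = 0" using adapted_N[OF adapted pc] p by blast
    have Pa: "P ?a = 0"
    proof -
      have "subspace {y. P y = 0}"
        by (auto simp: subspace_def P_add linear_0[OF linear_P] linear_cmul[OF linear_P])
      then have "?a \<in> {y. P y = 0}"
        by (rule sub_tangent_in_slice[OF a cA pc]) (use adapted_N[OF adapted] in blast)
      then show ?thesis by simp
    qed
    obtain D where D: "bounded_linear D" "\<And>v. v \<in> E \<Longrightarrow> dir_deriv ?f ?y v = D v"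
      using smooth_on_dir_deriv_linear[OF SH subspace_E f_smooth yH] by blast
    have "differential A (tb_atlas E A) Phi p (tadd a b) d = dir_deriv ?f ?y (tadd a b (c i))"
      by (rule differential_coord[OF cA H _ _ f_smooth tangent_space_add[OF aT bT]])
        (use True Phi_p in auto)
    also have "\<dots> = D (?a + ?b)"
      using D(2)[OF subspace_add[OF subspace_E aE bE]] by (simp add: tadd_def)
    also have "\<dots> = dir_deriv ?f ?y ?a + dir_deriv ?f ?y ?b"
      using linear_add[OF bounded_linear.linear[OF D(1)]] D(2) aE bE by simp
    also have "dir_deriv ?f ?y ?a = differential A (tb_atlas E A) zero_section p a d"
    proof -
      let ?g = "snd d \<circ> zero_section \<circ> chart_inv (c i)"
      let ?I = "fst (c i) \<inter> fst c'"
      have I: "openin X ?I" "?I \<subseteq> fst (c i)" "p \<in> ?I"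
        using openin_Int[OF openin_chart[OF cA] openin_chart[OF c'(1)]] pc pc' by auto
      have "smooth_on (snd (c i) ` ?I) (\<lambda>y. (?\<tau> y, 0))"
        by (intro smooth_on_Pair smooth_on_const smooth_transition cA c'(1))
      then have g: "smooth_on (snd (c i) ` ?I) ?g"
        by (rule smooth_on_eqI) (simp add: zero_section_def snd_d tzero_def)
      have "differential A (tb_atlas E A) zero_section p a d = dir_deriv ?g ?y ?a"
        by (rule differential_coord[OF cA I _ _ g aT]) (use True in \<open>auto simp: zero_section_def\<close>)
      also have "\<dots> = dir_deriv ?f ?y ?a"
      proof -
        obtain T where T: "open T" "(0::real) \<in> T" "\<And>t. t \<in> T \<Longrightarrow> ?y + t *\<^sub>R ?a \<in> snd (c i) ` ?H"
          using line_in_relopen[OF SH subspace_E yH aE] by blast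
        have "?g (?y + t *\<^sub>R ?a) = ?f (?y + t *\<^sub>R ?a)" if t: "t \<in> T" for t
        proof -
          obtain x where x: "x \<in> dom i" "?y + t *\<^sub>R ?a = snd (c i) x" using T(3)[OF t] by blast
          have xc: "x \<in> fst (c i)" using x dom_sub by blast
          have "P (snd (c i) x) = 0"
            using Py Pa by (simp add: x(2)[symmetric] P_add linear_cmul[OF linear_P])
          then have "x \<in> N" using adapted_N[OF adapted xc] by blast
          then show ?thesis unfolding x(2) using chart_inv_left[OF cA xc] Phi_N(2) by simp
        qed
        then have "eventually (\<lambda>t. ?g (?y + t *\<^sub>R ?a) = ?f (?y + t *\<^sub>R ?a)) (nhds 0)"
          unfolding eventually_nhds using T(1,2) by blast
        then show ?thesis unfolding dir_deriv_def by (intro vector_derivative_cong_eq) auto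
      qed
      finally show ?thesis by simp
    qed
    also have "dir_deriv ?f ?y ?b = vertical_lift E A p b d"
    proof -
      obtain L where L: "bounded_linear L" "\<And>v. v \<in> E \<Longrightarrow> tderiv (c i) c' p v = L v"
        using tderiv_linear[OF cA c'(1) pc pc'] by blast
      obtain T where T: "open T" "(0::real) \<in> T" "\<And>t. t \<in> T \<Longrightarrow> ?y + t *\<^sub>R ?b \<in> snd (c i) ` ?H"
        using line_in_relopen[OF SH subspace_E yH bE] by blast
      obtain D' where D': "(loc i has_derivative D') (at ?y within snd (c i) ` dom i)" "\<And>v. v \<in> E \<Longrightarrow> D' v = P v"
        by (rule loc_has_derivative[OF p i]) (rule that)
      have ydom: "?y \<in> snd (c i) ` dom i" using i by blast
      have "((\<lambda>t. loc i (?y + t *\<^sub>R ?b)) has_vector_derivative D' ?b) (at 0)"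
        by (rule has_vector_derivative_dir_deriv[OF openin_dom_image subspace_E ydom bE D'(1)])
      then have "((\<lambda>t. L (loc i (?y + t *\<^sub>R ?b))) has_vector_derivative L (D' ?b)) (at 0)"
        by (rule bounded_linear.has_vector_derivative[OF L(1)])
      moreover have "L (D' ?b) = b c'"
        using D'(2)[OF bE] P_id[OF bF] L(2)[OF bE] tangent_coord_change[OF bT cA pc c'(1) pc'] by simp
      ultimately have "((\<lambda>t. (snd c' p, L (loc i (?y + t *\<^sub>R ?b)))) has_vector_derivative (0, b c')) (at 0)"
        by (intro has_vector_derivative_Pair has_vector_derivative_const) simp
      then have "((\<lambda>t. ?f (?y + t *\<^sub>R ?b)) has_vector_derivative (0, b c')) (at 0)"
      proof (rule has_vector_derivative_transform_within_open[OF _ T(1,2)])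
        fix t assume "t \<in> T"
        then obtain x where x: "x \<in> ?H" "?y + t *\<^sub>R ?b = snd (c i) x" using T(3) by blast
        have "Q (snd (c i) x) = ?y"
          using x(2)[symmetric] by (simp add: Q_add Q_id[OF Py] linear_cmul[OF linear_Q] Q_F[OF bF])
        moreover have "loc i (snd (c i) x) \<in> E" using x(1) loc_F F_E by blast
        ultimately show "(snd c' p, L (loc i (?y + t *\<^sub>R ?b))) = ?f (?y + t *\<^sub>R ?b)"
          unfolding x(2) f_eq[OF x(1)] using L(2) chart_inv_left[OF cA pc] by (simp add: tderiv_def)
      qed
      then have 1: "dir_deriv ?f ?y ?b = (0, b c')" unfolding dir_deriv_def by (rule vector_derivative_at)
      have "((\<lambda>t. (snd c' p, t *\<^sub>R b c')) has_vector_derivative (0, b c')) (at 0)"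
        by (intro has_vector_derivative_Pair has_vector_derivative_const) (auto intro!: derivative_eq_intros)
      then have "vector_derivative (\<lambda>t. (snd c' p, t *\<^sub>R b c')) (at 0) = (0, b c')"
        by (rule vector_derivative_at)
      moreover have "snd d \<circ> (\<lambda>t. (p, tscale t b)) = (\<lambda>t. (snd c' p, t *\<^sub>R b c'))"
        by (auto simp: snd_d tscale_def)
      ultimately have "vertical_lift E A p b d = (0, b c')"
        using True lift by simp
      then show ?thesis using 1 by simp
    qed
    finally show ?thesis by (simp add: tadd_def)
  qed
qed

end

subsection \<open>Leaves\<close>

context tube
begin

text \<open>The inclusion has derivatives with values in \<open>W\<close>, which reads as
  \<open>F\<close> in the chart \<open>c i\<close>, so \<open>Q\<close> of the coordinates has zero
  derivative. It is therefore constant on a convex piece of a chart of \<open>Y\<close>.\<close>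

lemma integral_manifold_proj_N_locally_const:
  assumes Y: "smooth_manifold F' Y B" and id: "smooth_map_on Y B A (topspace Y) id"
    and bij: "\<And>q. q \<in> topspace Y \<Longrightarrow> bij_betw (differential B A id q) (tangent_space F' B q) (W q)"
    and sub: "topspace Y \<subseteq> nbhd" and q: "q \<in> topspace Y"
  shows "\<exists>G. openin Y G \<and> q \<in> G \<and> (\<forall>x\<in>G. proj_N x = proj_N q)"
proof -
  interpret Y: atlas_space F' Y B
    using Y by unfold_locales (simp_all add: smooth_manifold_def)
  obtain i where i: "q \<in> dom i" using nbhd_dom sub q by blast
  obtain e d G where e: "e \<in> B" and d: "d \<in> A" and G: "openin Y G" "q \<in> G" "G \<subseteq> fst e"
    and Gd: "id ` (G \<inter> topspace Y) \<subseteq> fst d"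
    and sm: "smooth_on (snd e ` (G \<inter> topspace Y)) (snd d \<circ> id \<circ> chart_inv e)"
    using bspec[OF id[unfolded smooth_map_on_def] q] by (elim bexE exE conjE) (rule that)
  have GY: "G \<inter> topspace Y = G" using openin_subset[OF G(1)] by blast
  have Gd': "G \<subseteq> fst d" using Gd GY by simp
  let ?f = "snd d \<circ> chart_inv e"
  have f: "smooth_on (snd e ` G) ?f" using sm unfolding GY by simp
  have f_eq: "?f (snd e x) = snd d x" if "x \<in> G" for x
    using Y.chart_inv_left[OF e subsetD[OF G(3) that]] by simp
  obtain T where T: "open T" "snd d ` (fst d \<inter> dom i) = E \<inter> T"
    using openin_image_open[OF d openin_Int[OF openin_chart[OF d] openin_dom[of i]]]
    by (auto simp: openin_open)
  \<comment> \<open>Smoothness of the inclusion is given in some chart \<open>d\<close> of the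
    manifold. Shrinking to points of \<open>dom i\<close>, by an open condition in the topology of
    \<open>Y\<close>, allows passing to the chart \<open>c i\<close>.\<close>
  define G1 where "G1 = {x \<in> G. ?f (snd e x) \<in> T}"
  have G1: "openin Y G1" unfolding G1_def
    by (rule Y.openin_preimage_fun[OF e G(1,3) smooth_on_imp_continuous_on[OF f] T(1)])
  have G1_sub: "G1 \<subseteq> G" by (auto simp: G1_def)
  have G1_dom: "x \<in> dom i" if x: "x \<in> G1" for x
  proof -
    have xd: "x \<in> fst d" "x \<in> G" using x G1_sub Gd' by blast+
    have "snd d x \<in> E \<inter> T" using x f_eq[OF xd(2)] chart_in_E[OF d xd(1)] by (simp add: G1_def)
    then obtain x' where x': "x' \<in> fst d" "x' \<in> dom i" "snd d x = snd d x'" using T(2) by auto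
    then show ?thesis using chart_eqI[OF d xd(1) x'(1,3)] by simp
  qed
  have qG1: "q \<in> G1"
    using G(2) Gd' i T(2) f_eq[OF G(2)] by (auto simp: G1_def)
  let ?f1 = "snd (c i) \<circ> id \<circ> chart_inv e"
  have f1_eq: "?f1 (snd e x) = snd (c i) x" if "x \<in> G1" for x
    using Y.chart_inv_left[OF e] that G1_sub G(3) by auto
  have f1: "smooth_on (snd e ` G1) ?f1"
  proof (rule smooth_on_eqI)
    show "smooth_on (snd e ` G1) (\<lambda>y. transition d (c i) (?f y))"
      by (rule smooth_on_compose[OF smooth_transition[OF d cA[of i]] smooth_on_subset[OF f image_mono[OF G1_sub]]])
        (use f_eq G1_sub Gd' G1_dom dom_sub in force)
    fix y assume "y \<in> snd e ` G1"
    then obtain x where x: "x \<in> G1" "y = snd e x" by blast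
    then have "x \<in> G" "x \<in> fst d" using G1_sub Gd' by blast+
    then show "?f1 y = transition d (c i) (?f y)"
      using f1_eq[OF x(1)] f_eq chart_inv_left[OF d] x(2) by simp
  qed
  have G1e: "G1 \<subseteq> fst e" using G1_sub G(3) by blast
  have S1: "openin (top_of_set F') (snd e ` G1)" by (rule Y.openin_image_open[OF e G1 G1e])
  then obtain T1 where T1: "open T1" "snd e ` G1 = F' \<inter> T1" by (auto simp: openin_open)
  let ?z = "snd e q"
  have "?z \<in> T1" using qG1 T1(2) by blast
  then obtain \<epsilon> where \<epsilon>: "0 < \<epsilon>" "ball ?z \<epsilon> \<subseteq> T1" using T1(1) by (metis openE)
  let ?S = "F' \<inter> ball ?z \<epsilon>"
  have S_sub: "?S \<subseteq> snd e ` G1" using \<epsilon>(2) T1(2) by blast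
  have conv: "convex ?S"
    by (intro convex_Int subspace_imp_convex Y.subspace_E convex_ball)
  have zS: "?z \<in> ?S" using \<epsilon>(1) Y.chart_in_E[OF e subsetD[OF G1e qG1]] by simp
  have const: "Q (?f1 ?z) = Q (?f1 y)" if y: "y \<in> ?S" for y
  proof (rule zero_derivative_on_segment[OF conv zS y])
    fix w assume "w \<in> ?S"
    then obtain x where x: "x \<in> G1" "w = snd e x" using S_sub by blast
    have xe: "x \<in> fst e" using x G1e by blast
    have xY: "x \<in> topspace Y" using x openin_subset[OF G1] by blast
    have wS: "w \<in> snd e ` G1" using x by blast
    obtain D where D: "bounded_linear D" "(?f1 has_derivative D) (at w within snd e ` G1)"
      "\<And>v. v \<in> F' \<Longrightarrow> dir_deriv ?f1 w v = D v"
      using smooth_on_dir_deriv_linear[OF S1 Y.subspace_E f1 wS] by blast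
    let ?u = "y - ?z"
    have u: "?u \<in> F'" using y zS Y.subspace_E by (blast intro: subspace_diff)
    have v: "Y.tvec e x ?u \<in> tangent_space F' B x" by (rule Y.tvec_in_tangent_space[OF e xe u])
    then have "differential B A id x (Y.tvec e x ?u) \<in> W x"
      using bij[OF xY] by (auto simp: bij_betw_def)
    moreover have xc: "x \<in> fst (c i)" using G1_dom[OF x(1)] dom_sub by blast
    ultimately have "differential B A id x (Y.tvec e x ?u) (c i) \<in> F"
      by (intro W_coord_F[OF adapted])
    moreover have "differential B A id x (Y.tvec e x ?u) (c i) = dir_deriv ?f1 w ?u"
      using Y.differential_coord[OF e G1 G1e x(1) cA _ f1 v] xc Y.tvec_self[OF e xe u] x(2) by simp
    ultimately have "Q (D ?u) = 0" using D(3)[OF u] Q_F by simp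
    moreover have "((\<lambda>y. Q (?f1 y)) has_derivative (\<lambda>v. Q (D v))) (at w within ?S)"
      by (rule bounded_linear.has_derivative[OF bounded_linear_Q has_derivative_subset[OF D(2) S_sub]])
    ultimately show "\<exists>D. ((\<lambda>y. Q (?f1 y)) has_derivative D) (at w within ?S) \<and> D ?u = 0" by blast
  qed
  define G2 where "G2 = {x \<in> G1. snd e x \<in> ball ?z \<epsilon>}"
  have G2: "openin Y G2" unfolding G2_def
    by (rule Y.openin_preimage_fun[OF e G1 G1e continuous_on_id open_ball])
  have const2: "\<forall>x\<in>G2. proj_N x = proj_N q"
  proof
    fix x assume x: "x \<in> G2"
    have xG1: "x \<in> G1" using x by (simp add: G2_def)
    have "snd e x \<in> ?S" using x Y.chart_in_E[OF e subsetD[OF G1e xG1]] by (simp add: G2_def)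
    then have "Q (snd (c i) q) = Q (snd (c i) x)" using const f1_eq[OF qG1] f1_eq[OF xG1] by simp
    then show "proj_N x = proj_N q" using proj_N_eq[OF i] proj_N_eq[OF G1_dom[OF xG1]] by (simp add: pr_def)
  qed
  have "q \<in> G2" using qG1 \<epsilon>(1) by (simp add: G2_def)
  then show ?thesis using G2 const2 by (intro exI[of _ G2] conjI)
qed

lemma integral_manifold_proj_N_const:
  assumes Y: "connected_integral_manifold E X A W nbhd Y" and p: "p \<in> topspace Y" and q: "q \<in> topspace Y"
  shows "proj_N q = proj_N p"
proof -
  have Y': "topspace Y \<subseteq> nbhd" "connected_space Y"
    using Y unfolding connected_integral_manifold_def by simp_all
  obtain F' :: "'e set" and B where B: "smooth_manifold F' Y B" "smooth_map_on Y B A (topspace Y) id"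
    "\<forall>q\<in>topspace Y. bij_betw (differential B A id q) (tangent_space F' B q) (W q)"
    using Y unfolding connected_integral_manifold_def by blast
  have loc: "\<exists>G. openin Y G \<and> x \<in> G \<and> (\<forall>y\<in>G. proj_N y = proj_N x)" if "x \<in> topspace Y" for x
    by (rule integral_manifold_proj_N_locally_const[OF B(1,2) _ Y'(1) that]) (use B(3) in simp)
  \<comment> \<open>An arbitrary predicate covers a level set and its complement at once;
    connectedness then leaves a single level.\<close>
  have op: "openin Y {x \<in> topspace Y. R (proj_N x)}" for R
  proof (subst openin_subopen, rule ballI)
    fix x assume "x \<in> {x \<in> topspace Y. R (proj_N x)}"
    then have x: "x \<in> topspace Y" "R (proj_N x)" by simp_all
    obtain G where G: "openin Y G" "x \<in> G" "\<forall>y\<in>G. proj_N y = proj_N x"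
      using loc[OF x(1)] by (elim exE conjE) (rule that)
    have "G \<subseteq> {x \<in> topspace Y. R (proj_N x)}"
    proof
      fix y assume "y \<in> G"
      then have "y \<in> topspace Y" "proj_N y = proj_N x" using openin_subset[OF G(1)] G(3) by blast+
      then show "y \<in> {x \<in> topspace Y. R (proj_N x)}" using x(2) by simp
    qed
    then show "\<exists>T. openin Y T \<and> x \<in> T \<and> T \<subseteq> {x \<in> topspace Y. R (proj_N x)}"
      using G(1,2) by (intro exI[of _ G] conjI)
  qed
  show ?thesis
  proof (rule ccontr)
    assume neq: "proj_N q \<noteq> proj_N p"
    let ?U = "{x \<in> topspace Y. proj_N x = proj_N p}" and ?V = "{x \<in> topspace Y. proj_N x \<noteq> proj_N p}"
    have "openin Y ?U \<and> openin Y ?V \<and> topspace Y \<subseteq> ?U \<union> ?V \<and> ?U \<inter> ?V = {} \<and> ?U \<noteq> {} \<and> ?V \<noteq> {}"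
      using op[of "\<lambda>y. y = proj_N p"] op[of "\<lambda>y. y \<noteq> proj_N p"] p q neq
      by (intro conjI) auto
    then have "\<not> connected_space Y" unfolding connected_space_def not_not by (intro exI)
    then show False using Y'(2) by simp
  qed
qed

text \<open>A local description of a fibre of \<open>proj_N\<close> by two charts: \<open>i\<close>
  gives coordinates for the whole fibre, \<open>j\<close> belongs to the box containing
  \<open>Phi q\<close>, and \<open>L\<close> changes fibre coordinates from one to the other. The
  condition \<open>norm (L u) < \<delta>\<close> is open and stable under shrinking \<open>u\<close>
  to 0, which yields both openness and starshapedness.\<close>

lemma leaf_local:
  assumes p: "p \<in> N" "p \<in> fst (c i)" and q: "q \<in> nbhd" "proj_N q = p"
  obtains j L \<delta> V g where "bounded_linear L" "p \<in> fst (c j)" "\<forall>u\<in>E. tderiv (c i) (c j) p u = L u"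
    "norm (L (fib q (c i))) < \<delta>" "smooth_on V g"
    "\<forall>u\<in>F. norm (L u) < \<delta> \<longrightarrow> snd (c j) p + L u \<in> V \<and> (\<exists>x\<in>nbhd. Phi x = (p, tvec (c i) p u))"
    "\<forall>x\<in>nbhd. proj_N x = p \<longrightarrow> norm (L (fib x (c i))) < \<delta> \<longrightarrow>
       x \<in> dom j \<and> snd (c j) x = g (snd (c j) p + L (fib x (c i)))"
proof -
  have "Phi q \<in> target" using q(1) Phi_nbhd by blast
  then obtain j a \<delta> V g where g: "good j a \<delta> V g" "Phi q \<in> tbox j a \<delta>" by (rule target_good)
  have pj: "p \<in> fst (c j)" "norm (snd (c j) p - a) < \<delta>"
    using g(2) q(2) by (simp_all add: Phi_def tbox_def)
  obtain L where L: "bounded_linear L" "\<And>u. u \<in> E \<Longrightarrow> tderiv (c i) (c j) p u = L u"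
    using tderiv_linear[OF cA cA p(2) pj(1)] by blast
  have fib: "fib x \<in> tangent_space E A p" "fib x \<in> W p" if x: "x \<in> nbhd" "proj_N x = p" for x
    using nbhd_dom[OF x(1)] fib_tangent fib_W x(2) by blast+
  have fibL: "fib x (c j) = L (fib x (c i))" if x: "x \<in> nbhd" "proj_N x = p" for x
    using tangent_coord_change[OF fib(1)[OF x] cA p(2) cA pj(1)] L(2)[OF tangent_in_E[OF fib(1)[OF x] cA p(2)]]
    by simp
  have box: "(p, tvec (c i) p u) \<in> tbox j a \<delta>" "tvec (c i) p u (c j) = L u" if u: "u \<in> F" "norm (L u) < \<delta>" for u
  proof -
    have "u \<in> E" using u F_E by blast
    then show "tvec (c i) p u (c j) = L u" using tvec_coord[OF cA pj(1)] L(2) by simp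
    then show "(p, tvec (c i) p u) \<in> tbox j a \<delta>"
      using adapted_tvec_W[OF adapted p(2) u(1)] pj p(1) u(2) by (simp add: tbox_def)
  qed
  show thesis
  proof (rule that[OF L(1) pj(1)])
    show "\<forall>u\<in>E. tderiv (c i) (c j) p u = L u" using L(2) by blast
    show "norm (L (fib q (c i))) < \<delta>"
      using g(2) fibL[OF q] by (simp add: Phi_def tbox_def)
    show "smooth_on V g" using g(1) by (simp add: good_def)
    show "\<forall>u\<in>F. norm (L u) < \<delta> \<longrightarrow> snd (c j) p + L u \<in> V \<and> (\<exists>x\<in>nbhd. Phi x = (p, tvec (c i) p u))"
    proof (intro ballI impI conjI)
      fix u assume u: "u \<in> F" "norm (L u) < \<delta>"
      show "snd (c j) p + L u \<in> V" using good_inverse(4)[OF g(1) box(1)[OF u]] box(2)[OF u] by simp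
      show "\<exists>x\<in>nbhd. Phi x = (p, tvec (c i) p u)"
      proof -
        have "(p, tvec (c i) p u) \<in> Phi ` nbhd"
          unfolding Phi_nbhd by (rule subsetD[OF good_target[OF g(1)] box(1)[OF u]])
        then show ?thesis by auto
      qed
    qed
    show "\<forall>x\<in>nbhd. proj_N x = p \<longrightarrow> norm (L (fib x (c i))) < \<delta> \<longrightarrow>
       x \<in> dom j \<and> snd (c j) x = g (snd (c j) p + L (fib x (c i)))"
    proof (intro ballI impI)
      fix x assume x: "x \<in> nbhd" "proj_N x = p" "norm (L (fib x (c i))) < \<delta>"
      have tb: "(p, fib x) \<in> tbox j a \<delta>"
        using fib[OF x(1,2)] fibL[OF x(1,2)] x(3) pj p(1) by (simp add: tbox_def)
      have "Phi x = (p, fib x)" using x(2) by (simp add: Phi_def)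
      then have "x = inv_into nbhd Phi (p, fib x)" using inv_into_f_f[OF inj_Phi x(1)] by simp
      then have "x = chart_inv (c j) (g (snd (c j) p + fib x (c j)))" using inv_Phi[OF g(1) tb] by simp
      then show "x \<in> dom j \<and> snd (c j) x = g (snd (c j) p + L (fib x (c i)))"
        using good_inverse(1,2)[OF g(1) tb] core_sub(2) fibL[OF x(1,2)] by (metis subsetD)
    qed
  qed
qed

text \<open>The fibre coordinate in the single chart \<open>c i\<close> is injective on the fibre of
  \<open>proj_N\<close>, because \<open>Phi\<close> is; it maps the fibre onto a starlike open
  subset of \<open>F\<close> and thus serves as a global chart.\<close>

lemma leaf_manifold:
  assumes p: "p \<in> N"
  shows "\<exists>Y. connected_integral_manifold E X A W nbhd Y \<and> topspace Y = {x \<in> nbhd. proj_N x = p}"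
proof -
  have pn: "p \<in> nbhd" by (rule Phi_N(1)[OF p])
  obtain i where i: "p \<in> dom i" using nbhd_dom[OF pn] by blast
  have pc: "p \<in> fst (c i)" using i dom_sub by blast
  define \<kappa> where "\<kappa> x = fib x (c i)" for x
  define Lf where "Lf = {x \<in> nbhd. proj_N x = p}"
  have LfD: "x \<in> nbhd" "proj_N x = p" if "x \<in> Lf" for x using that by (simp_all add: Lf_def)
  have fib: "fib x \<in> tangent_space E A p" "fib x \<in> W p" if x: "x \<in> Lf" for x
    using nbhd_dom[OF LfD(1)[OF x]] fib_tangent fib_W LfD(2)[OF x] by blast+
  have \<kappa>F: "\<kappa> x \<in> F" if "x \<in> Lf" for x
    unfolding \<kappa>_def by (rule W_coord_F[OF adapted pc fib(2)[OF that]])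
  have fib_\<kappa>: "fib x = tvec (c i) p (\<kappa> x)" if "x \<in> Lf" for x
    unfolding \<kappa>_def by (rule tangent_space_tvec[OF fib(1)[OF that] cA pc])
  have inj: "inj_on \<kappa> Lf"
  proof (rule inj_onI)
    fix x y assume xy: "x \<in> Lf" "y \<in> Lf" "\<kappa> x = \<kappa> y"
    then have "Phi x = Phi y" using fib_\<kappa> LfD by (simp add: Phi_def)
    then show "x = y" using inj_onD[OF inj_Phi] LfD(1) xy by blast
  qed
  have exists: "\<exists>x\<in>Lf. \<kappa> x = u" if "x \<in> nbhd" "Phi x = (p, tvec (c i) p u)" "u \<in> F" for x u
  proof -
    have "u \<in> E" using that F_E by blast
    then show ?thesis
      using that tvec_self[OF cA pc] by (intro bexI[of _ x]) (simp_all add: \<kappa>_def Lf_def Phi_def)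
  qed
  \<comment> \<open>Defining the topology through \<kappa> makes \<kappa> a homeomorphism onto its
    image, and the topological properties of \<open>Y\<close> are inherited from Euclidean
    space.\<close>
  define Y where "Y = pullback_topology Lf \<kappa> euclidean"
  have openY: "openin Y S \<longleftrightarrow> (\<exists>U. open U \<and> S = {x \<in> Lf. \<kappa> x \<in> U})" for S
  proof -
    have "\<kappa> -` U \<inter> Lf = {x \<in> Lf. \<kappa> x \<in> U}" for U by blast
    then show ?thesis by (simp add: Y_def openin_pullback_topology)
  qed
  have topY: "topspace Y = Lf" by (simp add: Y_def topspace_pullback_topology)
  let ?\<Omega> = "\<kappa> ` Lf"
  have homeo: "homeomorphic_map Y (top_of_set ?\<Omega>) \<kappa>"
  proof (rule bijective_open_imp_homeomorphic_map)
    show "continuous_map Y (top_of_set ?\<Omega>) \<kappa>"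
      unfolding continuous_map_def
    proof (intro conjI allI impI)
      show "\<kappa> \<in> topspace Y \<rightarrow> topspace (top_of_set ?\<Omega>)" by (simp add: topY)
      fix U assume "openin (top_of_set ?\<Omega>) U"
      then obtain U' where "open U'" "U = ?\<Omega> \<inter> U'" by (auto simp: openin_open)
      then show "openin Y {x \<in> topspace Y. \<kappa> x \<in> U}"
        unfolding openY topY by (intro exI[of _ U']) auto
    qed
    show "open_map Y (top_of_set ?\<Omega>) \<kappa>"
      unfolding open_map_def openY openin_open by blast
  qed (simp_all add: topY inj)
  then have hs: "Y homeomorphic_space top_of_set ?\<Omega>" by (rule homeomorphic_map_imp_homeomorphic_space)
  have openL: "open {u. norm (L u) < \<delta>}" if "bounded_linear L" for L :: "'e \<Rightarrow> 'e" and \<delta>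
  proof -
    have "continuous_on UNIV (\<lambda>u. norm (L u))"
      by (intro continuous_on_norm linear_continuous_on that)
    from open_Collect_less[OF this continuous_on_const] show ?thesis by simp
  qed
  have \<Omega>_open: "openin (top_of_set F) ?\<Omega>"
  proof (subst openin_subopen, rule ballI)
    fix u assume "u \<in> ?\<Omega>"
    then obtain q where q: "q \<in> Lf" "u = \<kappa> q" by blast
    obtain j L \<delta> V g where L: "bounded_linear L" "norm (L (fib q (c i))) < \<delta>"
      "\<forall>u\<in>F. norm (L u) < \<delta> \<longrightarrow> snd (c j) p + L u \<in> V \<and> (\<exists>x\<in>nbhd. Phi x = (p, tvec (c i) p u))"
      by (rule leaf_local[OF p pc LfD[OF q(1)]]) (rule that)
    have "F \<inter> {u. norm (L u) < \<delta>} \<subseteq> ?\<Omega>"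
    proof
      fix w assume "w \<in> F \<inter> {u. norm (L u) < \<delta>}"
      then have w: "w \<in> F" "norm (L w) < \<delta>" by simp_all
      then obtain x where "x \<in> nbhd" "Phi x = (p, tvec (c i) p w)" using L(3) by blast
      from exists[OF this w(1)] show "w \<in> ?\<Omega>" by blast
    qed
    moreover have "openin (top_of_set F) (F \<inter> {u. norm (L u) < \<delta>})" using openL[OF L(1)] by (rule openin_open_Int)
    moreover have "u \<in> F \<inter> {u. norm (L u) < \<delta>}" using q \<kappa>F L(2) by (simp add: \<kappa>_def)
    ultimately show "\<exists>T. openin (top_of_set F) T \<and> u \<in> T \<and> T \<subseteq> ?\<Omega>" by blast
  qed
  have "starlike ?\<Omega>"
    unfolding starlike_def
  proof (intro bexI[of _ 0] ballI subsetI)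
    have "p \<in> Lf" using pn proj_N_id[OF p i] by (simp add: Lf_def)
    moreover have "\<kappa> p = 0" using fib_N[OF p i] by (simp add: \<kappa>_def tzero_def)
    ultimately show "0 \<in> ?\<Omega>" by force
    fix u w assume "u \<in> ?\<Omega>" and w: "w \<in> closed_segment 0 u"
    then obtain q where q: "q \<in> Lf" "u = \<kappa> q" by blast
    obtain t where t: "0 \<le> t" "t \<le> 1" "w = t *\<^sub>R u" using w by (auto simp: closed_segment_def)
    obtain j L \<delta> V g where L: "bounded_linear L" "norm (L (fib q (c i))) < \<delta>"
      "\<forall>u\<in>F. norm (L u) < \<delta> \<longrightarrow> snd (c j) p + L u \<in> V \<and> (\<exists>x\<in>nbhd. Phi x = (p, tvec (c i) p u))"
      by (rule leaf_local[OF p pc LfD[OF q(1)]]) (rule that)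
    have "norm (L w) = t * norm (L u)"
      using t by (simp add: linear_cmul[OF bounded_linear.linear[OF L(1)]])
    also have "\<dots> \<le> 1 * norm (L u)" using t by (intro mult_right_mono) auto
    finally have "norm (L w) < \<delta>" using L(2) q(2) by (simp add: \<kappa>_def)
    moreover have wF: "w \<in> F" using t q \<kappa>F by (simp add: subspace_scale[OF subspace_F])
    ultimately obtain x where "x \<in> nbhd" "Phi x = (p, tvec (c i) p w)" using L(3) by blast
    from exists[OF this wF] show "w \<in> ?\<Omega>" by blast
  qed
  then have "connected ?\<Omega>" by (rule starlike_imp_connected)
  then have "connected_space (top_of_set ?\<Omega>)" by (simp add: connectedin_def flip: connectedin_iff_connected)
  then have connY: "connected_space Y" using homeomorphic_connected_space[OF hs] by simp
  have "Hausdorff_space (top_of_set ?\<Omega>)"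
    by (rule Hausdorff_space_subtopology) simp
  then have HY: "Hausdorff_space Y" using homeomorphic_Hausdorff_space[OF hs] by simp
  have SY: "second_countable Y"
  proof -
    obtain \<B> :: "'e set set" where B: "countable \<B>" "\<And>C. C \<in> \<B> \<Longrightarrow> open C"
      "\<And>S. open S \<Longrightarrow> \<exists>U. U \<subseteq> \<B> \<and> S = \<Union>U"
      using univ_second_countable by blast
    let ?B = "(\<lambda>U. {x \<in> Lf. \<kappa> x \<in> U}) ` \<B>"
    show ?thesis
      unfolding second_countable_def
    proof (intro exI[of _ ?B] conjI ballI allI impI)
      show "countable ?B" using B(1) by simp
      show "openin Y V" if "V \<in> ?B" for V unfolding openY using that B(2) by blast
      fix U x assume "openin Y U \<and> x \<in> U"
      then obtain U' where U': "open U'" "U = {x \<in> Lf. \<kappa> x \<in> U'}" "x \<in> U" unfolding openY by blast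
      obtain \<U> where "\<U> \<subseteq> \<B>" "U' = \<Union>\<U>" using B(3)[OF U'(1)] by blast
      then obtain C where "C \<in> \<B>" "\<kappa> x \<in> C" "C \<subseteq> U'" using U'(2,3) by blast
      then have "{x \<in> Lf. \<kappa> x \<in> C} \<in> ?B" "x \<in> {x \<in> Lf. \<kappa> x \<in> C}" "{x \<in> Lf. \<kappa> x \<in> C} \<subseteq> U"
        using U'(2,3) by auto
      then show "\<exists>V\<in>?B. x \<in> V \<and> V \<subseteq> U" by (intro bexI[of _ "{x \<in> Lf. \<kappa> x \<in> C}"] conjI)
    qed
  qed
  define c0 where "c0 = (Lf, \<kappa>)"
  have c0_simps: "fst c0 = Lf" "snd c0 = \<kappa>" by (simp_all add: c0_def)
  have inv0: "chart_inv c0 (\<kappa> x) = x" if "x \<in> Lf" for x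
    unfolding chart_inv_def c0_simps using inj that by (rule inv_into_f_f)
  have atlas0: "smooth_atlas F Y {c0}"
  proof -
    have "smooth_on ?\<Omega> (\<kappa> \<circ> chart_inv c0)"
      by (rule smooth_on_eqI[OF smooth_on_id]) (use inv0 in auto)
    moreover have "openin Y Lf" using openin_topspace[of Y] by (simp add: topY)
    moreover have "subtopology Y Lf = Y" using subtopology_topspace[of Y] by (simp add: topY)
    ultimately show ?thesis
      using \<Omega>_open homeo by (simp add: smooth_atlas_def c0_simps topY)
  qed
  define B where "B = {c. smooth_atlas F Y (insert c {c0})}"
  note max = maximal_atlas[OF subspace_F atlas0, folded B_def]
  have manY: "smooth_manifold F Y B"
    unfolding smooth_manifold_def using subspace_F HY SY max(2,3) by blast
  interpret Y: atlas_space F Y B using subspace_F max(2) by unfold_locales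
  have c0B: "c0 \<in> B" using max(1) by blast
  have main: "(\<exists>c\<in>B. \<exists>d\<in>A. \<exists>G. openin Y G \<and> q \<in> G \<and> G \<subseteq> fst c \<and> id ` (G \<inter> topspace Y) \<subseteq> fst d \<and>
        smooth_on (snd c ` (G \<inter> topspace Y)) (snd d \<circ> id \<circ> chart_inv c)) \<and>
      bij_betw (differential B A id q) (tangent_space F B q) (W q)" if q: "q \<in> Lf" for q
  proof -
    obtain j L \<delta> V g where L: "bounded_linear L" and pj: "p \<in> fst (c j)" and L': "\<forall>u\<in>E. tderiv (c i) (c j) p u = L u"
      and q\<delta>: "norm (L (fib q (c i))) < \<delta>" and g: "smooth_on V g"
      and LV: "\<forall>u\<in>F. norm (L u) < \<delta> \<longrightarrow> snd (c j) p + L u \<in> V \<and> (\<exists>x\<in>nbhd. Phi x = (p, tvec (c i) p u))"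
      and Lx: "\<forall>x\<in>nbhd. proj_N x = p \<longrightarrow> norm (L (fib x (c i))) < \<delta> \<longrightarrow>
       x \<in> dom j \<and> snd (c j) x = g (snd (c j) p + L (fib x (c i)))"
      by (rule leaf_local[OF p pc LfD[OF q]]) (rule that)
    define G where "G = {x \<in> Lf. \<kappa> x \<in> {u. norm (L u) < \<delta>}}"
    have G: "openin Y G" unfolding openY G_def using openL[OF L] by blast
    have qG: "q \<in> G" using q q\<delta> by (simp add: G_def \<kappa>_def)
    have G_Lf: "G \<subseteq> Lf" by (auto simp: G_def)
    have G_c0: "G \<subseteq> fst c0" using G_Lf by (simp add: c0_simps)
    \<comment> \<open>The inclusion of the leaf in coordinates, from the chart \<kappa> to the chart
      \<open>c j\<close>.\<close>
    define m where "m u = g (snd (c j) p + L u)" for u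
    have xG: "x \<in> dom j" "snd (c j) x = m (\<kappa> x)" if x: "x \<in> G" for x
      using Lx LfD[OF subsetD[OF G_Lf x]] x by (auto simp: G_def m_def \<kappa>_def)
    have Gj: "G \<subseteq> fst (c j)" using xG(1) dom_sub by blast
    have SG: "openin (top_of_set F) (\<kappa> ` G)" using Y.openin_image_open[OF c0B G G_c0] by (simp add: c0_simps)
    have m_smooth: "smooth_on (\<kappa> ` G) m"
      unfolding m_def
      by (rule smooth_on_compose[OF g]) (use LV \<kappa>F G_Lf in
          \<open>auto simp: G_def intro!: smooth_on_add smooth_on_const smooth_on_bounded_linear[OF L] smooth_on_id\<close>)
    have m_eq: "(snd (c j) \<circ> id \<circ> chart_inv c0) y = m y" if "y \<in> snd c0 ` G" for y
      using that inv0 G_Lf xG(2) by (auto simp: c0_simps)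
    have m_smooth': "smooth_on (snd c0 ` G) (snd (c j) \<circ> id \<circ> chart_inv c0)"
      by (rule smooth_on_eqI[OF _ m_eq]) (simp add: c0_simps m_smooth)
    have GY: "G \<inter> topspace Y = G" using G_Lf topY by blast
    have qj: "q \<in> fst (c j)" using qG Gj by blast
    have \<kappa>q: "\<kappa> q \<in> \<kappa> ` G" using qG by blast
    obtain M where M: "bounded_linear M" "(m has_derivative M) (at (\<kappa> q) within \<kappa> ` G)"
      "\<And>u. u \<in> F \<Longrightarrow> dir_deriv m (\<kappa> q) u = M u"
      using smooth_on_dir_deriv_linear[OF SG subspace_F m_smooth \<kappa>q] by blast
    have linM: "linear M" by (rule bounded_linear.linear[OF M(1)])
    have line: "\<exists>T. open T \<and> (0::real) \<in> T \<and> (\<forall>t\<in>T. \<exists>x\<in>G. \<kappa> q + t *\<^sub>R u = \<kappa> x)" if u: "u \<in> F" for u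
    proof -
      obtain T where "open T" "(0::real) \<in> T" "\<And>t. t \<in> T \<Longrightarrow> \<kappa> q + t *\<^sub>R u \<in> \<kappa> ` G"
        using line_in_relopen[OF SG subspace_F \<kappa>q u] by blast
      then show ?thesis by (intro exI[of _ T]) blast
    qed
    have m_line: "((\<lambda>t. m (\<kappa> q + t *\<^sub>R u)) has_vector_derivative M u) (at 0)" if u: "u \<in> F" for u
      by (rule has_vector_derivative_dir_deriv[OF SG subspace_F \<kappa>q u M(2)])
    \<comment> \<open>On the leaf \<open>Q\<close> of the coordinate is constantly
      \<open>snd (c j) p\<close>, so \<open>Q\<close> kills the derivative.\<close>
    have MF: "M u \<in> F" if u: "u \<in> F" for u
    proof -
      obtain T where T: "open T" "(0::real) \<in> T" "\<forall>t\<in>T. \<exists>x\<in>G. \<kappa> q + t *\<^sub>R u = \<kappa> x" using line[OF u] by (elim exE conjE) (rule that)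
      have "((\<lambda>t. Q (m (\<kappa> q + t *\<^sub>R u))) has_vector_derivative Q (M u)) (at 0)"
        by (rule bounded_linear.has_vector_derivative[OF bounded_linear_Q m_line[OF u]])
      then have "((\<lambda>t. snd (c j) p) has_vector_derivative Q (M u)) (at 0)"
      proof (rule has_vector_derivative_transform_within_open[OF _ T(1,2)])
        fix t assume "t \<in> T"
        then obtain x where x: "x \<in> G" "\<kappa> q + t *\<^sub>R u = \<kappa> x" using T(3) by blast
        have "Q (snd (c j) x) = snd (c j) p"
          using proj_N_in(3)[OF xG(1)[OF x(1)]] LfD(2)[OF subsetD[OF G_Lf x(1)]] by simp
        then show "Q (m (\<kappa> q + t *\<^sub>R u)) = snd (c j) p" using x(2) xG(2)[OF x(1)] by simp
      qed
      then have "Q (M u) = 0"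
        using vector_derivative_at[of "\<lambda>t. snd (c j) p" "Q (M u)" 0] by simp
      then show ?thesis by (rule Q_eq_0)
    qed
    have qdom: "snd (c j) q \<in> snd (c j) ` dom j" using xG(1)[OF qG] by blast
    obtain D where D: "bounded_linear D" "(loc j has_derivative D) (at (snd (c j) q) within snd (c j) ` dom j)"
      using smooth_on_dir_deriv_linear[OF openin_dom_image subspace_E loc_smooth qdom] by blast
    \<comment> \<open>Along the leaf \<open>loc j\<close> gives back \<kappa> transported by
      \<open>L\<close>. Since \<open>L\<close> is a coordinate change and thus injective on
      \<open>F\<close>, so is \<open>M\<close>; equal dimensions then make \<open>M\<close> a
      bijection of \<open>F\<close>.\<close>
    have DM: "D (M u) = L u" if u: "u \<in> F" for u
    proof -
      obtain T where T: "open T" "(0::real) \<in> T" "\<forall>t\<in>T. \<exists>x\<in>G. \<kappa> q + t *\<^sub>R u = \<kappa> x" using line[OF u] by (elim exE conjE) (rule that)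
      have "((\<lambda>t. loc j (m (\<kappa> q + t *\<^sub>R u))) has_vector_derivative D (M u)) (at 0)"
      proof (rule has_vector_derivative_compose_within[OF m_line[OF u] T(1,2)])
        show "(\<lambda>t. m (\<kappa> q + t *\<^sub>R u)) ` T \<subseteq> snd (c j) ` dom j"
        proof
          fix y assume "y \<in> (\<lambda>t. m (\<kappa> q + t *\<^sub>R u)) ` T"
          then obtain x where "x \<in> G" "y = m (\<kappa> x)" using T(3) by auto
          then show "y \<in> snd (c j) ` dom j" using xG[of x] by (metis image_eqI)
        qed
        show "(loc j has_derivative D) (at (m (\<kappa> q + 0 *\<^sub>R u)) within snd (c j) ` dom j)"
          using D(2) xG(2)[OF qG] by simp
      qed
      then have "((\<lambda>t. L (\<kappa> q) + t *\<^sub>R L u) has_vector_derivative D (M u)) (at 0)"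
      proof (rule has_vector_derivative_transform_within_open[OF _ T(1,2)])
        fix t assume "t \<in> T"
        then obtain x where x: "x \<in> G" "\<kappa> q + t *\<^sub>R u = \<kappa> x" using T(3) by blast
        have xL: "x \<in> Lf" using x(1) G_Lf by blast
        have "loc j (m (\<kappa> x)) = fib x (c j)" using loc_coord[OF xG(1)[OF x(1)]] xG(2)[OF x(1)] by simp
        also have "\<dots> = L (\<kappa> x)"
          using tangent_coord_change[OF fib(1)[OF xL] cA pc cA pj] L' \<kappa>F[OF xL] F_E by (auto simp: \<kappa>_def)
        also have "\<dots> = L (\<kappa> q) + t *\<^sub>R L u"
          unfolding x(2)[symmetric]
          by (simp add: linear_add[OF bounded_linear.linear[OF L]] linear_cmul[OF bounded_linear.linear[OF L]])
        finally show "loc j (m (\<kappa> q + t *\<^sub>R u)) = L (\<kappa> q) + t *\<^sub>R L u" using x(2) by simp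
      qed
      moreover have "((\<lambda>t. L (\<kappa> q) + t *\<^sub>R L u) has_vector_derivative L u) (at 0)"
        by (auto intro!: derivative_eq_intros)
      ultimately show ?thesis by (rule vector_derivative_unique_at)
    qed
    have M_inj: "u = 0" if u: "u \<in> F" and 0: "M u = 0" for u
    proof -
      have uE: "u \<in> E" using u F_E by blast
      have "L u = 0" using DM[OF u] 0 linear_0[OF bounded_linear.linear[OF D(1)]] by simp
      then have "tderiv (c i) (c j) p u = tderiv (c i) (c j) p 0"
        using L' uE subspace_0[OF subspace_E] linear_0[OF bounded_linear.linear[OF L]] by simp
      then have "tderiv (c j) (c i) p (tderiv (c i) (c j) p u) = tderiv (c j) (c i) p (tderiv (c i) (c j) p 0)"
        by simp
      then show "u = 0"
        using tderiv_chain[OF cA cA cA pc pj pc] tderiv_self[OF cA pc] uE subspace_0[OF subspace_E] by simp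
    qed
    have M_inj_on: "inj_on M F"
    proof (rule inj_onI)
      fix u w assume "u \<in> F" "w \<in> F" "M u = M w"
      then show "u = w"
        using M_inj[of "u - w"] subspace_diff[OF subspace_F] by (simp add: linear_diff[OF linM])
    qed
    have M_surj: "M ` F = F"
    proof (rule subspace_dim_equal)
      show "subspace (M ` F)" by (rule linear_subspace_image[OF linM subspace_F])
      show "M ` F \<subseteq> F" using MF by blast
      have "inj_on M (span F)"
        using M_inj_on by (simp only: span_eq_iff[THEN iffD2, OF subspace_F])
      then have "dim (M ` F) = dim F" by (rule dim_image_eq[OF linM])
      then show "dim F \<le> dim (M ` F)" by simp
    qed (rule subspace_F)
    \<comment> \<open>A tangent vector has a coordinate in every chart \<open>d\<close>, so the
      inclusion must be differentiated in all of them; each is reached from \<open>c j\<close> by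
      the chain rule.\<close>
    have diff: "differential B A id q v = tvec (c j) q (M (v c0))" if v: "v \<in> tangent_space F B q" for v
    proof
      fix d
      have vF: "v c0 \<in> F" using Y.tangent_in_E[OF v c0B] q by (simp add: c0_simps)
      show "differential B A id q v d = tvec (c j) q (M (v c0)) d"
      proof (cases "d \<in> A \<and> q \<in> fst d")
        case False
        then show ?thesis by (auto simp: differential_def tvec_def Let_def)
      next
        case True
        then have d: "d \<in> A" "q \<in> fst d" by auto
        obtain T where T: "open T" "snd (c j) ` (fst (c j) \<inter> fst d) = E \<inter> T"
          using openin_transition_domain[OF cA d(1)] by (auto simp: openin_open)
        define G' where "G' = {x \<in> G. m (snd c0 x) \<in> T}"
        have G': "openin Y G'" unfolding G'_def
          by (rule Y.openin_preimage_fun[OF c0B G G_c0 _ T(1)])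
            (use smooth_on_imp_continuous_on[OF m_smooth] in \<open>simp add: c0_simps\<close>)
        have G'G: "G' \<subseteq> G" by (auto simp: G'_def)
        have G'd: "x \<in> fst d" if x: "x \<in> G'" for x
        proof -
          have xg: "x \<in> G" using x G'G by blast
          have xj: "x \<in> fst (c j)" using xg Gj by blast
          have "snd (c j) x \<in> E \<inter> T"
            using x xG(2)[OF xg] chart_in_E[OF cA xj] by (simp add: G'_def c0_simps)
          then obtain x' where "x' \<in> fst (c j)" "x' \<in> fst d" "snd (c j) x = snd (c j) x'" using T(2) by auto
          then show ?thesis using chart_eqI[OF cA xj] by blast
        qed
        have "snd (c j) q \<in> snd (c j) ` (fst (c j) \<inter> fst d)" using qj d(2) by blast
        then have "m (\<kappa> q) \<in> T" using T(2) xG(2)[OF qG] by simp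
        then have qG': "q \<in> G'" using qG by (simp add: G'_def c0_simps)
        have SG': "openin (top_of_set F) (\<kappa> ` G')"
          using Y.openin_image_open[OF c0B G'] G'G G_c0 by (simp add: c0_simps)
        have eq: "(snd d \<circ> id \<circ> chart_inv c0) y = transition (c j) d (m y)" if y: "y \<in> \<kappa> ` G'" for y
        proof -
          obtain x where x: "x \<in> G'" "y = \<kappa> x" using y by blast
          have xg: "x \<in> G" using x G'G by blast
          have "transition (c j) d (snd (c j) x) = snd d x"
            using chart_inv_left[OF cA subsetD[OF Gj xg]] by simp
          then show ?thesis using inv0[OF subsetD[OF G_Lf xg]] xG(2)[OF xg] x(2) by simp
        qed
        have sub: "m ` \<kappa> ` G' \<subseteq> snd (c j) ` (fst (c j) \<inter> fst d)"
        proof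
          fix y assume "y \<in> m ` \<kappa> ` G'"
          then obtain x where x: "x \<in> G'" "y = m (\<kappa> x)" by blast
          have xg: "x \<in> G" using x G'G by blast
          show "y \<in> snd (c j) ` (fst (c j) \<inter> fst d)"
            using xG(2)[OF xg] x(2) G'd[OF x(1)] Gj xg by (intro image_eqI[of _ _ x]) auto
        qed
        have mG': "smooth_on (\<kappa> ` G') m" by (rule smooth_on_subset[OF m_smooth image_mono[OF G'G]])
        have "smooth_on (\<kappa> ` G') (\<lambda>y. transition (c j) d (m y))"
          by (rule smooth_on_compose[OF smooth_transition[OF cA d(1)] mG' sub])
        then have sm: "smooth_on (snd c0 ` G') (snd d \<circ> id \<circ> chart_inv c0)"
          unfolding c0_simps by (rule smooth_on_eqI[OF _ eq])
        have "differential B A id q v d = dir_deriv (snd d \<circ> id \<circ> chart_inv c0) (\<kappa> q) (v c0)"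
          using Y.differential_coord[OF c0B G' _ qG' d(1) _ sm v] G'G G_c0 d(2) by (simp add: c0_simps)
        also have "\<dots> = dir_deriv (\<lambda>y. transition (c j) d (m y)) (\<kappa> q) (v c0)"
          by (rule dir_deriv_cong[OF SG' subspace_F _ vF eq]) (use qG' in blast)
        also have "\<dots> = dir_deriv (transition (c j) d) (m (\<kappa> q)) (dir_deriv m (\<kappa> q) (v c0))"
          by (rule dir_deriv_compose[OF SG' subspace_F mG' _ vF openin_transition_domain[OF cA d(1)] subspace_E
                smooth_transition[OF cA d(1)] sub]) (use qG' in blast)
        also have "\<dots> = tvec (c j) q (M (v c0)) d"
          using M(3)[OF vF] xG(2)[OF qG] d by (simp add: tvec_def tderiv_def)
        finally show ?thesis .
      qed
    qed
    have qc0: "q \<in> fst c0" using q by (simp add: c0_simps)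
    have "bij_betw (differential B A id q) (tangent_space F B q) (W q)"
      unfolding bij_betw_def
    proof
      show "inj_on (differential B A id q) (tangent_space F B q)"
      proof (rule inj_onI)
        fix v w assume v: "v \<in> tangent_space F B q" and w: "w \<in> tangent_space F B q"
          and eq: "differential B A id q v = differential B A id q w"
        have vw: "v c0 \<in> F" "w c0 \<in> F"
          by (rule Y.tangent_in_E[OF v c0B qc0], rule Y.tangent_in_E[OF w c0B qc0])
        have ME: "M (v c0) \<in> E" "M (w c0) \<in> E" using MF vw F_E by blast+
        have "tvec (c j) q (M (v c0)) (c j) = tvec (c j) q (M (w c0)) (c j)"
          using eq diff[OF v] diff[OF w] by simp
        then have "M (v c0) = M (w c0)" using tvec_self[OF cA qj] ME by simp
        then have "v c0 = w c0" using inj_onD[OF M_inj_on _ vw] by blast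
        then show "v = w" by (rule Y.tangent_space_eqI[OF v w c0B qc0])
      qed
      show "differential B A id q ` tangent_space F B q = W q"
      proof (intro equalityI subsetI)
        fix w assume "w \<in> differential B A id q ` tangent_space F B q"
        then obtain v where v: "v \<in> tangent_space F B q" "w = differential B A id q v" by blast
        have "M (v c0) \<in> F" by (rule MF[OF Y.tangent_in_E[OF v(1) c0B qc0]])
        then show "w \<in> W q" unfolding v(2) diff[OF v(1)] by (rule adapted_tvec_W[OF adapted qj])
      next
        fix w assume w: "w \<in> W q"
        have "q \<in> topspace X" using chart_subset[OF cA] qj by blast
        then have wT: "w \<in> tangent_space E A q" using w W_tangent by blast
        obtain u where u: "u \<in> F" "M u = w (c j)" using W_coord_F[OF adapted qj w] M_surj by (metis imageE)
        let ?v = "Y.tvec c0 q u"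
        have v: "?v \<in> tangent_space F B q" "?v c0 = u"
          by (rule Y.tvec_in_tangent_space[OF c0B qc0 u(1)], rule Y.tvec_self[OF c0B qc0 u(1)])
        have "differential B A id q ?v = tvec (c j) q (w (c j))" using diff[OF v(1)] v(2) u(2) by simp
        also have "\<dots> = w" by (rule tangent_space_tvec[OF wT cA qj, symmetric])
        finally show "w \<in> differential B A id q ` tangent_space F B q" using v(1) by (metis image_eqI)
      qed
    qed
    moreover have "id ` (G \<inter> topspace Y) \<subseteq> fst (c j)" using Gj by auto
    moreover have "smooth_on (snd c0 ` (G \<inter> topspace Y)) (snd (c j) \<circ> id \<circ> chart_inv c0)"
      unfolding GY by (rule m_smooth')
    ultimately show ?thesis
      using c0B cA[of j] G qG G_c0 by (intro conjI bexI[of _ c0] bexI[of _ "c j"] exI[of _ G])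
  qed
  have "connected_integral_manifold E X A W nbhd Y"
    unfolding connected_integral_manifold_def
  proof (intro conjI exI ballI)
    show "topspace Y \<subseteq> nbhd" using LfD(1) by (auto simp: topY)
    show "connected_space Y" by (rule connY)
    show "smooth_manifold F Y B" by (rule manY)
    show "smooth_map_on Y B A (topspace Y) id"
      unfolding smooth_map_on_def using main by (auto simp only: topY)
    show "bij_betw (differential B A id q) (tangent_space F B q) (W q)" if "q \<in> topspace Y" for q
      using main that by (simp only: topY)
  qed
  then show ?thesis using topY unfolding Lf_def by blast
qed

text \<open>Every connected integral manifold through \<open>p\<close> stays in one fibre of
  \<open>proj_N\<close>, and that fibre is itself such a manifold, so the union is the
  fibre.\<close>

lemma leaf_in_eq:
  assumes p: "p \<in> N"
  shows "leaf_in E X A W nbhd p = {x \<in> nbhd. proj_N x = p}"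
proof
  obtain i where i: "p \<in> dom i" using nbhd_dom[OF Phi_N(1)[OF p]] by blast
  have pp: "proj_N p = p" by (rule proj_N_id[OF p i])
  show "leaf_in E X A W nbhd p \<subseteq> {x \<in> nbhd. proj_N x = p}"
  proof
    fix x assume "x \<in> leaf_in E X A W nbhd p"
    then obtain Y where Y: "connected_integral_manifold E X A W nbhd Y" "p \<in> topspace Y" "x \<in> topspace Y"
      unfolding leaf_in_def by blast
    then have "x \<in> nbhd" unfolding connected_integral_manifold_def by blast
    then show "x \<in> {x \<in> nbhd. proj_N x = p}" using integral_manifold_proj_N_const[OF Y] pp by simp
  qed
  obtain Y where "connected_integral_manifold E X A W nbhd Y" "topspace Y = {x \<in> nbhd. proj_N x = p}"
    using leaf_manifold[OF p] by blast
  moreover have "p \<in> {x \<in> nbhd. proj_N x = p}" using Phi_N(1)[OF p] pp by simp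
  ultimately show "{x \<in> nbhd. proj_N x = p} \<subseteq> leaf_in E X A W nbhd p"
    unfolding leaf_in_def by blast
qed

lemma Phi_leaf:
  assumes p: "p \<in> N"
  shows "Phi ` leaf_in E X A W nbhd p = Phi ` nbhd \<inter> ({p} \<times> W p)"
proof -
  have "fib x \<in> W (proj_N x)" if "x \<in> nbhd" for x using nbhd_dom[OF that] fib_W by blast
  then show ?thesis unfolding leaf_in_eq[OF p] by (force simp: Phi_def)
qed

end

text \<open>A Lindelof argument: among the sets of a countable basis, those contained in the quarter
  ball of some adapted chart cover \<open>N\<close>, and one such chart is chosen for each.
  Nonemptiness of \<open>N\<close> provides at least one chart to enumerate.\<close>

lemma (in foliated_submanifold) adapted_sequence:
  assumes "second_countable X" "N \<noteq> {}"
  shows "\<exists>c r. (\<forall>i::nat. adapted (c i) (r i)) \<and> (\<forall>p\<in>N. \<exists>i. p \<in> fst (c i) \<and> norm (snd (c i) p) < r i / 4)"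
proof -
  obtain \<B> where \<B>: "countable \<B>" "\<And>U x. openin X U \<Longrightarrow> x \<in> U \<Longrightarrow> \<exists>V\<in>\<B>. x \<in> V \<and> V \<subseteq> U"
    using assms(1) unfolding second_countable_def by (elim exE conjE) (rule that, blast+)
  define R where "R V z \<longleftrightarrow> adapted (fst z) (snd z) \<and> V \<subseteq> {q \<in> fst (fst z). norm (snd (fst z) q) < snd z / 4}" for V z
  define \<B>' where "\<B>' = {V \<in> \<B>. \<exists>z. R V z}"
  define z where "z V = (SOME z. R V z)" for V
  have z: "R V (z V)" if V: "V \<in> \<B>'" for V
  proof -
    have "\<exists>z. R V z" using V by (simp add: \<B>'_def)
    then show ?thesis unfolding z_def by (rule someI_ex)
  qed
  have cover: "\<exists>V\<in>\<B>'. p \<in> V" if p: "p \<in> N" for p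
  proof -
    obtain c r where c: "adapted c r" "p \<in> fst c" "snd c p = 0" using adapted_chart_exists[OF p] by blast
    then have cA: "c \<in> A" "0 < r" by (simp_all add: adapted_def)
    have "openin X {q \<in> fst c. snd c q \<in> ball 0 (r / 4)}" by (rule openin_preimage[OF cA(1) open_ball])
    moreover have "p \<in> {q \<in> fst c. snd c q \<in> ball 0 (r / 4)}" using c cA(2) by simp
    ultimately obtain V where V: "V \<in> \<B>" "p \<in> V" "V \<subseteq> {q \<in> fst c. snd c q \<in> ball 0 (r / 4)}"
      using \<B>(2) by blast
    then have "R V (c, r)" using c(1) by (auto simp: R_def)
    then have "V \<in> \<B>'" using V(1) unfolding \<B>'_def by blast
    then show ?thesis using V(2) by blast
  qed
  have ne: "\<B>' \<noteq> {}" using cover assms(2) by blast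
  have cnt: "countable \<B>'" using \<B>(1) by (rule countable_subset[rotated]) (auto simp: \<B>'_def)
  let ?V = "\<lambda>i. from_nat_into \<B>' i"
  show ?thesis
  proof (intro exI[of _ "\<lambda>i. fst (z (?V i))"] exI[of _ "\<lambda>i. snd (z (?V i))"] conjI allI ballI)
    show "adapted (fst (z (?V i))) (snd (z (?V i)))" for i
      using z[OF from_nat_into[OF ne]] unfolding R_def by blast
    fix p assume "p \<in> N"
    then obtain V where V: "V \<in> \<B>'" "p \<in> V" using cover by blast
    obtain i where "?V i = V" using from_nat_into_surj[OF cnt V(1)] by blast
    then have "p \<in> fst (fst (z (?V i))) \<and> norm (snd (fst (z (?V i))) p) < snd (z (?V i)) / 4"
      using z[OF V(1)] V(2) by (auto simp: R_def)
    then show "\<exists>i. p \<in> fst (fst (z (?V i))) \<and> norm (snd (fst (z (?V i))) p) < snd (z (?V i)) / 4" by blast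
  qed
qed

theorem theorem2:
  fixes E :: "'e::euclidean_space set"
    and X :: "'a topology"
    and A :: "('a, 'e) chart set"
    and W :: "'a \<Rightarrow> ('a, 'e) tvec set"
    and N :: "'a set"
    and k n :: nat
  assumes "smooth_manifold E X A"
    and "distribution E X A k W"
    and "integrable_distribution E X A W"
    and "embedded_submanifold E X A n N"
    and "complementary E A W N"
  shows "\<exists>U \<phi>.
    openin X U \<and> N \<subseteq> U \<and>
    openin (subtopology (tb_topology E A) (restricted_bundle W N)) (\<phi> ` U) \<and>
    zero_section ` N \<subseteq> \<phi> ` U \<and>
    diffeomorphism_on X A (tb_topology E A) (tb_atlas E A) U (\<phi> ` U) \<phi> \<and>
    (\<forall>p\<in>N. \<phi> p = zero_section p) \<and>
    (\<forall>p\<in>N. \<forall>a\<in>sub_tangent_space A N p. \<forall>b\<in>W p.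
       differential A (tb_atlas E A) \<phi> p (tadd a b) =
       tadd (differential A (tb_atlas E A) zero_section p a) (vertical_lift E A p b)) \<and>
    (\<forall>p\<in>N. \<phi> ` leaf_in E X A W U p = \<phi> ` U \<inter> ({p} \<times> W p))"
proof (cases "N = {}")
  \<comment> \<open>Without points of \<open>N\<close> there may be no adapted chart, hence no
    sequence of charts; the empty neighbourhood works.\<close>
  case True
  have "diffeomorphism_on X A (tb_topology E A) (tb_atlas E A) {} {} zero_section"
    by (simp add: diffeomorphism_on_def smooth_map_on_def bij_betw_def)
  then show ?thesis using True by (intro exI[of _ "{}"] exI[of _ zero_section]) simp
next
  case False
  obtain F \<F> where F: "foliated_atlas E X A F \<F>" and WF: "\<And>c q. c \<in> \<F> \<Longrightarrow> q \<in> fst c \<Longrightarrow> (\<lambda>v. v c) ` W q = F"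
    using assms(3) unfolding integrable_distribution_def by blast
  interpret foliated_submanifold E X A W N F
  proof
    show "subspace E" "smooth_atlas E X A" using assms(1) by (simp_all add: smooth_manifold_def)
    show "c \<in> A" if "smooth_atlas E X (insert c A)" for c
      using assms(1) that unfolding smooth_manifold_def by blast
    show "subspace F" "F \<subseteq> E" using F by (simp_all add: foliated_atlas_def)
    show "\<exists>c\<in>A. p \<in> fst c \<and> (\<forall>q\<in>fst c. (\<lambda>v. v c) ` W q = F)" if "p \<in> topspace X" for p
    proof -
      have "p \<in> (\<Union>c\<in>\<F>. fst c)" using F that by (simp add: foliated_atlas_def)
      then obtain c where "c \<in> \<F>" "p \<in> fst c" by blast
      moreover have "\<F> \<subseteq> A" using F by (simp add: foliated_atlas_def)
      ultimately show ?thesis using WF by blast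
    qed
    show "W p \<subseteq> tangent_space E A p" if "p \<in> topspace X" for p
      using assms(2) that by (simp add: distribution_def)
    show "N \<subseteq> topspace X" using assms(4) by (simp add: embedded_submanifold_def)
    show "\<exists>c\<in>A. \<exists>S. p \<in> fst c \<and> subspace S \<and> S \<subseteq> E \<and> snd c ` (fst c \<inter> N) = snd c ` fst c \<inter> S"
      if "p \<in> N" for p
      using assms(4) that unfolding embedded_submanifold_def by blast
    show "complementary E A W N" by fact
  qed
  obtain s :: "real \<Rightarrow> real" where s: "smooth_on UNIV s" "\<forall>t\<le>0. s t = 0" "\<forall>t\<ge>1. s t = 1"
    by (rule smooth_cutoff) (rule that, auto)
  have "second_countable X" using assms(1) by (simp add: smooth_manifold_def)
  then obtain c r where c: "\<forall>i::nat. adapted (c i) (r i)"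
    "\<forall>p\<in>N. \<exists>i. p \<in> fst (c i) \<and> norm (snd (c i) p) < r i / 4"
    using adapted_sequence[OF _ False] by blast
  interpret tube E X A W N F c r s
  proof
    show "Hausdorff_space X" using assms(1) by (simp add: smooth_manifold_def)
  qed (use c s in blast)+
  show ?thesis
  proof (intro exI[of _ nbhd] exI[of _ Phi] conjI ballI)
    show "openin X nbhd" by (rule openin_nbhd)
    show "N \<subseteq> nbhd" using Phi_N(1) by blast
    show "openin (subtopology (tb_topology E A) (restricted_bundle W N)) (Phi ` nbhd)"
      unfolding Phi_nbhd by (rule openin_target)
    show "zero_section ` N \<subseteq> Phi ` nbhd"
    proof (rule image_subsetI)
      fix p assume "p \<in> N"
      then show "zero_section p \<in> Phi ` nbhd" using Phi_N by (metis image_eqI)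
    qed
    show "diffeomorphism_on X A (tb_topology E A) (tb_atlas E A) nbhd (Phi ` nbhd) Phi"
      by (rule Phi_diffeomorphism)
    show "Phi p = zero_section p" if "p \<in> N" for p by (rule Phi_N(2)[OF that])
    show "differential A (tb_atlas E A) Phi p (tadd a b) =
       tadd (differential A (tb_atlas E A) zero_section p a) (vertical_lift E A p b)"
      if "p \<in> N" "a \<in> sub_tangent_space A N p" "b \<in> W p" for p a b
      by (rule Phi_differential[OF that])
    show "Phi ` leaf_in E X A W nbhd p = Phi ` nbhd \<inter> ({p} \<times> W p)" if "p \<in> N" for p
      by (rule Phi_leaf[OF that])
  qed
qed

end
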